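(* Let $d \geq 2$, let $z_1, z_2, z_3 \in \mathbb{B}^d$ be pairwise distinct points, and let $\zeta_1, \zeta_2, \zeta_3 \in \mathbb{D}$ be (not necessarily pairwise distinct) numbers. Suppose that the 3-point Nevanlinna-Pick interpolation problem $\mathbb{B}^d \ni z_j \mapsto \zeta_j \in \mathbb{D}$, $j = 1,2,3$, is extremal. Then its solution is not unique: there exist two distinct holomorphic functions $f, g : \mathbb{B}^d \to \mathbb{D}$, $f \neq g$, such that $f(z_j) = g(z_j) = \zeta_j$ for $j = 1, 2, 3$.
   Context: $\mathbb{D} = \{\lambda \in \mathbb{C} : |\lambda| < 1\}$ is the open unit disc and $\mathbb{B}^d = \{z \in \mathbb{C}^d : |z_1|^2 + \dots + |z_d|^2 < 1\}$ is the open complex unit Euclidean ball. Given pairwise distinct points $z_1, z_2, z_3 \in \mathbb{B}^d$ and numbers $\zeta_1, \zeta_2, \zeta_3 \in \mathbb{D}$, a solution of the 3-point Nevanlinna-Pick interpolation problem $z_j \mapsto \zeta_j$ is a holomorphic function $f : \mathbb{B}^d \to \mathbb{D}$ with $f(z_j) = \zeta_j$ for $j = 1, 2, 3$. The problem is called extremal if a solution exists, but there is no solution $f$ whose image $f(\mathbb{B}^d)$ is relatively compact in $\mathbb{D}$ (i.e. no solution $f$ such that the closure of $f(\mathbb{B}^d)$ is contained in $\mathbb{D}$). *)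

theory Defs
  imports "HOL-Complex_Analysis.Complex_Analysis"
begin

(* Holomorphy in several variables: the real Frechet derivative exists and is complex-linear.
   Only meant for open U, where "at z within U" is "at z". *)
definition cn_holomorphic_on :: "(complex ^ 'n \<Rightarrow> complex) \<Rightarrow> (complex ^ 'n) set \<Rightarrow> bool" where
  "cn_holomorphic_on f U \<longleftrightarrow>
     (\<forall>z\<in>U. \<exists>D. (f has_derivative D) (at z within U) \<and> Vector_Spaces.linear (*s) (*) D)"

(* The norm of complex ^ 'n is the Euclidean one, so "ball 0 1" is the Euclidean unit ball. *)
lemma unit_ball_cn: "(ball 0 1 :: (complex ^ 'n) set) = {z. (\<Sum>i\<in>UNIV. (cmod (z $ i))\<^sup>2) < 1}"
  by (simp add: set_eq_iff norm_vec_def L2_set_def)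

(* Nodes and targets are indexed by 1..N; f is a total function of which only the values on
   the ball matter. *)
definition np_solution ::
    "nat \<Rightarrow> (nat \<Rightarrow> complex ^ 'n) \<Rightarrow> (nat \<Rightarrow> complex) \<Rightarrow> (complex ^ 'n \<Rightarrow> complex) \<Rightarrow> bool" where
  "np_solution N z \<zeta> f \<longleftrightarrow>
     cn_holomorphic_on f (ball 0 1) \<and> f ` ball 0 1 \<subseteq> ball 0 1 \<and> (\<forall>j\<in>{1..N}. f (z j) = \<zeta> j)"

definition np_extremal :: "nat \<Rightarrow> (nat \<Rightarrow> complex ^ 'n) \<Rightarrow> (nat \<Rightarrow> complex) \<Rightarrow> bool" where
  "np_extremal N z \<zeta> \<longleftrightarrow>
     (\<exists>f. np_solution N z \<zeta> f) \<and>
     \<not> (\<exists>f. np_solution N z \<zeta> f \<and> closure (f ` ball 0 1) \<subseteq> ball 0 1)"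

end

theory Submission
  imports Defs
begin

text \<open>A solution forces the dual Pick condition: every analytic disc through the points with nodes \<open>l\<^sub>i\<close> makes the scalar
  problem \<open>l\<^sub>i \<mapsto> \<zeta>\<^sub>i\<close> solvable. Scale the targets by the largest factor \<open>T \<ge> 1\<close> for which this condition and the
  three two-point Schwarz-Pick inequalities persist; it suffices to find two solutions of the scaled problem, for if
  \<open>T > 1\<close>, dividing one of them by \<open>T\<close> contradicts extremality.

  If at the threshold one of the two-point inequalities is an equality, the Pick condition degenerates to a Julia inequality
  at a boundary point, and in the Siegel domain the two solutions are written down explicitly. Otherwise the discs that
  violate the condition just beyond the threshold converge to nodes \<open>l\<close> whose scalar problem has a singular Pick
  matrix, hence a Blaschke product of degree two as its solution; in suitable coordinates \<open>\<zeta>\<^sub>i = l\<^sub>i\<^sup>2\<close>. Criticality of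
  \<open>l\<close> under perturbation of the nodes forces the matrix \<open>1 - \<langle>z\<^sub>i, z\<^sub>j\<rangle>\<close> to be that of three points on a disc
  \<open>\<lambda> \<mapsto> (s \<lambda>\<^sup>2, c \<lambda>)\<close>, up to an automorphism of the ball, where \<open>\<lambda>\<^sup>2\<close> has several extensions to the ball.\<close>

section \<open>Holomorphic functions on the ball\<close>

no_notation fps_nth (infixl "$" 75)

text \<open>The dual Pick condition is only known to be necessary, so no solution of the scaled
  problem is given in advance: at the threshold its solutions come out of the two explicit
  constructions. All conditions are stated through matrices because automorphisms of ball and disc
  multiply their entries only by \<open>h i * cnj (h j)\<close>, which positivity does not notice;
  points and targets can thus be normalised freely. The classification rests on the signature of
  \<open>gram z\<close>: it is the all-ones matrix minus a positive semidefinite one. Domination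
  asks \<open>pd\<close> of the points and only \<open>psd\<close> of the targets: the strict
  condition survives small moves of the nodes and leaves room for a disc in the open ball. The
  obstacle is compactness: nodes of violating discs may run to the unit circle. In the limit this
  would make a pair of points extremal, hence the case split. In both constructions the second
  solution adds the square of a function vanishing at the three points, since the available slack is
  of second order as well.\<close>

lemma linear_cn_iff:
  fixes D :: "complex ^ 'n \<Rightarrow> complex"
  shows "Vector_Spaces.linear (*s) (*) D \<longleftrightarrow> (\<forall>x y. D (x + y) = D x + D y) \<and> (\<forall>c x. D (c *s x) = c * D x)"
proof -
  have 1: "vector_space ((*s) :: complex \<Rightarrow> complex ^ 'n \<Rightarrow> complex ^ 'n)" by (rule vec.vector_space_axioms)
  have 2: "vector_space ((*) :: complex \<Rightarrow> complex \<Rightarrow> complex)" by (rule vector_space_over_itself.vector_space_axioms)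
  show ?thesis
    using 1 2 unfolding Vector_Spaces.linear_iff by blast
qed

lemma cn_holomorphic_onI:
  assumes "\<And>z. z \<in> U \<Longrightarrow> (f has_derivative D z) (at z within U)"
    and "\<And>z x y. z \<in> U \<Longrightarrow> D z (x + y) = D z x + D z y"
    and "\<And>z c x. z \<in> U \<Longrightarrow> D z (c *s x) = c * D z x"
  shows "cn_holomorphic_on f U"
  unfolding cn_holomorphic_on_def linear_cn_iff using assms by blast

lemma cn_holomorphic_onE:
  assumes "cn_holomorphic_on f U"
  obtains D where "\<And>z. z \<in> U \<Longrightarrow> (f has_derivative D z) (at z within U)"
    "\<And>z x y. z \<in> U \<Longrightarrow> D z (x + y) = D z x + D z y"
    "\<And>z c x. z \<in> U \<Longrightarrow> D z (c *s x) = c * D z x"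
proof -
  have "\<forall>z. \<exists>D. z \<in> U \<longrightarrow> (f has_derivative D) (at z within U) \<and> (\<forall>x y. D (x + y) = D x + D y) \<and> (\<forall>c x. D (c *s x) = c * D x)"
    using assms unfolding cn_holomorphic_on_def linear_cn_iff by blast
  then obtain D where "\<forall>z. z \<in> U \<longrightarrow> (f has_derivative D z) (at z within U) \<and> (\<forall>x y. D z (x + y) = D z x + D z y) \<and> (\<forall>c x. D z (c *s x) = c * D z x)"
    by metis
  then show ?thesis using that by blast
qed

lemma cn_holomorphic_on_const: "cn_holomorphic_on (\<lambda>z. c) U"
  by (rule cn_holomorphic_onI[where D = "\<lambda>z h. 0"]) auto

lemma cn_holomorphic_on_add:
  assumes "cn_holomorphic_on f U" "cn_holomorphic_on g U"
  shows "cn_holomorphic_on (\<lambda>z. f z + g z) U"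
proof -
  obtain D where D: "\<And>z. z \<in> U \<Longrightarrow> (f has_derivative D z) (at z within U)"
    "\<And>z x y. z \<in> U \<Longrightarrow> D z (x + y) = D z x + D z y"
    "\<And>z c x. z \<in> U \<Longrightarrow> D z (c *s x) = c * D z x"
    using cn_holomorphic_onE[OF assms(1)] by blast
  obtain E where E: "\<And>z. z \<in> U \<Longrightarrow> (g has_derivative E z) (at z within U)"
    "\<And>z x y. z \<in> U \<Longrightarrow> E z (x + y) = E z x + E z y"
    "\<And>z c x. z \<in> U \<Longrightarrow> E z (c *s x) = c * E z x"
    using cn_holomorphic_onE[OF assms(2)] by blast
  show ?thesis
    by (rule cn_holomorphic_onI[where D = "\<lambda>z h. D z h + E z h"])
      (use D E in \<open>auto intro!: derivative_eq_intros simp: algebra_simps\<close>)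
qed

lemma cn_holomorphic_on_mult:
  assumes "cn_holomorphic_on f U" "cn_holomorphic_on g U"
  shows "cn_holomorphic_on (\<lambda>z. f z * g z) U"
proof -
  obtain D where D: "\<And>z. z \<in> U \<Longrightarrow> (f has_derivative D z) (at z within U)"
    "\<And>z x y. z \<in> U \<Longrightarrow> D z (x + y) = D z x + D z y"
    "\<And>z c x. z \<in> U \<Longrightarrow> D z (c *s x) = c * D z x"
    using cn_holomorphic_onE[OF assms(1)] by blast
  obtain E where E: "\<And>z. z \<in> U \<Longrightarrow> (g has_derivative E z) (at z within U)"
    "\<And>z x y. z \<in> U \<Longrightarrow> E z (x + y) = E z x + E z y"
    "\<And>z c x. z \<in> U \<Longrightarrow> E z (c *s x) = c * E z x"
    using cn_holomorphic_onE[OF assms(2)] by blast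
  show ?thesis
  proof (rule cn_holomorphic_onI[where D = "\<lambda>z h. f z * E z h + D z h * g z"])
    show "((\<lambda>z. f z * g z) has_derivative (\<lambda>h. f z * E z h + D z h * g z)) (at z within U)" if "z \<in> U" for z
      by (rule has_derivative_mult[OF D(1)[OF that] E(1)[OF that]])
  qed (use D E in \<open>auto simp: algebra_simps\<close>)
qed

lemma cn_holomorphic_on_compose_field:
  assumes f: "cn_holomorphic_on f U" and h: "h holomorphic_on V" and "open V" and sub: "f ` U \<subseteq> V"
  shows "cn_holomorphic_on (\<lambda>z. h (f z)) U"
proof -
  obtain D where D: "\<And>z. z \<in> U \<Longrightarrow> (f has_derivative D z) (at z within U)"
    "\<And>z x y. z \<in> U \<Longrightarrow> D z (x + y) = D z x + D z y"
    "\<And>z c x. z \<in> U \<Longrightarrow> D z (c *s x) = c * D z x"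
    using cn_holomorphic_onE[OF f] by blast
  have h': "(h has_field_derivative deriv h w) (at w)" if "w \<in> V" for w
    using holomorphic_derivI[OF h \<open>open V\<close> that] .
  show ?thesis
  proof (rule cn_holomorphic_onI[where D = "\<lambda>z x. deriv h (f z) * D z x"])
    fix z assume z: "z \<in> U"
    then have "f z \<in> V" using sub by auto
    from has_derivative_compose[OF D(1)[OF z] has_field_derivative_imp_has_derivative[OF h'[OF this]]]
    show "((\<lambda>z. h (f z)) has_derivative (\<lambda>x. deriv h (f z) * D z x)) (at z within U)" .
  qed (use D in \<open>auto simp: algebra_simps\<close>)
qed

lemma cn_holomorphic_on_divide:
  assumes "cn_holomorphic_on f U" "cn_holomorphic_on g U" "\<And>z. z \<in> U \<Longrightarrow> g z \<noteq> 0"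
  shows "cn_holomorphic_on (\<lambda>z. f z / g z) U"
proof -
  have "cn_holomorphic_on (\<lambda>z. inverse (g z)) U"
    by (rule cn_holomorphic_on_compose_field[where V = "- {0}" and h = inverse])
      (use assms in \<open>auto intro!: holomorphic_intros\<close>)
  then show ?thesis
    using cn_holomorphic_on_mult[OF assms(1)] by (simp add: divide_inverse)
qed

lemma cn_holomorphic_on_minus:
  "cn_holomorphic_on f U \<Longrightarrow> cn_holomorphic_on (\<lambda>z. - f z) U"
  using cn_holomorphic_on_mult[OF cn_holomorphic_on_const[of "-1"]] by simp

lemma cn_holomorphic_on_diff:
  assumes "cn_holomorphic_on f U" "cn_holomorphic_on g U"
  shows "cn_holomorphic_on (\<lambda>z. f z - g z) U"
  using cn_holomorphic_on_add[OF assms(1) cn_holomorphic_on_minus[OF assms(2)]] by simp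

lemma cn_holomorphic_on_power:
  "cn_holomorphic_on f U \<Longrightarrow> cn_holomorphic_on (\<lambda>z. f z ^ n) U"
  by (induction n) (auto intro: cn_holomorphic_on_mult cn_holomorphic_on_const)

lemma cn_holomorphic_on_sum:
  "(\<And>i. i \<in> I \<Longrightarrow> cn_holomorphic_on (f i) U) \<Longrightarrow> cn_holomorphic_on (\<lambda>z. \<Sum>i\<in>I. f i z) U"
  by (induction I rule: infinite_finite_induct) (auto intro!: cn_holomorphic_on_add cn_holomorphic_on_const)

lemma cn_holomorphic_on_nth: "cn_holomorphic_on (\<lambda>z. z $ i) U"
  by (rule cn_holomorphic_onI[where D = "\<lambda>z h. h $ i"])
    (auto intro!: bounded_linear_imp_has_derivative bounded_linear_vec_nth)

lemmas cn_holomorphic_intros =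
  cn_holomorphic_on_const cn_holomorphic_on_nth cn_holomorphic_on_add cn_holomorphic_on_diff
  cn_holomorphic_on_mult cn_holomorphic_on_minus cn_holomorphic_on_power cn_holomorphic_on_divide cn_holomorphic_on_sum

lemma has_derivative_vec_nthI:
  fixes \<Phi> :: "'a::real_normed_vector \<Rightarrow> complex ^ 'n"
  assumes "\<And>i. ((\<lambda>x. \<Phi> x $ i) has_derivative D i) (at x within S)"
  shows "(\<Phi> has_derivative (\<lambda>h. \<chi> i. D i h)) (at x within S)"
proof -
  have ax: "bounded_linear (axis i :: complex \<Rightarrow> complex ^ 'n)" for i
    by (intro linear_conv_bounded_linear[THEN iffD1] linearI)
      (auto simp: axis_def vec_eq_iff)
  have e: "v = (\<Sum>i\<in>UNIV. axis i (v $ i))" for v :: "complex ^ 'n"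
    by (simp add: vec_eq_iff axis_def if_distrib cong: if_cong)
  have "((\<lambda>x. \<Sum>i\<in>UNIV. axis i (\<Phi> x $ i)) has_derivative (\<lambda>h. \<Sum>i\<in>UNIV. axis i (D i h))) (at x within S)"
    by (intro has_derivative_sum bounded_linear.has_derivative[OF ax] assms)
  moreover have "(\<lambda>x. \<Sum>i\<in>UNIV. axis i (\<Phi> x $ i)) = \<Phi>" by (simp add: e[symmetric])
  moreover have "(\<lambda>h. \<Sum>i\<in>UNIV. axis i (D i h)) = (\<lambda>h. \<chi> i. D i h)"
    using e[of "\<chi> i. D i _"] by simp
  ultimately show ?thesis by simp
qed

lemma cn_holomorphic_on_compose_vec:
  assumes f: "cn_holomorphic_on f V" and \<Phi>: "\<And>i. cn_holomorphic_on (\<lambda>z. \<Phi> z $ i) U" and sub: "\<Phi> ` U \<subseteq> V"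
  shows "cn_holomorphic_on (\<lambda>z. f (\<Phi> z)) U"
proof -
  obtain D where D: "\<And>z. z \<in> V \<Longrightarrow> (f has_derivative D z) (at z within V)"
    "\<And>z x y. z \<in> V \<Longrightarrow> D z (x + y) = D z x + D z y"
    "\<And>z c x. z \<in> V \<Longrightarrow> D z (c *s x) = c * D z x"
    using cn_holomorphic_onE[OF f] by blast
  have "\<forall>i. \<exists>E. (\<forall>z\<in>U. ((\<lambda>z. \<Phi> z $ i) has_derivative E z) (at z within U)) \<and>
     (\<forall>z\<in>U. (\<forall>x y. E z (x + y) = E z x + E z y) \<and> (\<forall>c x. E z (c *s x) = c * E z x))"
    by (metis cn_holomorphic_onE[OF \<Phi>])
  then obtain E where E: "\<And>i z. z \<in> U \<Longrightarrow> ((\<lambda>z. \<Phi> z $ i) has_derivative E i z) (at z within U)"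
    "\<And>i z x y. z \<in> U \<Longrightarrow> E i z (x + y) = E i z x + E i z y" "\<And>i z c x. z \<in> U \<Longrightarrow> E i z (c *s x) = c * E i z x"
    by metis
  show ?thesis
  proof (rule cn_holomorphic_onI[where D = "\<lambda>z h. D (\<Phi> z) (\<chi> i. E i z h)"])
    fix z assume z: "z \<in> U"
    have "(\<Phi> has_derivative (\<lambda>h. \<chi> i. E i z h)) (at z within U)"
      by (intro has_derivative_vec_nthI E z)
    moreover have "(f has_derivative D (\<Phi> z)) (at (\<Phi> z) within \<Phi> ` U)"
      using D(1) sub z by (meson has_derivative_subset image_subset_iff)
    ultimately show "((\<lambda>z. f (\<Phi> z)) has_derivative (\<lambda>h. D (\<Phi> z) (\<chi> i. E i z h))) (at z within U)"
      by (rule has_derivative_in_compose)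
  next
    fix z x y assume z: "z \<in> U"
    have e: "(\<chi> i. E i z x + E i z y) = (\<chi> i. E i z x) + (\<chi> i. E i z y)" by (simp add: vec_eq_iff)
    show "D (\<Phi> z) (\<chi> i. E i z (x + y)) = D (\<Phi> z) (\<chi> i. E i z x) + D (\<Phi> z) (\<chi> i. E i z y)"
      using D(2) E(2) z sub by (simp add: e image_subset_iff)
  next
    fix z c x assume z: "z \<in> U"
    have e: "(\<chi> i. c * E i z x) = c *s (\<chi> i. E i z x)" by (simp add: vec_eq_iff)
    show "D (\<Phi> z) (\<chi> i. E i z (c *s x)) = c * D (\<Phi> z) (\<chi> i. E i z x)"
      using D(3) E(3) z sub by (simp add: e image_subset_iff)
  qed
qed

lemma holomorphic_on_compose_disc:
  assumes f: "cn_holomorphic_on f V" and \<phi>: "\<And>i. (\<lambda>w. \<phi> w $ i) holomorphic_on U" and "open U"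
    and sub: "\<phi> ` U \<subseteq> V"
  shows "(\<lambda>w. f (\<phi> w)) holomorphic_on U"
proof (rule holomorphic_onI)
  fix w assume w: "w \<in> U"
  obtain D where D: "\<And>z. z \<in> V \<Longrightarrow> (f has_derivative D z) (at z within V)"
    "\<And>z x y. z \<in> V \<Longrightarrow> D z (x + y) = D z x + D z y"
    "\<And>z c x. z \<in> V \<Longrightarrow> D z (c *s x) = c * D z x"
    using cn_holomorphic_onE[OF f] by blast
  let ?d = "\<chi> i. deriv (\<lambda>w. \<phi> w $ i) w"
  have "((\<lambda>w. \<phi> w $ i) has_derivative (*) (deriv (\<lambda>w. \<phi> w $ i) w)) (at w within U)" for i
    using holomorphic_derivI[OF \<phi> \<open>open U\<close> w, of i U] by (rule has_field_derivative_imp_has_derivative)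
  from has_derivative_vec_nthI[OF this] have "(\<phi> has_derivative (\<lambda>h. h *s ?d)) (at w within U)"
    by (auto elim!: has_derivative_eq_rhs simp: vec_eq_iff fun_eq_iff)
  moreover have "(f has_derivative D (\<phi> w)) (at (\<phi> w) within \<phi> ` U)"
    using D(1) sub w by (meson has_derivative_subset image_subset_iff)
  ultimately have "((\<lambda>w. f (\<phi> w)) has_derivative (\<lambda>h. D (\<phi> w) (h *s ?d))) (at w within U)"
    by (rule has_derivative_in_compose)
  moreover have "(\<lambda>h. D (\<phi> w) (h *s ?d)) = (*) (D (\<phi> w) ?d)"
    using D(3) sub w by (auto simp: fun_eq_iff image_subset_iff)
  ultimately show "(\<lambda>w. f (\<phi> w)) field_differentiable at w within U"
    by (auto simp: field_differentiable_def has_field_derivative_def)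
qed

section \<open>Hermitian inner product and automorphisms of the ball\<close>

definition cip :: "complex ^ 'n \<Rightarrow> complex ^ 'n \<Rightarrow> complex" where
  "cip z w = (\<Sum>i\<in>UNIV. z $ i * cnj (w $ i))"

lemma cip_add_left: "cip (x + y) z = cip x z + cip y z"
  and cip_diff_left: "cip (x - y) z = cip x z - cip y z"
  and cip_scale_left: "cip (c *s x) z = c * cip x z"
  and cip_add_right: "cip z (x + y) = cip z x + cip z y"
  and cip_diff_right: "cip z (x - y) = cip z x - cip z y"
  and cip_scale_right: "cip z (c *s x) = cnj c * cip z x"
  by (simp_all add: cip_def algebra_simps sum.distrib sum_subtractf sum_distrib_left)

lemma cip_zero_left [simp]: "cip 0 z = 0" and cip_zero_right [simp]: "cip z 0 = 0"
  by (simp_all add: cip_def)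

lemmas cip_simps = cip_add_left cip_diff_left cip_scale_left cip_add_right cip_diff_right cip_scale_right

lemma cnj_cip: "cnj (cip z w) = cip w z"
  by (simp add: cip_def mult.commute)

lemma cip_self: "cip z z = complex_of_real ((norm z)\<^sup>2)"
  by (simp add: cip_def norm_vec_def L2_set_def sum_nonneg complex_norm_square del: of_real_power)

lemma of_real_cmod_sq: "(complex_of_real (cmod z))\<^sup>2 = z * cnj z"
  by (simp add: complex_norm_square flip: of_real_power)

lemma norm_cscale: "norm (c *s x) = cmod c * norm x"
  by (simp add: norm_vec_def L2_set_right_distrib norm_mult)

lemma norm_diff_sq_cip: "(norm (x - y))\<^sup>2 = (norm x)\<^sup>2 + (norm y)\<^sup>2 - 2 * Re (cip x y)"
proof -
  have "cip (x - y) (x - y) = cip x x + cip y y - (cip x y + cnj (cip x y))"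
    by (simp add: cip_simps cnj_cip)
  then have "Re (cip (x - y) (x - y)) = Re (cip x x + cip y y - (cip x y + cnj (cip x y)))"
    by simp
  then show ?thesis by (simp add: cip_self)
qed

lemma cip_bound: "cmod (cip z w) \<le> norm z * norm w"
proof (cases "norm w = 0")
  case False
  then have w: "norm w > 0" by simp
  define n where "n = complex_of_real ((norm w)\<^sup>2)"
  have n: "n \<noteq> 0" "cnj n = n" using w by (auto simp: n_def)
  have "cip (z - (cip z w / n) *s w) (z - (cip z w / n) *s w)
      = cip z z - cip z w * cnj (cip z w) / n"
    using n unfolding cip_simps cip_self[of w, folded n_def] cnj_cip[of z w, symmetric]
    by (simp add: divide_simps algebra_simps cnj_cip)
  also have "\<dots> = of_real ((norm z)\<^sup>2 - (cmod (cip z w))\<^sup>2 / (norm w)\<^sup>2)"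
    by (simp add: cip_self n_def of_real_cmod_sq)
  finally have "(norm z)\<^sup>2 - (cmod (cip z w))\<^sup>2 / (norm w)\<^sup>2 = (norm (z - (cip z w / n) *s w))\<^sup>2"
    unfolding cip_self using of_real_eq_iff by metis
  then have "(cmod (cip z w))\<^sup>2 / (norm w)\<^sup>2 \<le> (norm z)\<^sup>2"
    by (metis diff_ge_0_iff_ge zero_le_power2)
  then have "(cmod (cip z w))\<^sup>2 \<le> (norm z * norm w)\<^sup>2"
    using w by (simp add: divide_le_eq power_mult_distrib)
  then show ?thesis by (rule power2_le_imp_le) simp
qed simp

lemma cn_holomorphic_on_cip: "cn_holomorphic_on (\<lambda>z. cip z u) U"
  unfolding cip_def by (intro cn_holomorphic_intros)

lemma cip_neq_1: assumes "norm z < 1" "norm w < 1" shows "cip z w \<noteq> 1"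
proof -
  have "norm z * norm w < 1"
    using assms by (metis mult_strict_mono' norm_ge_zero mult_1)
  then show ?thesis
    using cip_bound[of z w] by auto
qed

text \<open>The involutive automorphism of the ball that interchanges \<open>0\<close> and \<open>p\<close>. With \<open>s = sqrt (1 - |p|\<^sup>2)\<close>,
  the usual factor \<open>(1 - s) / |p|\<^sup>2\<close> is written \<open>1 / (1 + s)\<close> so that \<open>p = 0\<close> is not exceptional.\<close>

definition ballaut :: "complex ^ 'n \<Rightarrow> complex ^ 'n \<Rightarrow> complex ^ 'n" where
  "ballaut p z = (let s = complex_of_real (sqrt (1 - (norm p)\<^sup>2)) in
     (1 / (1 - cip z p)) *s ((1 - cip z p / (1 + s)) *s p - s *s z))"

lemma cip_ballaut_aux:
  "cip (a *s (b *s p - s *s z)) (a' *s (b' *s p - s *s w)) =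
    a * cnj a' * (b * cnj b' * cip p p - cnj s * b * cip p w - s * cip z p * cnj b' + s * cnj s * cip z w)"
  by (simp add: cip_simps algebra_simps)

text \<open>With X = <z,p> and Y = <p,w>, the inner product of the images has numerator (1 - X)(1 -
  Y) - s^2 (1 - <z,w>). This covariance is why \<open>gram\<close> changes under an automorphism
  only by a row factor and the conjugate column factor.\<close>

lemma ballaut_kernel:
  assumes p: "norm p < 1" and z: "cip z p \<noteq> 1" and w: "cip w p \<noteq> 1"
  shows "1 - cip (ballaut p z) (ballaut p w) =
    of_real (1 - (norm p)\<^sup>2) * (1 - cip z w) / ((1 - cip z p) * cnj (1 - cip w p))"
proof -
  define r where "r = sqrt (1 - (norm p)\<^sup>2)"
  define s where "s = complex_of_real r"
  have r0: "r \<ge> 0" using p by (simp add: r_def abs_square_le_1)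
  have r2: "r\<^sup>2 = 1 - (norm p)\<^sup>2" using p by (simp add: r_def abs_square_le_1)
  have s2: "s\<^sup>2 = of_real (1 - (norm p)\<^sup>2)" by (simp only: s_def r2 flip: of_real_power)
  have pp: "cip p p = 1 - s\<^sup>2" unfolding cip_self s2 by simp
  have s1: "1 + s \<noteq> 0" using r0 unfolding s_def complex_eq_iff by simp
  have cs: "cnj s = s" by (simp add: s_def)
  define X where "X = cip z p"
  define Y where "Y = cip p w"
  have Xn: "1 - X \<noteq> 0" using z by (simp add: X_def)
  have cw: "cnj (cip w p) = Y" by (simp add: Y_def cnj_cip)
  have Yn: "1 - Y \<noteq> 0" using w cw by (metis complex_cnj_one complex_cnj_cancel_iff right_minus_eq)
  have "cip (ballaut p z) (ballaut p w) = (1/(1-X)) * (1/(1-Y)) * ((1 - X / (1+s)) * (1 - Y / (1+s)) * (1 - s\<^sup>2) - s * (1 - X/(1+s)) * Y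
     - s * X * (1 - Y / (1+s)) + s * s * cip z w)"
    unfolding ballaut_def Let_def r_def[symmetric] s_def[symmetric] cip_ballaut_aux pp X_def[symmetric] Y_def[symmetric]
    by (simp add: cs cw)
  also have "(1 - X / (1+s)) * (1 - Y / (1+s)) * (1 - s\<^sup>2) - s * (1 - X/(1+s)) * Y
     - s * X * (1 - Y / (1+s)) + s * s * cip z w = (1 - X) * (1 - Y) - s\<^sup>2 * (1 - cip z w)"
    using s1 by (simp add: divide_simps) algebra
  finally have "1 - cip (ballaut p z) (ballaut p w) = s\<^sup>2 * (1 - cip z w) / ((1 - X) * (1 - Y))"
    using Xn Yn by (simp add: diff_divide_distrib)
  then show ?thesis using cw s2 by (simp add: X_def)
qed

lemma ballaut_ballaut:
  assumes p: "norm p < 1" and z: "cip z p \<noteq> 1"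
  shows "ballaut p (ballaut p z) = z"
proof -
  define r where "r = sqrt (1 - (norm p)\<^sup>2)"
  define s where "s = complex_of_real r"
  have r0: "r > 0" using p by (simp add: r_def abs_square_less_1)
  have r2: "r\<^sup>2 = 1 - (norm p)\<^sup>2" using p by (simp add: r_def abs_square_le_1)
  have s2: "s\<^sup>2 = of_real (1 - (norm p)\<^sup>2)" by (simp only: s_def r2 flip: of_real_power)
  have pp: "cip p p = 1 - s\<^sup>2" unfolding cip_self s2 by simp
  have s0: "s \<noteq> 0" using r0 by (simp add: s_def)
  have s1: "1 + s \<noteq> 0" using r0 unfolding s_def complex_eq_iff by simp
  define X where "X = cip z p"
  have Xn: "1 - X \<noteq> 0" using z by (simp add: X_def)
  have bz: "ballaut p z = (1 / (1 - X)) *s ((1 - X / (1 + s)) *s p - s *s z)"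
    unfolding ballaut_def Let_def r_def[symmetric] s_def[symmetric] X_def ..
  have "cip (ballaut p z) p = (1 / (1 - X)) * ((1 - X / (1 + s)) * (1 - s\<^sup>2) - s * X)"
    unfolding bz cip_simps pp X_def[symmetric] by (rule refl)
  also have "(1 - X / (1 + s)) * (1 - s\<^sup>2) - s * X = 1 - X - s\<^sup>2"
    using s1 by (simp add: divide_simps) algebra
  finally have c: "cip (ballaut p z) p = 1 - s\<^sup>2 / (1 - X)"
    using Xn by (simp add: divide_simps)
  have e: "ballaut p (ballaut p z) = ((1 - X) / s\<^sup>2) *s ((1 - cip (ballaut p z) p / (1 + s)) *s p - s *s ballaut p z)"
    unfolding ballaut_def[of p "ballaut p z"] Let_def r_def[symmetric] s_def[symmetric] c by simp
  have "ballaut p (ballaut p z) $ i = z $ i" for i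
    unfolding e c unfolding bz using Xn s0 s1 by (simp add: divide_simps) algebra
  then show ?thesis by (simp add: vec_eq_iff)
qed

lemma ballaut_norm_sq:
  assumes p: "norm p < 1" and z: "norm z < 1"
  shows "1 - (norm (ballaut p z))\<^sup>2 = (1 - (norm p)\<^sup>2) * (1 - (norm z)\<^sup>2) / (cmod (1 - cip z p))\<^sup>2"
proof -
  have n: "cip z p \<noteq> 1" using cip_neq_1[OF z p] by simp
  have "of_real (1 - (norm (ballaut p z))\<^sup>2) = 1 - cip (ballaut p z) (ballaut p z)" by (simp add: cip_self)
  also have "\<dots> = of_real ((1 - (norm p)\<^sup>2) * (1 - (norm z)\<^sup>2) / (cmod (1 - cip z p))\<^sup>2)"
    by (subst ballaut_kernel[OF p n n], subst cip_self) (simp add: of_real_cmod_sq)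
  finally show ?thesis using of_real_eq_iff by blast
qed

lemma ballaut_norm:
  assumes p: "norm p < 1" and z: "norm z < 1"
  shows "norm (ballaut p z) < 1"
proof -
  have "1 - (norm (ballaut p z))\<^sup>2 > 0"
    unfolding ballaut_norm_sq[OF assms] using p z cip_neq_1[OF z p] by (simp add: abs_square_less_1)
  then show ?thesis by (simp add: abs_square_less_1)
qed

lemma ballaut_0: "ballaut p 0 = p"
  by (simp add: ballaut_def)

lemma ballaut_self: assumes "norm p < 1" shows "ballaut p p = 0"
  using ballaut_ballaut[OF assms, of 0] by (simp add: ballaut_0)

lemma cn_holomorphic_on_ballaut:
  assumes p: "norm p < 1"
  shows "cn_holomorphic_on (\<lambda>z. ballaut p z $ i) (ball 0 1)"
proof -
  have "sqrt (1 - (norm p)\<^sup>2) \<ge> 0" using p by (simp add: abs_square_le_1)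
  then have "1 + sqrt (1 - (norm p)\<^sup>2) \<noteq> 0" by linarith
  then have "1 + complex_of_real (sqrt (1 - (norm p)\<^sup>2)) \<noteq> 0" by (metis of_real_1 of_real_add of_real_eq_0_iff)
  then show ?thesis
    unfolding ballaut_def Let_def using cip_neq_1[OF _ p]
    by (auto intro!: cn_holomorphic_intros cn_holomorphic_on_cip)
qed

section \<open>Pick matrices\<close>

text \<open>The conjugate sits on the column index, so null vectors of a positive semidefinite
  Hermitian \<open>M\<close> satisfy a relation between \<open>cnj (u j)\<close> and the rows of
  \<open>M\<close>. Taking the real part makes \<open>psd\<close> and \<open>pd\<close> meaningful
  without a symmetry assumption.\<close>

definition qform :: "(3 \<Rightarrow> 3 \<Rightarrow> complex) \<Rightarrow> (3 \<Rightarrow> complex) \<Rightarrow> real" where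
  "qform M v = Re (\<Sum>i\<in>UNIV. \<Sum>j\<in>UNIV. v i * cnj (v j) * M i j)"

definition psd :: "(3 \<Rightarrow> 3 \<Rightarrow> complex) \<Rightarrow> bool" where
  "psd M \<longleftrightarrow> (\<forall>v. 0 \<le> qform M v)"

definition pd :: "(3 \<Rightarrow> 3 \<Rightarrow> complex) \<Rightarrow> bool" where
  "pd M \<longleftrightarrow> (\<forall>v. (\<exists>i. v i \<noteq> 0) \<longrightarrow> 0 < qform M v)"

text \<open>Diagonal congruence: the action of automorphisms of the ball and the disc on the
  matrices of the problem.\<close>

definition gauge_mat :: "(3 \<Rightarrow> complex) \<Rightarrow> (3 \<Rightarrow> 3 \<Rightarrow> complex) \<Rightarrow> 3 \<Rightarrow> 3 \<Rightarrow> complex" where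
  "gauge_mat h M i j = h i * cnj (h j) * M i j"

lemma qform_gauge: "qform (gauge_mat h M) v = qform M (\<lambda>i. h i * v i)"
  unfolding qform_def gauge_mat_def by (simp add: mult_ac)

lemma psd_gauge: assumes "psd M" shows "psd (gauge_mat h M)"
  using assms by (simp add: psd_def qform_gauge)

lemma pd_gauge: assumes "pd M" "\<And>i. h i \<noteq> 0" shows "pd (gauge_mat h M)"
  using assms by (simp add: pd_def qform_gauge)

lemma gauge_inverse: assumes "\<And>i. h i \<noteq> 0" shows "gauge_mat (\<lambda>i. inverse (h i)) (gauge_mat h M) = M"
  using assms by (simp add: gauge_mat_def fun_eq_iff field_simps)

lemma psd_gauge_iff: assumes "\<And>i. h i \<noteq> 0" shows "psd (gauge_mat h M) \<longleftrightarrow> psd M"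
  by (metis assms gauge_inverse psd_gauge)

lemma pd_gauge_iff: assumes "\<And>i. h i \<noteq> 0" shows "pd (gauge_mat h M) \<longleftrightarrow> pd M"
  by (metis assms gauge_inverse pd_gauge nonzero_imp_inverse_nonzero)

lemma qform_permute:
  assumes "bij \<pi>" shows "qform (\<lambda>i j. M (\<pi> i) (\<pi> j)) v = qform M (\<lambda>i. v (inv \<pi> i))"
proof -
  have i: "inv \<pi> (\<pi> i) = i" for i using assms by (simp add: bij_is_inj)
  have r: "(\<Sum>i\<in>UNIV. g i) = (\<Sum>i\<in>UNIV. g (\<pi> i))" for g :: "3 \<Rightarrow> complex"
    by (rule sum.reindex_bij_betw[OF assms, symmetric])
  have "(\<Sum>i\<in>UNIV. \<Sum>j\<in>UNIV. v (inv \<pi> i) * cnj (v (inv \<pi> j)) * M i j)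
     = (\<Sum>i\<in>UNIV. \<Sum>j\<in>UNIV. v (inv \<pi> (\<pi> i)) * cnj (v (inv \<pi> (\<pi> j))) * M (\<pi> i) (\<pi> j))"
    by (rule trans[OF r], rule sum.cong[OF refl], rule r)
  then show ?thesis unfolding qform_def i by simp
qed

lemma psd_permute: assumes "bij \<pi>" shows "psd (\<lambda>i j. M (\<pi> i) (\<pi> j)) \<longleftrightarrow> psd M"
proof
  assume *: "psd (\<lambda>i j. M (\<pi> i) (\<pi> j))"
  show "psd M" unfolding psd_def
  proof
    fix v :: "3 \<Rightarrow> complex" have "(\<lambda>i. v (\<pi> (inv \<pi> i))) = v" using assms by (simp add: bij_is_surj surj_f_inv_f)
    then show "0 \<le> qform M v"
      using * qform_permute[OF assms, of M "\<lambda>i. v (\<pi> i)"] unfolding psd_def by metis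
  qed
next
  assume "psd M"
  then show "psd (\<lambda>i j. M (\<pi> i) (\<pi> j))" unfolding psd_def qform_permute[OF assms] by blast
qed

lemma pd_permute: assumes "bij \<pi>" shows "pd (\<lambda>i j. M (\<pi> i) (\<pi> j)) \<longleftrightarrow> pd M"
proof
  assume *: "pd (\<lambda>i j. M (\<pi> i) (\<pi> j))"
  show "pd M" unfolding pd_def
  proof (intro allI impI)
    fix v :: "3 \<Rightarrow> complex" assume "\<exists>i. v i \<noteq> 0"
    then obtain i where "v i \<noteq> 0" by blast
    then have "v (\<pi> (inv \<pi> i)) \<noteq> 0" using assms by (simp add: bij_is_surj surj_f_inv_f)
    moreover have "(\<lambda>i. v (\<pi> (inv \<pi> i))) = v" using assms by (simp add: bij_is_surj surj_f_inv_f)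
    ultimately show "0 < qform M v"
      using * qform_permute[OF assms, of M "\<lambda>i. v (\<pi> i)"] unfolding pd_def by metis
  qed
next
  assume *: "pd M"
  show "pd (\<lambda>i j. M (\<pi> i) (\<pi> j))" unfolding pd_def
  proof (intro allI impI)
    fix v :: "3 \<Rightarrow> complex" assume "\<exists>i. v i \<noteq> 0"
    then obtain i where "v (inv \<pi> (\<pi> i)) \<noteq> 0" using assms by (auto simp: bij_is_inj)
    then show "0 < qform (\<lambda>i j. M (\<pi> i) (\<pi> j)) v"
      using * unfolding qform_permute[OF assms] pd_def by auto
  qed
qed

text \<open>\<open>G\<close> is a matrix of the form \<open>1 - \<langle>z\<^sub>i, z\<^sub>j\<rangle>\<close> and \<open>l\<close> are nodes in the unit disc: positivity of
  \<open>pick G l\<close> is the Nevanlinna-Pick condition for \<open>l\<^sub>i \<mapsto> z\<^sub>i\<close>.\<close>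

definition pick :: "(3 \<Rightarrow> 3 \<Rightarrow> complex) \<Rightarrow> (3 \<Rightarrow> complex) \<Rightarrow> 3 \<Rightarrow> 3 \<Rightarrow> complex" where
  "pick G l i j = G i j / (1 - l i * cnj (l j))"

definition gram :: "(3 \<Rightarrow> complex ^ 'n) \<Rightarrow> 3 \<Rightarrow> 3 \<Rightarrow> complex" where
  "gram z i j = 1 - cip (z i) (z j)"

definition cgram :: "(3 \<Rightarrow> complex) \<Rightarrow> 3 \<Rightarrow> 3 \<Rightarrow> complex" where
  "cgram \<zeta> i j = 1 - \<zeta> i * cnj (\<zeta> j)"

text \<open>By the Nevanlinna-Pick theorem, \<open>pick_dominates (gram z) (cgram \<zeta>)\<close> says that every disc through the points
  \<open>z\<^sub>i\<close> at nodes \<open>l\<^sub>i\<close> leaves the scalar problem \<open>l\<^sub>i \<mapsto> \<zeta>\<^sub>i\<close> solvable.\<close>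

definition pick_dominates :: "(3 \<Rightarrow> 3 \<Rightarrow> complex) \<Rightarrow> (3 \<Rightarrow> 3 \<Rightarrow> complex) \<Rightarrow> bool" where
  "pick_dominates G G' \<longleftrightarrow> (\<forall>l. (\<forall>i. cmod (l i) < 1) \<longrightarrow> pd (pick G l) \<longrightarrow> psd (pick G' l))"

lemma pick_gauge: "pick (gauge_mat h G) l = gauge_mat h (pick G l)"
  by (simp add: pick_def gauge_mat_def fun_eq_iff)

lemma pick_dominates_gauge:
  assumes "\<And>i. h i \<noteq> 0" "\<And>i. k i \<noteq> 0"
  shows "pick_dominates (gauge_mat h G) (gauge_mat k G') \<longleftrightarrow> pick_dominates G G'"
  using assms by (simp add: pick_dominates_def pick_gauge pd_gauge_iff psd_gauge_iff)

lemma pick_dominates_permute: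
  assumes \<pi>: "bij \<pi>" and d: "pick_dominates G G'"
  shows "pick_dominates (\<lambda>i j. G (\<pi> i) (\<pi> j)) (\<lambda>i j. G' (\<pi> i) (\<pi> j))"
  unfolding pick_dominates_def
proof (intro allI impI)
  fix l :: "3 \<Rightarrow> complex" assume l: "\<forall>i. cmod (l i) < 1" and p: "pd (pick (\<lambda>i j. G (\<pi> i) (\<pi> j)) l)"
  have i: "inv \<pi> (\<pi> i) = i" for i using \<pi> by (simp add: bij_is_inj)
  have e: "pick (\<lambda>i j. M (\<pi> i) (\<pi> j)) l = (\<lambda>i j. pick M (\<lambda>i. l (inv \<pi> i)) (\<pi> i) (\<pi> j))" for M
    by (simp add: pick_def fun_eq_iff i)
  show "psd (pick (\<lambda>i j. G' (\<pi> i) (\<pi> j)) l)"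
    using p d l e[of G] e[of G'] psd_permute[OF \<pi>, of "pick G' (\<lambda>i. l (inv \<pi> i))"]
      pd_permute[OF \<pi>, of "pick G (\<lambda>i. l (inv \<pi> i))"] unfolding pick_dominates_def by metis
qed

section \<open>Automorphisms of the disc and their action on Pick matrices\<close>

definition moeb :: "complex \<Rightarrow> complex \<Rightarrow> complex" where
  "moeb c u = (u - c) / (1 - cnj c * u)"

lemma disc_mult_neq_1: assumes "cmod a < 1" "cmod b \<le> 1" shows "1 - a * b \<noteq> 0"
proof -
  have "cmod (a * b) < 1" using assms by (smt (verit) mult_left_le norm_ge_zero norm_mult)
  then show ?thesis by auto
qed

lemma moeb_denom: assumes "cmod c < 1" "cmod u \<le> 1" shows "1 - cnj c * u \<noteq> 0"
  using disc_mult_neq_1[of "cnj c" u] assms by simp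

lemma moeb_kernel:
  assumes "cmod c < 1" "cmod u \<le> 1" "cmod w \<le> 1"
  shows "1 - moeb c u * cnj (moeb c w) =
    of_real (1 - (cmod c)\<^sup>2) * (1 - u * cnj w) / ((1 - cnj c * u) * cnj (1 - cnj c * w))"
proof -
  have n: "1 - cnj c * u \<noteq> 0" "1 - c * cnj w \<noteq> 0"
    using moeb_denom[OF assms(1,2)] disc_mult_neq_1[of c "cnj w"] assms by simp_all
  show ?thesis
    unfolding moeb_def using n
    by (simp add: divide_simps of_real_cmod_sq) algebra
qed

lemma moeb_norm_sq:
  assumes "cmod c < 1" "cmod u \<le> 1"
  shows "1 - (cmod (moeb c u))\<^sup>2 = (1 - (cmod c)\<^sup>2) * (1 - (cmod u)\<^sup>2) / (cmod (1 - cnj c * u))\<^sup>2"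
proof -
  have "of_real (1 - (cmod (moeb c u))\<^sup>2) = 1 - moeb c u * cnj (moeb c u)" by (simp add: of_real_cmod_sq)
  also have "\<dots> = of_real ((1 - (cmod c)\<^sup>2) * (1 - (cmod u)\<^sup>2) / (cmod (1 - cnj c * u))\<^sup>2)"
    using assms by (subst moeb_kernel) (auto simp: of_real_cmod_sq)
  finally show ?thesis using of_real_eq_iff by blast
qed

lemma moeb_norm: assumes "cmod c < 1" "cmod u < 1" shows "cmod (moeb c u) < 1"
proof -
  have "1 - (cmod (moeb c u))\<^sup>2 > 0"
    using assms moeb_denom[of c u] by (simp add: moeb_norm_sq abs_square_less_1)
  then show ?thesis by (simp add: abs_square_less_1)
qed

lemma moeb_unimodular: assumes "cmod c < 1" "cmod u = 1" shows "cmod (moeb c u) = 1"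
  using moeb_norm_sq[of c u] assms by (simp add: abs_square_eq_1)

lemma moeb_moeb: assumes "cmod c < 1" "cmod u \<le> 1" shows "moeb (- c) (moeb c u) = u"
proof -
  have n: "1 - cnj c * u \<noteq> 0" using moeb_denom assms by simp
  have m: "1 - cnj c * c \<noteq> 0" using moeb_denom[of c c] assms by simp
  have "1 + cnj c * moeb c u = (1 - cnj c * c) / (1 - cnj c * u)" "moeb c u + c = u * (1 - cnj c * c) / (1 - cnj c * u)"
    unfolding moeb_def using n by (simp_all add: divide_simps algebra_simps)
  then show ?thesis unfolding moeb_def[of "-c"] using n m by simp
qed

lemma moeb_self [simp]: "moeb c c = 0" by (simp add: moeb_def)
lemma moeb_zero_left [simp]: "moeb 0 u = u" by (simp add: moeb_def)

lemma moeb_holomorphic: assumes "cmod c < 1" shows "moeb c holomorphic_on ball 0 1"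
  unfolding moeb_def using moeb_denom[OF assms] by (auto intro!: holomorphic_intros)

text \<open>The square root distributes the factor \<open>1 - |c|^2\<close> of
  \<open>moeb_kernel\<close> evenly over row and column, which gives the shape of a
  \<open>gauge_mat\<close>.\<close>

definition moeb_gauge :: "complex \<Rightarrow> complex \<Rightarrow> complex" where
  "moeb_gauge c u = of_real (sqrt (1 - (cmod c)\<^sup>2)) / (1 - cnj c * u)"

lemma moeb_gauge_nz: assumes "cmod c < 1" "cmod u < 1" shows "moeb_gauge c u \<noteq> 0"
  using assms moeb_denom[of c u] by (simp add: moeb_gauge_def abs_square_eq_1)

lemma moeb_kernel_gauge:
  assumes "cmod c < 1" "cmod u < 1" "cmod w < 1"
  shows "1 - moeb c u * cnj (moeb c w) = moeb_gauge c u * cnj (moeb_gauge c w) * (1 - u * cnj w)"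
proof -
  have "complex_of_real (1 - (cmod c)\<^sup>2) = of_real (sqrt (1 - (cmod c)\<^sup>2)) * of_real (sqrt (1 - (cmod c)\<^sup>2))"
    using assms by (simp add: abs_square_le_1 flip: of_real_mult)
  then show ?thesis using assms by (subst moeb_kernel) (auto simp: moeb_gauge_def)
qed

lemma cgram_moeb:
  assumes "cmod c < 1" "\<And>i. cmod (\<zeta> i) < 1"
  shows "cgram (\<lambda>i. moeb c (\<zeta> i)) = gauge_mat (\<lambda>i. moeb_gauge c (\<zeta> i)) (cgram \<zeta>)"
  using assms by (simp add: cgram_def gauge_mat_def moeb_kernel_gauge fun_eq_iff)

lemma pick_moeb:
  assumes "cmod c < 1" "\<And>i. cmod (l i) < 1"
  shows "pick G (\<lambda>i. moeb c (l i)) = gauge_mat (\<lambda>i. inverse (moeb_gauge c (l i))) (pick G l)"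
  using assms by (simp add: pick_def gauge_mat_def moeb_kernel_gauge fun_eq_iff divide_simps)

lemma pick_moeb_pd:
  assumes "cmod c < 1" "\<And>i. cmod (l i) < 1"
  shows "pd (pick G (\<lambda>i. moeb c (l i))) \<longleftrightarrow> pd (pick G l)" "psd (pick G (\<lambda>i. moeb c (l i))) \<longleftrightarrow> psd (pick G l)"
  using assms moeb_gauge_nz by (simp_all add: pick_moeb pd_gauge_iff psd_gauge_iff)

lemma gram_ballaut:
  assumes p: "norm p < 1" and z: "\<And>i. norm (z i) < 1"
  obtains h where "\<And>i. h i \<noteq> 0" "gram (\<lambda>i. ballaut p (z i)) = gauge_mat h (gram z)"
proof -
  define r where "r = sqrt (1 - (norm p)\<^sup>2)"
  have r: "r > 0" "1 - (norm p)\<^sup>2 = r * r" using p by (auto simp: r_def abs_square_less_1 abs_square_le_1)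
  have n: "cip (z i) p \<noteq> 1" for i using cip_neq_1[OF z p] .
  show thesis
    by (rule that[of "\<lambda>i. of_real r / (1 - cip (z i) p)"])
      (use r n in \<open>auto simp: gram_def gauge_mat_def ballaut_kernel[OF p n n] fun_eq_iff\<close>)
qed

section \<open>Positivity of binary Hermitian forms and Schur complements\<close>

lemma form2_iff:
  fixes p q :: real and n :: complex
  shows "(\<forall>a b. 0 \<le> p * (cmod a)\<^sup>2 + q * (cmod b)\<^sup>2 + 2 * Re (a * cnj b * n)) \<longleftrightarrow> 0 \<le> p \<and> 0 \<le> q \<and> (cmod n)\<^sup>2 \<le> p * q"
    (is "?L \<longleftrightarrow> ?R")
proof
  assume L: ?L
  have p: "p \<ge> 0" using L[rule_format, of 1 0] by simp
  have q: "q \<ge> 0" using L[rule_format, of 0 1] by simp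
  \<comment> \<open>The test vector \<open>a = - cnj n\<close>, \<open>b = p\<close> evaluates to
    \<open>p\<close> times the determinant.\<close>
  have 1: "0 \<le> p * (p * q - (cmod n)\<^sup>2)"
  proof -
    have "Re (- cnj n * cnj (of_real p) * n) = - p * (cmod n)\<^sup>2"
      by (simp add: cmod_power2) (simp add: algebra_simps power2_eq_square)
    then show ?thesis
      using L[rule_format, of "- cnj n" "of_real p"] by (simp add: power2_eq_square algebra_simps)
  qed
  have "(cmod n)\<^sup>2 \<le> p * q"
  proof (cases "p = 0")
    case False then show ?thesis using 1 p by (simp add: zero_le_mult_iff)
  next
    case True
    have "0 \<le> q - 2 * (q + 1) * (cmod n)\<^sup>2"
    proof -
      have "Re (- (of_real (q+1) * cnj n) * cnj 1 * n) = - (q + 1) * (cmod n)\<^sup>2"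
        by (simp add: cmod_power2) (simp add: algebra_simps power2_eq_square)
      then show ?thesis using L[rule_format, of "- (of_real (q+1) * cnj n)" 1] True by (simp add: algebra_simps)
    qed
    moreover have "0 \<le> q - 2 * (q + 1) * t * (cmod n)\<^sup>2" for t :: real
    proof -
      have "Re (- (of_real ((q+1) * t) * cnj n) * cnj 1 * n) = - ((q + 1) * t) * (cmod n)\<^sup>2"
        by (simp add: cmod_power2) (simp add: algebra_simps power2_eq_square)
      then show ?thesis using L[rule_format, of "- (of_real ((q+1)*t) * cnj n)" 1] True by (simp add: algebra_simps)
    qed
    \<comment> \<open>With this \<open>t\<close> a nonzero \<open>n\<close> would give
      \<open>0 \<le> q - 2 * (q + 1)\<close>, which is negative.\<close>
    from this[of "1 / (cmod n)\<^sup>2"] have "n = 0" using q by (auto simp: divide_simps split: if_splits)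
    then show ?thesis using True by simp
  qed
  then show ?R using p q by simp
next
  assume R: ?R
  show ?L
  proof (intro allI)
    fix a b :: complex
    have "cmod n \<le> sqrt p * sqrt q" using R by (metis real_sqrt_mult real_le_rsqrt)
    then have "\<bar>Re (a * cnj b * n)\<bar> \<le> cmod a * cmod b * (sqrt p * sqrt q)"
      using abs_Re_le_cmod[of "a * cnj b * n"] by (smt (verit) complex_mod_cnj mult_left_mono norm_ge_zero norm_mult mult_nonneg_nonneg)
    moreover have "0 \<le> (sqrt p * cmod a - sqrt q * cmod b)\<^sup>2" by simp
    ultimately show "0 \<le> p * (cmod a)\<^sup>2 + q * (cmod b)\<^sup>2 + 2 * Re (a * cnj b * n)"
      using R by (simp add: power2_diff power_mult_distrib algebra_simps)
  qed
qed

lemma form2_strict: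
  fixes p q :: real and n :: complex
  assumes "0 < p" "0 < q" "(cmod n)\<^sup>2 < p * q" "a \<noteq> 0 \<or> b \<noteq> 0"
  shows "0 < p * (cmod a)\<^sup>2 + q * (cmod b)\<^sup>2 + 2 * Re (a * cnj b * n)"
proof -
  \<comment> \<open>This \<open>e\<close> makes \<open>(p - e) * (q - e)\<close> equal to
    \<open>|n|^2 + e^2\<close>, so the non-strict criterion survives subtracting \<open>e\<close>
    from both diagonal coefficients, and the subtracted part is strictly positive.\<close>
  define e where "e = (p * q - (cmod n)\<^sup>2) / (p + q)"
  have e: "e > 0" "e * (p + q) = p * q - (cmod n)\<^sup>2" using assms by (auto simp: e_def)
  have "e * (p + q) \<le> p * q" using e by simp
  then have "e * p \<le> p * q" "e * q \<le> p * q" using e assms by (smt (verit) mult_pos_pos distrib_left)+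
  then have le: "e \<le> q" "e \<le> p" using assms by (auto simp: mult.commute)
  have "(p - e) * (q - e) = (cmod n)\<^sup>2 + e * e" using e(2) by (simp add: algebra_simps)
  then have "(cmod n)\<^sup>2 \<le> (p - e) * (q - e)" by simp
  then have "0 \<le> (p - e) * (cmod a)\<^sup>2 + (q - e) * (cmod b)\<^sup>2 + 2 * Re (a * cnj b * n)"
    using form2_iff[of "p - e" "q - e" n] le by auto
  moreover have "0 < e * (cmod a)\<^sup>2 + e * (cmod b)\<^sup>2"
    using assms(4) e(1) by (metis add_nonneg_pos add_pos_nonneg less_imp_le mult_pos_pos zero_le_power2 zero_less_norm_iff zero_less_power mult_nonneg_nonneg)
  ultimately show ?thesis by (simp add: algebra_simps)
qed

text \<open>Completing the square in the first variable. Pick matrices have this shape once the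
  first node and the first point are at 0.\<close>

lemma qform_schur:
  assumes "\<And>j. M 1 j = 1" "\<And>j. M j 1 = 1" "M 2 2 = of_real (1 + p)" "M 3 3 = of_real (1 + q)"
    "M 2 3 = 1 + n" "M 3 2 = cnj (1 + n)"
  shows "qform M v = (cmod (v 1 + v 2 + v 3))\<^sup>2 + (p * (cmod (v 2))\<^sup>2 + q * (cmod (v 3))\<^sup>2 + 2 * Re (v 2 * cnj (v 3) * n))"
  unfolding qform_def sum_3 assms by (simp add: cmod_power2) (simp add: algebra_simps power2_eq_square)

lemma schur_psd_iff:
  assumes "\<And>j. M 1 j = 1" "\<And>j. M j 1 = 1" "M 2 2 = of_real (1 + p)" "M 3 3 = of_real (1 + q)"
    "M 2 3 = 1 + n" "M 3 2 = cnj (1 + n)"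
  shows "psd M \<longleftrightarrow> 0 \<le> p \<and> 0 \<le> q \<and> (cmod n)\<^sup>2 \<le> p * q"
  unfolding form2_iff[symmetric]
proof
  assume L: "psd M"
  show "\<forall>a b. 0 \<le> p * (cmod a)\<^sup>2 + q * (cmod b)\<^sup>2 + 2 * Re (a * cnj b * n)"
  proof (intro allI)
    fix a b :: complex
    define v :: "3 \<Rightarrow> complex" where "v i = (if i = 1 then - (a + b) else if i = 2 then a else b)" for i
    have v: "v 1 = - (a + b)" "v 2 = a" "v 3 = b" by (auto simp: v_def)
    show "0 \<le> p * (cmod a)\<^sup>2 + q * (cmod b)\<^sup>2 + 2 * Re (a * cnj b * n)"
      using L[unfolded psd_def, rule_format, of v] unfolding qform_schur[OF assms] v by simp
  qed
qed (auto simp: psd_def qform_schur[OF assms])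

lemma schur_pd_iff:
  assumes "\<And>j. M 1 j = 1" "\<And>j. M j 1 = 1" "M 2 2 = of_real (1 + p)" "M 3 3 = of_real (1 + q)"
    "M 2 3 = 1 + n" "M 3 2 = cnj (1 + n)"
  shows "pd M \<longleftrightarrow> 0 < p \<and> 0 < q \<and> (cmod n)\<^sup>2 < p * q"
proof
  assume L: "pd M"
  have *: "0 < p * (cmod a)\<^sup>2 + q * (cmod b)\<^sup>2 + 2 * Re (a * cnj b * n)" if "a \<noteq> 0 \<or> b \<noteq> 0" for a b
  proof -
    define v :: "3 \<Rightarrow> complex" where "v i = (if i = 1 then - (a + b) else if i = 2 then a else b)" for i
    have v: "v 1 = - (a + b)" "v 2 = a" "v 3 = b" by (auto simp: v_def)
    have "\<exists>i. v i \<noteq> 0" using that v by metis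
    then show ?thesis using L[unfolded pd_def, rule_format, of v] unfolding qform_schur[OF assms] v by simp
  qed
  have p: "p > 0" using *[of 1 0] by simp
  have q: "q > 0" using *[of 0 1] by simp
  have "Re (- cnj n * cnj (of_real p) * n) = - p * (cmod n)\<^sup>2"
    by (simp add: cmod_power2) (simp add: algebra_simps power2_eq_square)
  then have "0 < p * (p * q - (cmod n)\<^sup>2)"
    using *[of "- cnj n" "of_real p"] p by (simp add: power2_eq_square algebra_simps)
  then show "0 < p \<and> 0 < q \<and> (cmod n)\<^sup>2 < p * q" using p q by (simp add: zero_less_mult_iff)
next
  assume R: "0 < p \<and> 0 < q \<and> (cmod n)\<^sup>2 < p * q"
  show "pd M" unfolding pd_def
  proof (intro allI impI)
    fix v :: "3 \<Rightarrow> complex" assume "\<exists>i. v i \<noteq> 0"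
    then have v: "v 1 \<noteq> 0 \<or> v 2 \<noteq> 0 \<or> v 3 \<noteq> 0" by (metis exhaust_3)
    show "0 < qform M v"
    proof (cases "v 2 \<noteq> 0 \<or> v 3 \<noteq> 0")
      case True
      then show ?thesis unfolding qform_schur[OF assms] using form2_strict[of p q n "v 2" "v 3"] R
        by (smt (verit) zero_le_power2)
    qed (use v in \<open>simp add: qform_schur[OF assms]\<close>)
  qed
qed

text \<open>The Pick condition when the first node and the first point are \<open>0\<close>: here \<open>A = |z\<^sub>2|\<^sup>2\<close>, \<open>B = |z\<^sub>3|\<^sup>2\<close> and
  \<open>m = \<langle>z\<^sub>2, z\<^sub>3\<rangle>\<close>.\<close>

lemma pick_reduced:
  assumes "\<And>j. G 1 j = 1" "\<And>j. G j 1 = 1" "G 2 2 = of_real (1 - A)" "G 3 3 = of_real (1 - B)"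
    "G 2 3 = 1 - m" "G 3 2 = cnj (1 - m)"
  assumes "l 1 = 0" and l: "\<And>i. cmod (l i) < 1"
  defines "x \<equiv> (cmod (l 2))\<^sup>2" and "y \<equiv> (cmod (l 3))\<^sup>2" and "w \<equiv> l 2 * cnj (l 3)"
  shows "pd (pick G l) \<longleftrightarrow> A < x \<and> B < y \<and> (1 - x) * (1 - y) * (cmod (w - m))\<^sup>2 < (x - A) * (y - B) * (cmod (1 - w))\<^sup>2"
    and "psd (pick G l) \<longleftrightarrow> A \<le> x \<and> B \<le> y \<and> (1 - x) * (1 - y) * (cmod (w - m))\<^sup>2 \<le> (x - A) * (y - B) * (cmod (1 - w))\<^sup>2"
proof -
  have x: "x < 1" "y < 1" using l by (auto simp: x_def y_def abs_square_less_1)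
  have w: "1 - w \<noteq> 0" using disc_mult_neq_1[of "l 2" "cnj (l 3)"] l[of 2] l[of 3] by (simp add: w_def)
  have ll: "l 2 * cnj (l 2) = of_real x" "l 3 * cnj (l 3) = of_real y" by (simp_all add: x_def y_def of_real_cmod_sq)
  have lw: "l 3 * cnj (l 2) = cnj w" by (simp add: w_def)
  define p where "p = (x - A) / (1 - x)"
  define q where "q = (y - B) / (1 - y)"
  define n where "n = (w - m) / (1 - w)"
  have e: "pick G l 1 j = 1" "pick G l j 1 = 1" "pick G l 2 2 = of_real (1 + p)" "pick G l 3 3 = of_real (1 + q)"
    "pick G l 2 3 = 1 + n" "pick G l 3 2 = cnj (1 + n)" for j
  proof -
    show "pick G l 1 j = 1" "pick G l j 1 = 1" by (simp_all add: pick_def assms)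
    have "1 + p = (1 - A) / (1 - x)" "1 + q = (1 - B) / (1 - y)" using x by (auto simp: p_def q_def field_simps)
    then show "pick G l 2 2 = of_real (1 + p)" "pick G l 3 3 = of_real (1 + q)" by (simp_all add: pick_def assms(3,4) ll)
    have "1 + n = (1 - m) / (1 - w)" using w by (auto simp: n_def field_simps)
    then show "pick G l 2 3 = 1 + n" "pick G l 3 2 = cnj (1 + n)" by (simp_all add: pick_def assms(5,6) lw w_def[symmetric])
  qed
  have pq: "0 < p \<longleftrightarrow> A < x" "0 < q \<longleftrightarrow> B < y" "0 \<le> p \<longleftrightarrow> A \<le> x" "0 \<le> q \<longleftrightarrow> B \<le> y"
    using x by (auto simp: p_def q_def zero_less_divide_iff zero_le_divide_iff)
  have pos: "(1 - x) * (1 - y) > 0" "(cmod (1 - w))\<^sup>2 > 0" using x w by auto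
  have n2: "(cmod n)\<^sup>2 = (cmod (w - m))\<^sup>2 / (cmod (1 - w))\<^sup>2" by (simp add: n_def norm_divide power_divide)
  have pq2: "p * q = ((x - A) * (y - B)) / ((1 - x) * (1 - y))" by (simp add: p_def q_def)
  have 1: "(cmod n)\<^sup>2 < p * q \<longleftrightarrow> (1 - x) * (1 - y) * (cmod (w - m))\<^sup>2 < (x - A) * (y - B) * (cmod (1 - w))\<^sup>2"
    unfolding n2 pq2 using pos by (simp only: divide_less_eq less_divide_eq times_divide_eq_left) (simp add: mult.commute)
  have 2: "(cmod n)\<^sup>2 \<le> p * q \<longleftrightarrow> (1 - x) * (1 - y) * (cmod (w - m))\<^sup>2 \<le> (x - A) * (y - B) * (cmod (1 - w))\<^sup>2"
    unfolding n2 pq2 using pos by (simp only: divide_le_eq le_divide_eq times_divide_eq_left) (simp add: mult.commute)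
  show "pd (pick G l) \<longleftrightarrow> A < x \<and> B < y \<and> (1 - x) * (1 - y) * (cmod (w - m))\<^sup>2 < (x - A) * (y - B) * (cmod (1 - w))\<^sup>2"
    using schur_pd_iff[OF e] pq 1 by simp
  show "psd (pick G l) \<longleftrightarrow> A \<le> x \<and> B \<le> y \<and> (1 - x) * (1 - y) * (cmod (w - m))\<^sup>2 \<le> (x - A) * (y - B) * (cmod (1 - w))\<^sup>2"
    using schur_psd_iff[OF e] pq 2 by simp
qed

section \<open>Pairs of solutions and the normal form\<close>

definition solves :: "(3 \<Rightarrow> complex ^ 'n) \<Rightarrow> (3 \<Rightarrow> complex) \<Rightarrow> (complex ^ 'n \<Rightarrow> complex) \<Rightarrow> bool" where
  "solves z \<zeta> f \<longleftrightarrow> cn_holomorphic_on f (ball 0 1) \<and> (\<forall>w. norm w < 1 \<longrightarrow> cmod (f w) < 1) \<and> (\<forall>j. f (z j) = \<zeta> j)"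

text \<open>Functions are total, so the difference has to show at a point of the ball.\<close>

definition nonunique :: "(3 \<Rightarrow> complex ^ 'n) \<Rightarrow> (3 \<Rightarrow> complex) \<Rightarrow> bool" where
  "nonunique z \<zeta> \<longleftrightarrow> (\<exists>f g. solves z \<zeta> f \<and> solves z \<zeta> g \<and> (\<exists>w. norm w < 1 \<and> f w \<noteq> g w))"

lemma solves_compose_ballaut:
  assumes p: "norm p < 1" and f: "solves z \<zeta> f"
    and z: "\<And>j. ballaut p (z' j) = z j"
  shows "solves z' \<zeta> (\<lambda>w. f (ballaut p w))"
proof -
  have "cn_holomorphic_on (\<lambda>w. f (ballaut p w)) (ball 0 1)"
    by (rule cn_holomorphic_on_compose_vec[where V = "ball 0 1"])
      (use f ballaut_norm[OF p] cn_holomorphic_on_ballaut[OF p] in \<open>auto simp: solves_def\<close>)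
  then show ?thesis using f z ballaut_norm[OF p] by (simp add: solves_def)
qed

lemma solves_compose_moeb:
  assumes c: "cmod c < 1" and f: "solves z \<zeta> f" and z: "\<And>j. moeb c (\<zeta> j) = \<zeta>' j"
  shows "solves z \<zeta>' (\<lambda>w. moeb c (f w))"
proof -
  have "cn_holomorphic_on (\<lambda>w. moeb c (f w)) (ball 0 1)"
    by (rule cn_holomorphic_on_compose_field[where V = "ball 0 1", OF _ moeb_holomorphic[OF c]])
      (use f in \<open>auto simp: solves_def\<close>)
  then show ?thesis using f z moeb_norm[OF c] by (simp add: solves_def)
qed

lemma nonunique_ballaut:
  assumes p: "norm p < 1" and z: "\<And>j. norm (z j) < 1" and n: "nonunique (\<lambda>j. ballaut p (z j)) \<zeta>"
  shows "nonunique z \<zeta>"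
proof -
  obtain f g w where fg: "solves (\<lambda>j. ballaut p (z j)) \<zeta> f" "solves (\<lambda>j. ballaut p (z j)) \<zeta> g" "norm w < 1" "f w \<noteq> g w"
    using n unfolding nonunique_def by blast
  have "solves z \<zeta> (\<lambda>w. f (ballaut p w))" "solves z \<zeta> (\<lambda>w. g (ballaut p w))"
    by (rule solves_compose_ballaut[OF p]; use fg in simp)+
  moreover have "f (ballaut p (ballaut p w)) \<noteq> g (ballaut p (ballaut p w))"
    using fg ballaut_ballaut[OF p] cip_neq_1[OF fg(3) p] by simp
  ultimately show ?thesis using ballaut_norm[OF p fg(3)] unfolding nonunique_def by blast
qed

lemma nonunique_moeb:
  assumes c: "cmod c < 1" and \<zeta>: "\<And>j. cmod (\<zeta> j) < 1" and n: "nonunique z (\<lambda>j. moeb c (\<zeta> j))"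
  shows "nonunique z \<zeta>"
proof -
  obtain f g w where fg: "solves z (\<lambda>j. moeb c (\<zeta> j)) f" "solves z (\<lambda>j. moeb c (\<zeta> j)) g" "norm w < 1" "f w \<noteq> g w"
    using n unfolding nonunique_def by blast
  have "solves z \<zeta> (\<lambda>w. moeb (- c) (f w))" "solves z \<zeta> (\<lambda>w. moeb (- c) (g w))"
    using c \<zeta> by (auto intro!: solves_compose_moeb fg moeb_moeb simp: less_imp_le)
  moreover have "moeb (- c) (f w) \<noteq> moeb (- c) (g w)"
    using moeb_moeb[of "- c" "f w"] moeb_moeb[of "- c" "g w"] fg c unfolding solves_def
    by (metis less_imp_le norm_minus_cancel)
  ultimately show ?thesis using fg(3) unfolding nonunique_def by blast
qed

lemma nonunique_permute:
  assumes \<pi>: "bij \<pi>" and n: "nonunique (\<lambda>j. z (\<pi> j)) (\<lambda>j. \<zeta> (\<pi> j))"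
  shows "nonunique z \<zeta>"
proof -
  have "solves z \<zeta> f" if "solves (\<lambda>j. z (\<pi> j)) (\<lambda>j. \<zeta> (\<pi> j)) f" for f
    using that \<pi> unfolding solves_def by (metis bij_pointE)
  then show ?thesis using n unfolding nonunique_def by blast
qed

text \<open>The left side grows with \<open>Re (u * cnj q)\<close> for \<open>q = v\<^sup>2\<close>,
  which is therefore replaced by its maximum \<open>X * Y\<close>; the result \<open>V\<close> is a
  convex quadratic in \<open>Y\<close>, so the endpoints \<open>Y = 0\<close> and
  \<open>Y = 1 - X\<^sup>2\<close> suffice. The second summand is the room in which a multiple of
  the square of a function vanishing on the model disc can be added.\<close>

lemma normal_form_bound:
  fixes s :: real and u v :: complex
  assumes s: "0 \<le> s" "s \<le> 1" and uv: "(cmod u)\<^sup>2 + (cmod v)\<^sup>2 < 1"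
  shows "(cmod (s * u + v\<^sup>2 / 2))\<^sup>2 + (cmod ((1 - s\<^sup>2) * u - s * v\<^sup>2))\<^sup>2 / 16 < ((1 + s\<^sup>2) / 2)\<^sup>2"
proof -
  define X where "X = cmod u"
  define Y where "Y = (cmod v)\<^sup>2"
  define q where "q = v\<^sup>2"
  define R where "R = Re (u * cnj q)"
  have qY: "cmod q = Y" by (simp add: q_def Y_def norm_power)
  have X0: "X \<ge> 0" "Y \<ge> 0" by (auto simp: X_def Y_def)
  have T: "Y < 1 - X\<^sup>2" using uv by (simp add: X_def Y_def)
  have R: "R \<le> X * Y" unfolding R_def using complex_Re_le_cmod[of "u * cnj q"] by (simp add: norm_mult X_def qY)
  have e: "(cmod (of_real a * u + of_real b * q))\<^sup>2 = a\<^sup>2 * X\<^sup>2 + b\<^sup>2 * Y\<^sup>2 + 2 * a * b * R" for a b :: real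
    unfolding X_def R_def qY[symmetric] by (simp add: cmod_power2) (simp add: algebra_simps power2_eq_square)
  have 1: "(cmod (s * u + v\<^sup>2 / 2))\<^sup>2 = s\<^sup>2 * X\<^sup>2 + Y\<^sup>2 / 4 + s * R"
    using e[of s "1/2"] by (simp add: q_def power2_eq_square)
  have 2: "(cmod ((1 - s\<^sup>2) * u - s * v\<^sup>2))\<^sup>2 = (1 - s\<^sup>2)\<^sup>2 * X\<^sup>2 + s\<^sup>2 * Y\<^sup>2 - 2 * (1 - s\<^sup>2) * s * R"
    using e[of "1 - s\<^sup>2" "- s"] by (simp add: q_def)
  define V where "V y = (s * X + y / 2)\<^sup>2 + ((1 - s\<^sup>2) * X - s * y)\<^sup>2 / 16" for y
  have "s * (1 - (1 - s\<^sup>2) / 8) * R \<le> s * (1 - (1 - s\<^sup>2) / 8) * (X * Y)"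
    using s by (intro mult_left_mono[OF R] mult_nonneg_nonneg) (auto simp: field_simps add_nonneg_nonneg)
  then have LV: "(cmod (s * u + v\<^sup>2 / 2))\<^sup>2 + (cmod ((1 - s\<^sup>2) * u - s * v\<^sup>2))\<^sup>2 / 16 \<le> V Y"
    unfolding 1 2 V_def by (simp add: field_simps power2_eq_square)
  define M where "M = (1 + s\<^sup>2) / 2"
  have M: "M \<ge> 1 / 2" "M > 0" using s by (auto simp: M_def field_simps add_pos_nonneg)
  have X1: "X\<^sup>2 < 1" using T X0 by simp
  have MM: "M\<^sup>2 = s\<^sup>2 + (1 - s\<^sup>2)\<^sup>2 / 4" by (simp add: M_def power2_eq_square field_simps)
  have V0: "V 0 < M\<^sup>2"
  proof -
    have "V 0 = X\<^sup>2 * (s\<^sup>2 + (1 - s\<^sup>2)\<^sup>2 / 16)" by (simp add: V_def power2_eq_square field_simps)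
    also have "\<dots> \<le> X\<^sup>2 * M\<^sup>2" unfolding MM by (rule mult_left_mono) auto
    also have "\<dots> < M\<^sup>2" using X1 M by simp
    finally show ?thesis .
  qed
  \<comment> \<open>At this endpoint the gap \<open>M - k\<close> and the extra term both carry the
    factor \<open>(X - s)\<^sup>2\<close>, with equality at the contact point \<open>X = s\<close>;
    the divisor 16 and \<open>M + k \<ge> 1 / 2\<close> settle the comparison.\<close>
  have VT: "V (1 - X\<^sup>2) \<le> M\<^sup>2"
  proof -
    define k where "k = s * X + (1 - X\<^sup>2) / 2"
    have k0: "k \<ge> 0" using s X0 X1 by (simp add: k_def)
    have kM: "M - k = (X - s)\<^sup>2 / 2" by (simp add: M_def k_def power2_eq_square field_simps)
    have 3: "(1 - s\<^sup>2) * X - s * (1 - X\<^sup>2) = (X - s) * (1 + s * X)" by (simp add: power2_eq_square algebra_simps)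
    have "X \<le> 1" using X1 X0 by (simp add: power_le_one_iff abs_square_less_1)
    then have "s * X \<le> 1" using s X0 by (simp add: mult_le_one)
    then have 4: "(1 + s * X)\<^sup>2 \<le> 4" using s X0 power_mono[of "1 + s * X" 2 2] by simp
    have "((1 - s\<^sup>2) * X - s * (1 - X\<^sup>2))\<^sup>2 / 16 \<le> (X - s)\<^sup>2 / 4"
      unfolding 3 power_mult_distrib using mult_left_mono[OF 4, of "(X - s)\<^sup>2"] by simp
    also have "\<dots> \<le> (M - k) * (M + k)"
    proof -
      have "(M - k) * (1/2) \<le> (M - k) * (M + k)" unfolding kM using M k0 by (intro mult_left_mono) auto
      then show ?thesis unfolding kM by simp
    qed
    also have "\<dots> = M\<^sup>2 - k\<^sup>2" by (simp add: power2_eq_square algebra_simps)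
    finally show ?thesis unfolding V_def k_def by simp
  qed
  define \<theta> where "\<theta> = Y / (1 - X\<^sup>2)"
  have \<theta>: "0 \<le> \<theta>" "\<theta> < 1" "Y = \<theta> * (1 - X\<^sup>2)" using T X1 X0 by (auto simp: \<theta>_def)
  have "V Y \<le> (1 - \<theta>) * V 0 + \<theta> * V (1 - X\<^sup>2)"
  proof -
    have "(1 - \<theta>) * V 0 + \<theta> * V t - V (\<theta> * t) = \<theta> * (1 - \<theta>) * t\<^sup>2 * (1/4 + s\<^sup>2/16)" for t
      unfolding V_def by (simp add: power2_eq_square field_simps)
    moreover have "\<theta> * (1 - \<theta>) * (1 - X\<^sup>2)\<^sup>2 * (1/4 + s\<^sup>2/16) \<ge> 0" using \<theta> by simp
    ultimately show ?thesis using \<theta>(3) by (smt (verit))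
  qed
  also have "\<dots> \<le> (1 - \<theta>) * V 0 + \<theta> * M\<^sup>2" using VT \<theta> by (simp add: mult_left_mono)
  also have "\<dots> < (1 - \<theta>) * M\<^sup>2 + \<theta> * M\<^sup>2" using V0 \<theta> by simp
  also have "\<dots> = M\<^sup>2" by (simp add: algebra_simps)
  finally show ?thesis using LV unfolding M_def by simp
qed

section \<open>Orthonormal frames and coordinate planes\<close>

lemma cip_orthonormal_bound:
  assumes e: "cip e e = 1" "cip n n = 1" "cip n e = 0"
  shows "(cmod (cip z e))\<^sup>2 + (cmod (cip z n))\<^sup>2 \<le> (norm z)\<^sup>2"
proof -
  define y where "y = z - cip z e *s e - cip z n *s n"
  have en: "cip e n = 0" using e(3) cnj_cip[of n e] by simp
  have "cip y y = cip z z - cip z e * cnj (cip z e) - cip z n * cnj (cip z n)"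
    unfolding y_def cip_simps cnj_cip e en by (simp add: algebra_simps)
  also have "\<dots> = of_real ((norm z)\<^sup>2 - (cmod (cip z e))\<^sup>2 - (cmod (cip z n))\<^sup>2)"
    by (simp add: cip_self of_real_cmod_sq)
  finally have "(norm y)\<^sup>2 = (norm z)\<^sup>2 - (cmod (cip z e))\<^sup>2 - (cmod (cip z n))\<^sup>2"
    unfolding cip_self using of_real_eq_iff by blast
  then show ?thesis by (smt (verit) zero_le_power2)
qed

lemma exists_two_indices:
  assumes "CARD('d::finite) \<ge> 2" shows "\<exists>i j :: 'd. i \<noteq> j"
proof (rule ccontr)
  assume "\<not> ?thesis"
  then have "card (UNIV :: 'd set) \<le> Suc 0" by (subst card_le_Suc0_iff_eq) auto
  then show False using assms by simp
qed

lemma exists_orthogonal_unit: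
  fixes e :: "complex ^ 'd"
  assumes d: "CARD('d) \<ge> 2"
  obtains n where "cip n n = 1" "cip n e = 0"
proof -
  obtain i j :: 'd where ij: "i \<noteq> j" using exists_two_indices[OF d] by blast
  define x where "x = (if e $ i = 0 \<and> e $ j = 0 then axis i 1 else axis i (cnj (e $ j)) - axis j (cnj (e $ i)))"
  have c: "cip (axis k a) w = a * cnj (w $ k)" for k a and w :: "complex ^ 'd"
    by (simp add: cip_def axis_def if_distrib[of "\<lambda>x. x * _"] cong: if_cong)
  have xe: "cip x e = 0" by (simp add: x_def c cip_diff_left)
  have "x $ i \<noteq> 0 \<or> x $ j \<noteq> 0" using ij by (auto simp: x_def axis_def)
  then have nx: "norm x \<noteq> 0" by (metis norm_eq_zero zero_index)
  define n where "n = (1 / of_real (norm x)) *s x"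
  have "cip n n = 1" using nx by (simp add: n_def cip_self norm_cscale norm_divide)
  moreover have "cip n e = 0" by (simp add: n_def cip_simps xe)
  ultimately show ?thesis using that by blast
qed

text \<open>The coefficient \<open>\<beta>\<close> is prescribed including its phase:
  \<open>n\<close> is the part of \<open>b\<close> orthogonal to \<open>e\<close>, divided by
  \<open>\<beta>\<close>. For \<open>\<beta> = 0\<close> any unit vector orthogonal to
  \<open>e\<close> serves; here dimension at least two enters.\<close>

lemma orthonormal_decomposition:
  fixes e b :: "complex ^ 'd"
  assumes d: "CARD('d) \<ge> 2" and e: "cip e e = 1" and b: "(norm b)\<^sup>2 = (cmod (cip b e))\<^sup>2 + (cmod \<beta>)\<^sup>2"
  obtains n where "cip n n = 1" "cip n e = 0" "b = cip b e *s e + \<beta> *s n"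
proof -
  define y where "y = b - cip b e *s e"
  have ye: "cip y e = 0" by (simp add: y_def cip_simps e)
  have "cip y y = cip b b - cip b e * cnj (cip b e)"
    unfolding y_def cip_simps cnj_cip e by simp
  also have "\<dots> = of_real ((cmod \<beta>)\<^sup>2)" by (simp add: cip_self of_real_cmod_sq b)
  finally have yy: "cip y y = of_real ((cmod \<beta>)\<^sup>2)" .
  show thesis
  proof (cases "\<beta> = 0")
    case True
    then have "y = 0" using yy by (simp add: cip_self)
    obtain n where "cip n n = 1" "cip n e = 0" using exists_orthogonal_unit[OF d] by blast
    then show ?thesis using that[of n] True \<open>y = 0\<close> by (simp add: y_def)
  next
    case False
    define n where "n = (1 / \<beta>) *s y"
    have "cip n n = 1" using False yy by (simp add: n_def cip_simps of_real_cmod_sq)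
    moreover have "cip n e = 0" by (simp add: n_def cip_simps ye)
    moreover have "b = cip b e *s e + \<beta> *s n" using False by (simp add: n_def y_def vec_eq_iff)
    ultimately show ?thesis using that by blast
  qed
qed

definition plane :: "'d \<Rightarrow> 'd \<Rightarrow> complex \<Rightarrow> complex \<Rightarrow> complex ^ 'd" where
  "plane i j x y = x *s axis i 1 + y *s axis j 1"

lemma plane_nth: assumes "i \<noteq> j" shows "plane i j x y $ i = x" "plane i j x y $ j = y"
  using assms by (auto simp: plane_def axis_def)

lemma cip_axis:
  fixes z :: "complex ^ 'd" shows "cip z (axis k 1) = z $ k"
  by (simp add: cip_def axis_def if_distrib[of cnj] if_distrib[of "\<lambda>x. _ * x"] cong: if_cong)

lemma cip_plane: assumes "i \<noteq> j" shows "cip (plane i j x y) (plane i j x' y') = x * cnj x' + y * cnj y'"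
  using assms unfolding plane_def[of i j x' y'] by (simp add: cip_simps cip_axis plane_nth algebra_simps)

lemma plane_arith: "c *s plane i j x y = plane i j (c * x) (c * y)"
  "plane i j x y + plane i j x' y' = plane i j (x + x') (y + y')"
  "plane i j x y - plane i j x' y' = plane i j (x - x') (y - y')"
  by (simp_all add: plane_def vec_eq_iff algebra_simps)

lemma ballaut_plane: "\<exists>x'' y''. ballaut (plane i j x y) (plane i j x' y') = plane i j x'' y''"
  unfolding ballaut_def Let_def plane_arith by blast

lemma norm_nth2:
  fixes z :: "complex ^ 'd"
  assumes "i \<noteq> j" shows "(cmod (z $ i))\<^sup>2 + (cmod (z $ j))\<^sup>2 \<le> (norm z)\<^sup>2"
  using cip_orthonormal_bound[of "axis i 1" "axis j 1" z] assms by (simp add: cip_axis) (simp add: axis_def)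

lemma plane_expand:
  assumes ij: "i \<noteq> j" and pq: "p * cnj p + q * cnj q = 1" and x: "x = plane i j a b"
  shows "x = cip x (plane i j p q) *s plane i j p q + cip x (plane i j (- cnj q) (cnj p)) *s plane i j (- cnj q) (cnj p)"
proof -
  have "(a * cnj p + b * cnj q) * p + (- a * q + b * p) * (- cnj q) = a * (p * cnj p + q * cnj q)"
    "(a * cnj p + b * cnj q) * q + (- a * q + b * p) * cnj p = b * (p * cnj p + q * cnj q)"
    by (simp_all add: algebra_simps)
  then show ?thesis unfolding x by (simp add: cip_plane[OF ij] plane_arith pq)
qed

text \<open>Two triples with the same Gram matrix, one of them in a coordinate plane, are matched by a linear
  contraction that maps the ball onto the disc of that plane.\<close>

lemma gram_eq_contraction:
  fixes a b :: "complex ^ 'd"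
  assumes d: "CARD('d) \<ge> 2" and ij: "i \<noteq> j" and a: "a \<noteq> 0"
    and a': "a' = plane i j a1 a2" and b': "b' = plane i j b1 b2"
    and g: "cip a a = cip a' a'" "cip b a = cip b' a'" "cip b b = cip b' b'"
  obtains u1 u2 v1 v2 where
    "plane i j (cip a u1) (cip a u2) = a'" "plane i j (cip b u1) (cip b u2) = b'"
    "\<And>z. norm (plane i j (cip z u1) (cip z u2)) \<le> norm z"
    "\<And>x y. \<exists>z. norm z = norm (plane i j x y) \<and> plane i j (cip z u1) (cip z u2) = plane i j x y"
proof -
  define r where "r = norm a"
  have r: "r > 0" using a by (simp add: r_def)
  define e where "e = (1 / of_real r) *s a"
  define p where "p = a1 / of_real r"
  define q where "q = a2 / of_real r"
  define e' where "e' = plane i j p q"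
  have ea: "a = of_real r *s e" "a' = of_real r *s e'"
    using r by (auto simp: e_def e'_def p_def q_def a' plane_arith vec_eq_iff)
  have e: "cip e e = 1" using r by (simp add: e_def cip_self norm_cscale norm_divide r_def)
  have "cip e' e' = 1"
    using g(1) e r unfolding ea cip_simps by simp
  then have pq: "p * cnj p + q * cnj q = 1" by (simp add: e'_def cip_plane[OF ij])
  define n' where "n' = plane i j (- cnj q) (cnj p)"
  have n': "cip n' n' = 1" "cip n' e' = 0" "cip e' n' = 0" "cip e' e' = 1"
    using pq by (auto simp: n'_def e'_def cip_plane[OF ij] algebra_simps)
  define \<beta> where "\<beta> = cip b' n'"
  have b'e: "b' = cip b' e' *s e' + \<beta> *s n'"
    unfolding \<beta>_def e'_def n'_def by (rule plane_expand[OF ij pq b'])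
  have be: "cip b e = cip b' e'" using g(2) r unfolding ea cip_simps by simp
  have "cip b b = cip b' e' * cnj (cip b' e') + \<beta> * cnj \<beta>"
    by (subst g(3), subst b'e, subst (2) b'e) (simp add: cip_simps n')
  then have "complex_of_real ((norm b)\<^sup>2) = of_real ((cmod (cip b e))\<^sup>2 + (cmod \<beta>)\<^sup>2)"
    unfolding be by (simp add: of_real_cmod_sq cip_self)
  then have "(norm b)\<^sup>2 = (cmod (cip b e))\<^sup>2 + (cmod \<beta>)\<^sup>2" using of_real_eq_iff by blast
  from orthonormal_decomposition[OF d e this] obtain n where n: "cip n n = 1" "cip n e = 0" "b = cip b e *s e + \<beta> *s n" .
  have en: "cip e n = 0" using n(2) cnj_cip[of n e] by simp
  \<comment> \<open>Chosen so that the map sends the orthonormal pair \<open>e\<close>,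
    \<open>n\<close> to the orthonormal pair \<open>e'\<close>, \<open>n'\<close> and kills the
    orthogonal complement.\<close>
  define u1 where "u1 = cnj p *s e - q *s n"
  define u2 where "u2 = cnj q *s e + p *s n"
  have L: "plane i j (cip z u1) (cip z u2) = cip z e *s e' + cip z n *s n'" for z
    unfolding u1_def u2_def e'_def n'_def plane_arith by (simp add: cip_simps algebra_simps)
  have nL: "(norm (plane i j (cip z u1) (cip z u2)))\<^sup>2 = (cmod (cip z e))\<^sup>2 + (cmod (cip z n))\<^sup>2" for z
  proof -
    have "cip (plane i j (cip z u1) (cip z u2)) (plane i j (cip z u1) (cip z u2)) = of_real ((cmod (cip z e))\<^sup>2 + (cmod (cip z n))\<^sup>2)"
      unfolding L by (simp add: cip_simps n' of_real_cmod_sq)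
    then show ?thesis unfolding cip_self using of_real_eq_iff by blast
  qed
  show thesis
  proof (rule that[of u1 u2])
    show "plane i j (cip a u1) (cip a u2) = a'" unfolding L unfolding ea by (simp add: cip_simps e en)
    show "plane i j (cip b u1) (cip b u2) = b'"
    proof -
      have bn: "cip b n = \<beta>" by (subst n(3)) (simp add: cip_simps n(1,2) en)
      show ?thesis unfolding L bn be by (rule b'e[symmetric])
    qed
    show "norm (plane i j (cip z u1) (cip z u2)) \<le> norm z" for z
      using nL[of z] cip_orthonormal_bound[OF e n(1,2), of z] by (simp add: power2_le_imp_le)
    show "\<exists>z. norm z = norm (plane i j x y) \<and> plane i j (cip z u1) (cip z u2) = plane i j x y" for x y
    proof -
      define w where "w = plane i j x y"
      define z where "z = cip w e' *s e + cip w n' *s n"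
      have ze: "cip z e = cip w e'" "cip z n = cip w n'" by (simp_all add: z_def cip_simps e n en)
      have w: "w = cip w e' *s e' + cip w n' *s n'"
        unfolding e'_def n'_def by (rule plane_expand[OF ij pq w_def])
      have 1: "plane i j (cip z u1) (cip z u2) = w" unfolding L ze by (rule w[symmetric])
      have "cip z z = of_real ((cmod (cip w e'))\<^sup>2 + (cmod (cip w n'))\<^sup>2)"
        unfolding z_def by (simp add: cip_simps e n en of_real_cmod_sq)
      then have "(norm z)\<^sup>2 = (cmod (cip w e'))\<^sup>2 + (cmod (cip w n'))\<^sup>2"
        unfolding cip_self using of_real_eq_iff by blast
      then have "(norm z)\<^sup>2 = (norm w)\<^sup>2" using nL[of z] unfolding 1 ze by simp
      then have "norm z = norm w" by (simp add: power2_eq_iff_nonneg)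
      then show ?thesis using 1 unfolding w_def by blast
    qed
  qed
qed

text \<open>The model disc \<open>\<lambda> \<mapsto> (s \<lambda>\<^sup>2, c \<lambda>)\<close> with \<open>c\<^sup>2 = 1 - s\<^sup>2\<close> has the Gram matrix of \<open>G\<close> up to the factors \<open>h\<close>. On it
  \<open>F = (2 s y\<^sub>1 + y\<^sub>2\<^sup>2) / (1 + s\<^sup>2)\<close> equals \<open>\<lambda>\<^sup>2\<close> and \<open>g = c\<^sup>2 y\<^sub>1 - s y\<^sub>2\<^sup>2\<close> vanishes; \<open>F + g\<^sup>2 / 32\<close> is the second
  solution.\<close>

lemma nonunique_normal_form_0:
  fixes z :: "3 \<Rightarrow> complex ^ 'd" and s :: real
  assumes d: "CARD('d) \<ge> 2" and z: "\<And>i. norm (z i) < 1" and z1: "z 1 = 0" "z 2 \<noteq> 0"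
    and l: "\<And>i. cmod (l i) < 1" and s: "0 \<le> s" "s \<le> 1"
    and G: "\<And>i j. 1 - cip (z i) (z j) = h i * cnj (h j) * ((1 - l i * cnj (l j)) * (1 + of_real (s\<^sup>2) * (l i * cnj (l j))))"
  shows "nonunique z (\<lambda>i. (l i)\<^sup>2)"
proof -
  obtain i j :: 'd where ij: "i \<noteq> j" using exists_two_indices[OF d] by blast
  have s2: "s\<^sup>2 \<le> 1" using s by (simp add: power_le_one)
  define c where "c = sqrt (1 - s\<^sup>2)"
  have c2: "c\<^sup>2 = 1 - s\<^sup>2" using s2 by (simp add: c_def)
  define Y where "Y k = plane i j (of_real s * (l k)\<^sup>2) (of_real c * l k)" for k
  define K where "K a b = (1 - l a * cnj (l b)) * (1 + of_real (s\<^sup>2) * (l a * cnj (l b)))" for a b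
  have YY: "1 - cip (Y a) (Y b) = K a b" for a b
  proof -
    have "of_real c * of_real c = (1::complex) - of_real (s\<^sup>2)"
      by (simp add: c2[symmetric] power2_eq_square flip: of_real_mult of_real_power of_real_diff)
        (metis c2 of_real_1 of_real_diff of_real_mult power2_eq_square)
    then show ?thesis unfolding Y_def K_def cip_plane[OF ij] by simp algebra
  qed
  have Yn: "norm (Y a) < 1" for a
  proof -
    have "l a * cnj (l a) = of_real ((cmod (l a))\<^sup>2)" by (simp add: of_real_cmod_sq)
    then have "K a a = of_real ((1 - (cmod (l a))\<^sup>2) * (1 + s\<^sup>2 * (cmod (l a))\<^sup>2))" unfolding K_def by simp
    then have "complex_of_real (1 - (norm (Y a))\<^sup>2) = of_real ((1 - (cmod (l a))\<^sup>2) * (1 + s\<^sup>2 * (cmod (l a))\<^sup>2))"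
      using YY[of a a] by (simp add: cip_self)
    then have "1 - (norm (Y a))\<^sup>2 = (1 - (cmod (l a))\<^sup>2) * (1 + s\<^sup>2 * (cmod (l a))\<^sup>2)" using of_real_eq_iff by blast
    also have "\<dots> > 0" using l[of a] by (intro mult_pos_pos) (auto simp: abs_square_less_1 add_pos_nonneg)
    finally show ?thesis by (simp add: abs_square_less_1)
  qed
  \<comment> \<open>The matching by Gram matrices needs exact equality, so the model points are
    first moved to put the first of them at 0, like \<open>z 1\<close>.\<close>
  define p where "p = Y 1"
  have pn: "norm p < 1" using Yn by (simp add: p_def)
  define Z where "Z k = ballaut p (Y k)" for k
  have K0: "K a b \<noteq> 0" for a b using cip_neq_1[OF Yn Yn, of a b] YY[of a b] by (metis right_minus_eq)
  have gram: "cip (z a) (z b) = cip (Z a) (Z b)" for a b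
  proof -
    have n: "cip (Y k) p \<noteq> 1" for k using cip_neq_1[OF Yn pn] .
    have 11: "complex_of_real (1 - (norm p)\<^sup>2) = K 1 1" unfolding YY[symmetric] p_def cip_self by simp
    have Kb: "cnj (1 - cip (Y b) p) = K 1 b" unfolding YY[symmetric] p_def by (simp add: cnj_cip)
    have ZZ: "1 - cip (Z a) (Z b) = K 1 1 * K a b / (K a 1 * K 1 b)"
      unfolding Z_def ballaut_kernel[OF pn n n] 11 Kb YY by (simp add: YY[symmetric] p_def)
    \<comment> \<open>The row and column of \<open>z 1 = 0\<close> consist of ones and so express
      the gauge factors through \<open>K\<close>; the two Gram matrices then agree exactly and not
      only up to gauge.\<close>
    have eq: "h a * cnj (h 1) * K a 1 = 1" "h 1 * cnj (h b) * K 1 b = 1" "h 1 * cnj (h 1) * K 1 1 = 1"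
      using G[of a 1] G[of 1 b] G[of 1 1] z1 by (simp_all add: K_def)
    have "K 1 1 = K 1 1 * (h a * cnj (h 1) * K a 1) * (h 1 * cnj (h b) * K 1 b)" unfolding eq by simp
    also have "\<dots> = (h 1 * cnj (h 1) * K 1 1) * (h a * cnj (h b) * (K a 1 * K 1 b))" by (simp only: mult_ac)
    finally have k11: "K 1 1 = h a * cnj (h b) * (K a 1 * K 1 b)" unfolding eq by simp
    have "K 1 1 * K a b / (K a 1 * K 1 b) = h a * cnj (h b) * K a b"
      unfolding k11 using K0 by simp
    then have "1 - cip (Z a) (Z b) = 1 - cip (z a) (z b)" using G[of a b] ZZ by (simp add: K_def)
    then show ?thesis by simp
  qed
  have Zp: "\<exists>x y. Z k = plane i j x y" for k unfolding Z_def p_def Y_def by (rule ballaut_plane)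
  obtain a1 a2 b1 b2 where ab: "Z 2 = plane i j a1 a2" "Z 3 = plane i j b1 b2" using Zp by metis
  obtain u1 u2 where
    L: "plane i j (cip (z 2) u1) (cip (z 2) u2) = Z 2" "plane i j (cip (z 3) u1) (cip (z 3) u2) = Z 3"
    "\<And>w. norm (plane i j (cip w u1) (cip w u2)) \<le> norm w"
    "\<And>x y. \<exists>w. norm w = norm (plane i j x y) \<and> plane i j (cip w u1) (cip w u2) = plane i j x y"
    using gram_eq_contraction[OF d ij z1(2) ab gram gram gram] by metis
  define L where "L w = plane i j (cip w u1) (cip w u2)" for w
  have L1: "L (z 1) = Z 1" using ballaut_self[OF pn] by (simp add: L_def z1 Z_def p_def plane_def)
  have Lz: "L (z k) = Z k" for k
    using exhaust_3[of k] L1 L(1,2) by (auto simp: L_def)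
  \<comment> \<open>A holomorphic self-map of the ball sending \<open>z k\<close> to the model point
    \<open>Y k\<close>: functions of the two model coordinates are pulled back along it.\<close>
  define \<Psi> where "\<Psi> w = ballaut p (L w)" for w
  have \<Psi>n: "norm (\<Psi> w) < 1" if "norm w < 1" for w
    unfolding \<Psi>_def by (rule ballaut_norm[OF pn]) (use L(3)[of w] that in \<open>simp add: L_def\<close>)
  have \<Psi>z: "\<Psi> (z k) = Y k" for k
    unfolding \<Psi>_def Lz Z_def by (rule ballaut_ballaut[OF pn cip_neq_1[OF Yn pn]])
  have \<Psi>h: "cn_holomorphic_on (\<lambda>w. \<Psi> w $ k) (ball 0 1)" for k
    unfolding \<Psi>_def
  proof (rule cn_holomorphic_on_compose_vec[where V = "ball 0 1" and f = "\<lambda>w. ballaut p w $ k"])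
    show "cn_holomorphic_on (\<lambda>w. L w $ m) (ball 0 1)" for m
      unfolding L_def plane_def by (auto intro!: cn_holomorphic_intros cn_holomorphic_on_cip)
    show "L ` ball 0 1 \<subseteq> ball 0 1" using le_less_trans[OF L(3)] by (auto simp: L_def)
  qed (rule cn_holomorphic_on_ballaut[OF pn])
  define g where "g w = of_real (1 - s\<^sup>2) * \<Psi> w $ i - of_real s * (\<Psi> w $ j)\<^sup>2" for w
  define F where "F e w = of_real (2 / (1 + s\<^sup>2)) * (of_real s * \<Psi> w $ i + (\<Psi> w $ j)\<^sup>2 / 2) + of_real e * (g w)\<^sup>2" for e :: real and w
  have sol: "solves z (\<lambda>i. (l i)\<^sup>2) (F e)" if e: "0 \<le> e" "e \<le> 1 / 32" for e
    unfolding solves_def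
  proof (intro conjI allI impI)
    show "cn_holomorphic_on (F e) (ball 0 1)"
      unfolding F_def g_def by (intro cn_holomorphic_intros \<Psi>h) auto
    show "F e (z k) = (l k)\<^sup>2" for k
    proof -
      have cc: "(of_real c)\<^sup>2 = (1::complex) - (of_real s)\<^sup>2" using c2 by (metis of_real_1 of_real_diff of_real_power)
      have n: "1 + (complex_of_real s)\<^sup>2 \<noteq> 0"
      proof -
        have "1 + s\<^sup>2 \<noteq> 0" by (smt (verit) zero_le_power2)
        then show ?thesis by (metis of_real_1 of_real_add of_real_eq_0_iff of_real_power)
      qed
      have "g (z k) = 0" unfolding g_def \<Psi>z Y_def plane_nth[OF ij] by (simp add: power_mult_distrib cc)
      moreover have v: "of_real s * (of_real s * (l k)\<^sup>2) + (of_real c * l k)\<^sup>2 / 2 = (l k)\<^sup>2 * (1 + (of_real s)\<^sup>2) / 2"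
        unfolding power_mult_distrib cc by (simp add: power2_eq_square field_simps)
      ultimately show ?thesis unfolding F_def \<Psi>z Y_def plane_nth[OF ij] v using n by simp
    qed
    fix w :: "complex ^ 'd" assume w: "norm w < 1"
    \<comment> \<open>Half of the slack in \<open>normal_form_bound\<close>, whence the divisor 32:
      as \<open>M \<le> 1\<close>, it follows that \<open>(m / M)\<^sup>2 < 1 - 2 * t\<close>, which
      is at most \<open>(1 - t)\<^sup>2\<close>.\<close>
    define t where "t = (cmod (g w))\<^sup>2 / 32"
    define m where "m = cmod (of_real s * \<Psi> w $ i + (\<Psi> w $ j)\<^sup>2 / 2)"
    define M where "M = (1 + s\<^sup>2) / 2"
    have M: "M > 0" "M \<le> 1" using s2 by (auto simp: M_def add_pos_nonneg)
    have "(cmod (\<Psi> w $ i))\<^sup>2 + (cmod (\<Psi> w $ j))\<^sup>2 < 1"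
      using norm_nth2[OF ij, of "\<Psi> w"] \<Psi>n[OF w] by (smt (verit) norm_ge_zero abs_square_less_1 abs_of_nonneg)
    from normal_form_bound[OF s this] have b: "m\<^sup>2 + 2 * t < M\<^sup>2"
      unfolding m_def t_def g_def M_def by simp
    have t0: "t \<ge> 0" by (simp add: t_def)
    have "(m / M)\<^sup>2 + 2 * t < 1"
    proof -
      have "2 * t * M\<^sup>2 \<le> 2 * t" using t0 M by (simp add: mult_left_le power_le_one)
      then have "m\<^sup>2 + 2 * t * M\<^sup>2 < M\<^sup>2" using b by linarith
      then show ?thesis using M by (simp add: field_simps power_divide)
    qed
    moreover have "1 - 2 * t \<le> (1 - t)\<^sup>2" by (simp add: power2_eq_square algebra_simps)
    moreover have "t < 1" using calculation t0 by (smt (verit) zero_le_power2)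
    ultimately have "m / M < 1 - t" by (smt (verit) power2_less_imp_less)
    moreover have "cmod (F e w) \<le> \<bar>2 / (1 + s\<^sup>2)\<bar> * m + \<bar>e\<bar> * (cmod (g w))\<^sup>2"
      unfolding F_def m_def by (rule order.trans[OF norm_triangle_ineq], unfold norm_mult norm_power norm_of_real, rule order_refl)
    moreover have "\<bar>2 / (1 + s\<^sup>2)\<bar> * m = m / M"
    proof -
      have "\<bar>2 / (1 + s\<^sup>2)\<bar> = 2 / (1 + s\<^sup>2)" by (simp add: add_nonneg_nonneg)
      then show ?thesis by (simp add: M_def)
    qed
    moreover have "\<bar>e\<bar> * (cmod (g w))\<^sup>2 \<le> t" unfolding t_def using e mult_right_mono[of e "1/32" "(cmod (g w))\<^sup>2"] by simp
    ultimately show "cmod (F e w) < 1" by linarith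
  qed
  \<comment> \<open>A point of the plane off the zero set of \<open>g\<close> lifts to the ball
    because the contraction is onto.\<close>
  have "\<exists>w. norm w < 1 \<and> g w \<noteq> 0"
  proof -
    obtain x y :: complex where xy: "norm (plane i j x y) < 1" "of_real (1 - s\<^sup>2) * x - of_real s * y\<^sup>2 \<noteq> 0"
    proof (cases "s = 0")
      case True
      have "norm (plane i j (1/2) 0) = 1 / 2" unfolding plane_def by (simp add: norm_cscale)
      then show ?thesis using that[of "1/2" 0] True by simp
    next
      case False
      have "norm (plane i j 0 (1/2)) = 1 / 2" unfolding plane_def by (simp add: norm_cscale)
      then show ?thesis using that[of 0 "1/2"] False by simp
    qed
    obtain x' y' where b: "ballaut p (plane i j x y) = plane i j x' y'" unfolding p_def Y_def using ballaut_plane by metis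
    obtain w where w: "norm w = norm (plane i j x' y')" "L w = plane i j x' y'" using L(4) unfolding L_def by blast
    have "\<Psi> w = plane i j x y" unfolding \<Psi>_def w(2) b[symmetric]
      by (rule ballaut_ballaut[OF pn cip_neq_1[OF xy(1) pn]])
    then have "g w \<noteq> 0" using xy(2) by (simp add: g_def plane_nth[OF ij])
    moreover have "norm w < 1" unfolding w(1) b[symmetric] by (rule ballaut_norm[OF pn xy(1)])
    ultimately show ?thesis by blast
  qed
  then obtain w where w: "norm w < 1" "g w \<noteq> 0" by blast
  have "F 0 w \<noteq> F (1/32) w" using w(2) by (simp add: F_def)
  then show ?thesis unfolding nonunique_def using sol[of 0] sol[of "1/32"] w(1) by force
qed

lemma nonunique_normal_form:
  fixes z :: "3 \<Rightarrow> complex ^ 'd" and s :: real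
  assumes d: "CARD('d) \<ge> 2" and z: "\<And>i. norm (z i) < 1" and z12: "z 1 \<noteq> z 2"
    and l: "\<And>i. cmod (l i) < 1" and s: "0 \<le> s" "s \<le> 1"
    and G: "\<And>i j. 1 - cip (z i) (z j) = h i * cnj (h j) * ((1 - l i * cnj (l j)) * (1 + of_real (s\<^sup>2) * (l i * cnj (l j))))"
  shows "nonunique z (\<lambda>i. (l i)\<^sup>2)"
proof (rule nonunique_ballaut[of "z 1"])
  let ?z = "\<lambda>j. ballaut (z 1) (z j)"
  obtain k where k: "gram ?z = gauge_mat k (gram z)"
    using gram_ballaut[of "z 1" z] z by blast
  show "nonunique ?z (\<lambda>i. (l i)\<^sup>2)"
  proof (rule nonunique_normal_form_0[OF d, where s = s and h = "\<lambda>i. k i * h i"])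
    show "norm (?z i) < 1" for i by (rule ballaut_norm[OF z z])
    show "?z 1 = 0" by (rule ballaut_self[OF z])
    show "?z 2 \<noteq> 0"
    proof
      assume "?z 2 = 0"
      then have "z 2 = z 1" using ballaut_ballaut[OF z cip_neq_1[OF z z], of 1 2] by (simp add: ballaut_0)
      then show False using z12 by simp
    qed
    show "1 - cip (?z i) (?z j) = (k i * h i) * cnj (k j * h j) * ((1 - l i * cnj (l j)) * (1 + of_real (s\<^sup>2) * (l i * cnj (l j))))" for i j
      using fun_cong[OF fun_cong[OF k], of i j] G[of i j] by (simp add: gram_def gauge_mat_def mult_ac)
  qed (use l s in auto)
qed (use z in auto)

section \<open>Extremal pairs of points\<close>

text \<open>The nodes are \<open>0\<close>, one that tends to the critical radius \<open>sqrt A\<close> and one that tends to the unit circle: in the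
  limit the Pick condition becomes a Julia inequality at a boundary point.\<close>

lemma pick_dominates_julia:
  fixes A B B' :: real
  assumes G: "\<And>j. G 1 j = 1" "\<And>j. G j 1 = 1" "G 2 2 = of_real (1 - A)" "G 3 3 = of_real (1 - B)"
      "G 2 3 = 1 - m" "G 3 2 = cnj (1 - m)"
    and G': "\<And>j. G' 1 j = 1" "\<And>j. G' j 1 = 1" "G' 2 2 = of_real (1 - A)" "G' 3 3 = of_real (1 - B')"
      "G' 2 3 = 1 - q" "G' 3 2 = cnj (1 - q)"
    and d: "pick_dominates G G'" and A: "0 < A" "A < 1" and B: "0 \<le> B" "B < 1"
    and w0: "(cmod w0)\<^sup>2 = A" and m: "w0 \<noteq> m"
  shows "(1 - B) * (cmod (w0 - q))\<^sup>2 \<le> (1 - B') * (cmod (w0 - m))\<^sup>2"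
proof -
  have w01: "1 - w0 \<noteq> 0" using w0 A by auto
  define P where "P = (cmod (w0 - m))\<^sup>2"
  define N where "N = (cmod (1 - w0))\<^sup>2"
  have PN: "P > 0" "N > 0" using m w01 by (auto simp: P_def N_def)
  have main: "(1 - A) * \<kappa> * (cmod (w0 - q))\<^sup>2 \<le> (1 - B') * N"
    if \<kappa>: "0 < \<kappa>" "(1 - A) * \<kappa> * P < (1 - B) * N" for \<kappa>
  proof -
    \<comment> \<open>Squared radii of the second and third node. The gaps \<open>x - A\<close> and
      \<open>1 - y\<close> both vanish linearly, so \<open>\<epsilon>\<close> cancels from the
      reduced Pick inequality; \<open>\<kappa>\<close> is the ratio of the rates.\<close>
    define x where "x \<epsilon> = A + \<epsilon>" for \<epsilon> :: real
    define y where "y \<epsilon> = 1 - \<kappa> * \<epsilon>" for \<epsilon> :: real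
    define W where "W \<epsilon> = of_real (sqrt (x \<epsilon> * y \<epsilon> / A)) * w0" for \<epsilon>
    have xl: "(x \<longlongrightarrow> A) (at_right 0)" unfolding x_def by (auto intro!: tendsto_eq_intros)
    have yl: "(y \<longlongrightarrow> 1) (at_right 0)" unfolding y_def by (auto intro!: tendsto_eq_intros)
    have Wl: "(W \<longlongrightarrow> w0) (at_right 0)"
      unfolding W_def using A by (auto intro!: tendsto_eq_intros xl yl)
    have l1: "((\<lambda>\<epsilon>. (1 - x \<epsilon>) * \<kappa> * (cmod (W \<epsilon> - m))\<^sup>2) \<longlongrightarrow> (1 - A) * \<kappa> * P) (at_right 0)"
      unfolding P_def by (intro tendsto_intros xl Wl)
    have l2: "((\<lambda>\<epsilon>. (y \<epsilon> - B) * (cmod (1 - W \<epsilon>))\<^sup>2) \<longlongrightarrow> (1 - B) * N) (at_right 0)"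
      unfolding N_def by (intro tendsto_intros yl Wl)
    have l3: "((\<lambda>\<epsilon>. (1 - x \<epsilon>) * \<kappa> * (cmod (W \<epsilon> - q))\<^sup>2) \<longlongrightarrow> (1 - A) * \<kappa> * (cmod (w0 - q))\<^sup>2) (at_right 0)"
      by (intro tendsto_intros xl Wl)
    have l4: "((\<lambda>\<epsilon>. (y \<epsilon> - B') * (cmod (1 - W \<epsilon>))\<^sup>2) \<longlongrightarrow> (1 - B') * N) (at_right 0)"
      unfolding N_def by (intro tendsto_intros yl Wl)
    have ev: "eventually (\<lambda>\<epsilon>. (1 - x \<epsilon>) * \<kappa> * (cmod (W \<epsilon> - m))\<^sup>2 < (y \<epsilon> - B) * (cmod (1 - W \<epsilon>))\<^sup>2) (at_right 0)"
    proof -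
      have "eventually (\<lambda>\<epsilon>. 0 < (y \<epsilon> - B) * (cmod (1 - W \<epsilon>))\<^sup>2 - (1 - x \<epsilon>) * \<kappa> * (cmod (W \<epsilon> - m))\<^sup>2) (at_right 0)"
        by (rule order_tendstoD(1)[OF tendsto_diff[OF l2 l1]]) (use \<kappa> in simp)
      then show ?thesis by eventually_elim simp
    qed
    have evx: "eventually (\<lambda>\<epsilon>. x \<epsilon> < 1) (at_right 0)" by (rule order_tendstoD(2)[OF xl A(2)])
    have evy: "eventually (\<lambda>\<epsilon>. B < y \<epsilon>) (at_right 0)" by (rule order_tendstoD(1)[OF yl B(2)])
    have evp: "eventually (\<lambda>\<epsilon>. (0::real) < \<epsilon>) (at_right 0)" by (rule eventually_at_right_less)
    have "eventually (\<lambda>\<epsilon>. (1 - x \<epsilon>) * \<kappa> * (cmod (W \<epsilon> - q))\<^sup>2 \<le> (y \<epsilon> - B') * (cmod (1 - W \<epsilon>))\<^sup>2) (at_right 0)"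
      using ev evx evy evp
    proof eventually_elim
      case (elim \<epsilon>)
      define X where "X = x \<epsilon>"
      define Y where "Y = y \<epsilon>"
      have XY: "A < X" "X < 1" "B < Y" "Y < 1" "0 < X" "0 < Y" using elim \<kappa>(1) A B by (auto simp: X_def Y_def x_def y_def)
      define l :: "3 \<Rightarrow> complex" where
        "l i = (if i = 1 then 0 else if i = 2 then of_real (sqrt X) else of_real (sqrt Y) * cnj (w0 / of_real (sqrt A)))" for i
      have l: "l 1 = 0" "l 2 = of_real (sqrt X)" "l 3 = of_real (sqrt Y) * cnj (w0 / of_real (sqrt A))" by (auto simp: l_def)
      have cw: "cmod w0 = sqrt A" using w0 by (metis norm_ge_zero real_sqrt_abs abs_of_nonneg)
      have c2: "cmod (l 2) = sqrt X" using XY by (simp add: l)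
      have c3: "cmod (l 3) = sqrt Y" using XY A by (simp add: l norm_mult norm_divide cw)
      have lW: "l 2 * cnj (l 3) = W \<epsilon>" using XY A
        by (simp add: l W_def X_def[symmetric] Y_def[symmetric] real_sqrt_mult real_sqrt_divide)
      have ln: "cmod (l i) < 1" for i using exhaust_3[of i] l(1) c2 c3 XY by auto
      have X2: "(cmod (l 2))\<^sup>2 = X" "(cmod (l 3))\<^sup>2 = Y" using XY by (simp_all add: c2 c3)
      have e: "X - A = \<epsilon>" "1 - Y = \<kappa> * \<epsilon>" by (simp_all add: X_def Y_def x_def y_def)
      have "pd (pick G l)"
        unfolding pick_reduced(1)[where G = G and A = A and B = B and m = m and l = l, OF G l(1) ln] X2 lW e
        using XY mult_strict_left_mono[OF elim(1) elim(4)] by (simp add: X_def Y_def mult_ac)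
      then have "psd (pick G' l)" using d ln unfolding pick_dominates_def by blast
      then have "(1 - X) * (\<kappa> * \<epsilon>) * (cmod (W \<epsilon> - q))\<^sup>2 \<le> \<epsilon> * (Y - B') * (cmod (1 - W \<epsilon>))\<^sup>2"
        unfolding pick_reduced(2)[where G = G' and A = A and B = B' and m = q and l = l, OF G' l(1) ln] X2 lW e by blast
      then have "\<epsilon> * ((1 - X) * \<kappa> * (cmod (W \<epsilon> - q))\<^sup>2) \<le> \<epsilon> * ((Y - B') * (cmod (1 - W \<epsilon>))\<^sup>2)"
        by (simp add: mult_ac)
      then show ?case using elim(4) unfolding X_def Y_def by (rule mult_left_le_imp_le)
    qed
    then show ?thesis by (rule tendsto_le[OF trivial_limit_at_right_real l4 l3])
  qed
  \<comment> \<open>Here \<open>\<kappa>\<close> is the fraction \<open>\<theta>\<close> of the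
    critical rate for the points; letting \<open>\<theta>\<close> tend to 1 gives the claim.\<close>
  have "\<theta> * ((1 - B) * (cmod (w0 - q))\<^sup>2) \<le> (1 - B') * P" if \<theta>: "0 < \<theta>" "\<theta> < 1" for \<theta>
  proof -
    define \<kappa> where "\<kappa> = \<theta> * ((1 - B) * N / ((1 - A) * P))"
    have k: "(1 - A) * \<kappa> * P = \<theta> * ((1 - B) * N)" using PN A by (simp add: \<kappa>_def)
    have "0 < \<kappa>" using \<theta> PN A B by (simp add: \<kappa>_def)
    moreover have "(1 - A) * \<kappa> * P < (1 - B) * N" unfolding k using \<theta> PN B by simp
    ultimately have "(1 - A) * \<kappa> * (cmod (w0 - q))\<^sup>2 \<le> (1 - B') * N" by (rule main)
    then have "((1 - A) * \<kappa> * P) * (cmod (w0 - q))\<^sup>2 \<le> (1 - B') * N * P"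
      using PN mult_right_mono[of _ _ P] by (simp add: mult_ac)
    then have "N * (\<theta> * ((1 - B) * (cmod (w0 - q))\<^sup>2)) \<le> N * ((1 - B') * P)" unfolding k by (simp add: mult_ac)
    then show ?thesis using PN(2) by (rule mult_left_le_imp_le)
  qed
  then show ?thesis unfolding P_def by (rule field_le_mult_one_interval)
qed

text \<open>The difference of the two sides is the square of \<open>Re (U * cnj D)\<close> divided
  by \<open>Re D * |D|^2\<close>.\<close>

lemma Re_power2_divide_ge:
  assumes "Re D > 0" shows "Re (U\<^sup>2 / D) \<ge> - ((Im U)\<^sup>2 / Re D)"
proof -
  define X where "X = Re U" define Y where "Y = Im U" define a where "a = Re D" define c where "c = Im D"
  have a: "a > 0" using assms by (simp add: a_def)
  have n: "a\<^sup>2 + c\<^sup>2 > 0" using a by (simp add: add_pos_nonneg)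
  have "Re (U\<^sup>2 / D) = ((X\<^sup>2 - Y\<^sup>2) * a + 2 * X * Y * c) / (a\<^sup>2 + c\<^sup>2)"
    by (simp add: Re_divide X_def Y_def a_def c_def power2_eq_square)
  also have "\<dots> + Y\<^sup>2 / a = (X * a + Y * c)\<^sup>2 / (a * (a\<^sup>2 + c\<^sup>2))"
    using a n by (simp add: divide_simps) (simp add: power2_eq_square algebra_simps)
  finally have "Re (U\<^sup>2 / D) + Y\<^sup>2 / a \<ge> 0" using a n by simp
  then show ?thesis by (simp add: Y_def a_def)
qed

lemma cayley_norm: assumes "Re W > 0" shows "cmod ((W - 1) / (W + 1)) < 1" "W + 1 \<noteq> 0"
proof -
  show n: "W + 1 \<noteq> 0" using assms by (auto simp: complex_eq_iff)
  have "(cmod (W - 1))\<^sup>2 < (cmod (W + 1))\<^sup>2" using assms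
    by (simp add: cmod_power2) (simp add: power2_eq_square algebra_simps)
  then have "cmod (W - 1) < cmod (W + 1)" by (rule power_less_imp_less_base) simp
  then show "cmod ((W - 1) / (W + 1)) < 1" using n by (simp add: norm_divide)
qed

text \<open>In the Siegel domain \<open>Re w > |v|\<^sup>2\<close> with \<open>v = V + i H\<close>, the real part of \<open>w + \<omega> v\<^sup>2\<close> exceeds \<open>V\<^sup>2\<close>, while the
  perturbation has real part at least \<open>- V\<^sup>2\<close> because \<open>Im (v (v - i k)) = V (2 H - k)\<close>.\<close>

lemma siegel_bound:
  fixes \<omega> k e :: real
  assumes w: "(cmod v)\<^sup>2 < Re w" and \<omega>: "0 \<le> \<omega>" "\<omega> \<le> 1" and k: "0 \<le> k" "k \<le> 1" and e: "0 \<le> e" "e \<le> 1 / 8"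
  shows "0 < Re (w + of_real \<omega> * v\<^sup>2 + of_real e * ((v * (v - \<i> * of_real k))\<^sup>2 / (1 + w)))"
proof -
  define V where "V = Re v" define H where "H = Im v"
  have vv: "(cmod v)\<^sup>2 = V\<^sup>2 + H\<^sup>2" by (simp add: V_def H_def cmod_power2)
  have D: "Re (1 + w) \<ge> 1 + V\<^sup>2 + H\<^sup>2" using w vv by simp
  have Dp: "Re (1 + w) > 0" using D by (smt (verit) zero_le_power2)
  have Y: "Im (v * (v - \<i> * of_real k)) = V * (2 * H - k)" by (simp add: V_def H_def algebra_simps)
  \<comment> \<open>Both \<open>8 * H\<^sup>2\<close> and \<open>2 * k\<^sup>2 \<le> 2\<close> are
    absorbed by \<open>8 * (1 + V\<^sup>2 + H\<^sup>2)\<close>; this 8 is the origin of the bound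
    1/8 on \<open>e\<close>.\<close>
  have "(2 * H - k)\<^sup>2 \<le> 2 * (2 * H)\<^sup>2 + 2 * k\<^sup>2"
    using zero_le_power2[of "2 * H + k"] by (simp add: power2_eq_square algebra_simps)
  also have "k\<^sup>2 \<le> 1" using k by (simp add: power_le_one)
  finally have "(2 * H - k)\<^sup>2 \<le> 8 * (1 + V\<^sup>2 + H\<^sup>2)" by (simp add: power_mult_distrib) (smt (verit) zero_le_power2)
  also have "\<dots> \<le> 8 * Re (1 + w)" by (rule mult_left_mono[OF D]) simp
  finally have "(2 * H - k)\<^sup>2 \<le> 8 * Re (1 + w)" .
  then have "V\<^sup>2 * (2 * H - k)\<^sup>2 \<le> V\<^sup>2 * (8 * Re (1 + w))" by (intro mult_left_mono) auto
  then have b: "(Im (v * (v - \<i> * of_real k)))\<^sup>2 / Re (1 + w) \<le> 8 * V\<^sup>2"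
    unfolding Y power_mult_distrib using Dp by (simp add: divide_le_eq algebra_simps)
  have "e * ((Im (v * (v - \<i> * of_real k)))\<^sup>2 / Re (1 + w)) \<le> 1/8 * (8 * V\<^sup>2)"
    using e b Dp by (intro mult_mono) auto
  moreover have "e * Re ((v * (v - \<i> * of_real k))\<^sup>2 / (1 + w)) \<ge> e * - ((Im (v * (v - \<i> * of_real k)))\<^sup>2 / Re (1 + w))"
    by (rule mult_left_mono[OF Re_power2_divide_ge[OF Dp] e(1)])
  ultimately have 1: "e * Re ((v * (v - \<i> * of_real k))\<^sup>2 / (1 + w)) \<ge> - V\<^sup>2" by simp
  have "\<omega> * H\<^sup>2 \<le> H\<^sup>2" "0 \<le> \<omega> * V\<^sup>2" using \<omega> by (auto simp: mult_left_le_one_le)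
  then have 2: "Re (of_real \<omega> * v\<^sup>2) \<ge> - H\<^sup>2" by (simp add: V_def H_def power2_eq_square algebra_simps)
  have r: "Re (of_real e * x) = e * Re x" for x by simp
  show ?thesis unfolding plus_complex.sel r using 1 2 w vv by linarith
qed

text \<open>Since \<open>z 2 = \<alpha> *s e\<close> with a unit vector \<open>e\<close> and target
  \<open>\<alpha>\<close>, the Schwarz lemma forces every solution to be the coordinate along the
  disc of \<open>e\<close>; freedom remains only orthogonally to it. In Siegel coordinates this disc
  is \<open>v = 0\<close>, so a multiple of \<open>v\<^sup>2\<close> added to \<open>W\<close>
  corrects the value at \<open>z 3\<close>. The Julia inequality guarantees that the coefficient
  needed lies between 0 and 1.\<close>

lemma nonunique_degenerate_0:
  fixes z :: "3 \<Rightarrow> complex ^ 'd"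
  assumes d: "CARD('d) \<ge> 2" and z: "\<And>i. norm (z i) < 1" and \<zeta>: "\<And>i. cmod (\<zeta> i) < 1"
    and z1: "z 1 = 0" "z 2 \<noteq> 0" "\<zeta> 1 = 0" and tight: "cmod (\<zeta> 2) = norm (z 2)"
    and dom: "pick_dominates (gram z) (cgram \<zeta>)"
  shows "nonunique z \<zeta>"
proof -
  define \<alpha> where "\<alpha> = \<zeta> 2"
  define \<beta> where "\<beta> = \<zeta> 3"
  define b where "b = z 3"
  define A where "A = (cmod \<alpha>)\<^sup>2"
  define B where "B = (norm b)\<^sup>2"
  define e where "e = (1 / \<alpha>) *s z 2"
  have \<alpha>: "\<alpha> \<noteq> 0" "cmod \<alpha> < 1" using tight z1 \<zeta>[of 2] by (auto simp: \<alpha>_def)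
  have \<beta>1: "cmod \<beta> < 1" using \<zeta> by (simp add: \<beta>_def)
  have z2: "z 2 = \<alpha> *s e" using \<alpha> by (simp add: e_def vec_eq_iff)
  have ee: "cip e e = 1" using \<alpha> tight z1 by (simp add: e_def cip_self norm_cscale norm_divide \<alpha>_def)
  define b1 where "b1 = cip b e"
  have ne: "norm e = 1" using ee by (simp add: cip_self flip: of_real_power) (metis norm_ge_zero of_real_1 of_real_eq_iff of_real_power power2_eq_1_iff one_neq_neg_one abs_1 abs_of_nonneg abs_minus_cancel)
  have b1: "cmod b1 \<le> norm b" using cip_bound[of b e] ne by (simp add: b1_def)
  have nb: "norm b < 1" using z by (simp add: b_def)
  then have b1': "cmod b1 < 1" using b1 by simp
  have AB: "0 < A" "A < 1" "0 \<le> B" "B < 1" using \<alpha> nb by (auto simp: A_def B_def abs_square_less_1)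
  have m: "cip (z 2) (z 3) = \<alpha> * cnj b1" unfolding z2 by (simp add: cip_simps b1_def b_def cnj_cip)
  have m': "cip (z 3) (z 2) = cnj (\<alpha> * cnj b1)" unfolding m[symmetric] by (simp add: cnj_cip)
  have A2: "cip (z 2) (z 2) = of_real A" unfolding cip_self A_def \<alpha>_def tight ..
  have AB2: "cip (z 3) (z 3) = of_real B" "\<zeta> 2 * cnj (\<zeta> 2) = of_real A" "\<zeta> 3 * cnj (\<zeta> 3) = of_real ((cmod \<beta>)\<^sup>2)"
    by (simp_all add: cip_self B_def b_def A_def \<alpha>_def \<beta>_def of_real_cmod_sq)
  \<comment> \<open>Applied at \<open>w0 = \<alpha> * cnj \<tau>\<close>, which runs over the circle
    of squared radius \<open>A\<close>, so that every boundary point \<open>\<tau>\<close> yields an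
    inequality.\<close>
  have julia: "(1 - B) * (cmod (1 - \<tau> * cnj \<beta>))\<^sup>2 \<le> (1 - (cmod \<beta>)\<^sup>2) * (cmod (1 - cnj b1 * \<tau>))\<^sup>2" if \<tau>: "cmod \<tau> = 1" for \<tau>
  proof -
    have c: "cmod (cnj \<tau> - cnj u) = cmod (1 - cnj u * \<tau>)" for u
    proof -
      have "\<tau> * (cnj \<tau> - cnj u) = 1 - cnj u * \<tau>" using \<tau> by (simp add: algebra_simps flip: of_real_cmod_sq)
      then show ?thesis using \<tau> by (metis mult.left_neutral norm_mult)
    qed
    have f: "cmod (\<alpha> * cnj \<tau> - \<alpha> * cnj u) = cmod \<alpha> * cmod (1 - cnj u * \<tau>)" for u
      unfolding c[symmetric] by (simp add: right_diff_distrib flip: norm_mult)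
    have "1 - cnj b1 * \<tau> \<noteq> 0" using moeb_denom[OF b1', of \<tau>] \<tau> by simp
    then have ne: "\<alpha> * cnj \<tau> \<noteq> \<alpha> * cnj b1" using f[of b1] \<alpha> by auto
    have "(1 - B) * (cmod (\<alpha> * cnj \<tau> - \<alpha> * cnj \<beta>))\<^sup>2 \<le> (1 - (cmod \<beta>)\<^sup>2) * (cmod (\<alpha> * cnj \<tau> - \<alpha> * cnj b1))\<^sup>2"
    proof (rule pick_dominates_julia[OF _ _ _ _ _ _ _ _ _ _ _ _ dom])
      show "(cmod (\<alpha> * cnj \<tau>))\<^sup>2 = A" using \<tau> by (simp add: norm_mult A_def)
    qed (use AB ne in \<open>auto simp: gram_def cgram_def z1 m m' A2 AB2 simp del: of_real_power, simp_all add: \<alpha>_def \<beta>_def\<close>)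
    then have "A * ((1 - B) * (cmod (1 - cnj \<beta> * \<tau>))\<^sup>2) \<le> A * ((1 - (cmod \<beta>)\<^sup>2) * (cmod (1 - cnj b1 * \<tau>))\<^sup>2)"
      unfolding f by (simp add: power_mult_distrib A_def mult_ac)
    then show ?thesis using AB by (simp add: mult.commute)
  qed
  define \<gamma> where "\<gamma> = 1 - (cmod b1)\<^sup>2"
  have \<gamma>: "\<gamma> > 0" "\<gamma> \<le> 1" using b1' by (auto simp: \<gamma>_def abs_square_less_1)
  \<comment> \<open>Moving \<open>b1\<close> to 0 puts \<open>z 3\<close> over the centre: its new
    coordinates are 0 along \<open>e\<close> and \<open>k\<close> along \<open>n\<close>, and its
    target becomes \<open>\<beta>'\<close>.\<close>
  define \<beta>' where "\<beta>' = moeb b1 \<beta>"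
  define \<rho> where "\<rho> = cmod \<beta>'"
  have \<rho>: "0 \<le> \<rho>" "\<rho> < 1" using moeb_norm[OF b1' \<beta>1] by (auto simp: \<rho>_def \<beta>'_def)
  define k where "k = sqrt ((B - (cmod b1)\<^sup>2) / \<gamma>)"
  have Bb: "(cmod b1)\<^sup>2 \<le> B" unfolding B_def using b1 by (simp add: power_mono)
  have k2: "k\<^sup>2 = (B - (cmod b1)\<^sup>2) / \<gamma>" using Bb \<gamma> by (simp add: k_def)
  have k1: "1 - k\<^sup>2 = (1 - B) / \<gamma>" unfolding k2 using \<gamma> by (simp add: field_simps) (simp add: \<gamma>_def)
  have "(1 - B) / \<gamma> > 0" using AB \<gamma> by simp
  then have "k\<^sup>2 < 1" using k1 by linarith
  have k0: "0 \<le> k" unfolding k_def using Bb \<gamma> by simp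
  have kk: "k \<le> 1" using \<open>k\<^sup>2 < 1\<close> k0 by (simp add: abs_square_less_1)
  have "(1 - k\<^sup>2) * (cmod (1 - \<tau> * cnj \<beta>'))\<^sup>2 \<le> 1 - \<rho>\<^sup>2" if \<tau>: "cmod \<tau> = 1" for \<tau>
  proof -
    define t where "t = moeb (- b1) \<tau>"
    have t: "cmod t = 1" using moeb_unimodular[of "- b1" \<tau>] b1' \<tau> by (simp add: t_def)
    have \<tau>t: "\<tau> = moeb b1 t" using moeb_moeb[of "- b1" \<tau>] b1' \<tau> by (simp add: t_def)
    define p where "p = (cmod (1 - cnj b1 * t))\<^sup>2"
    define q where "q = (cmod (1 - cnj b1 * \<beta>))\<^sup>2"
    have p: "p > 0" "q > 0" using moeb_denom[OF b1', of t] moeb_denom[OF b1', of \<beta>] t \<beta>1 by (auto simp: p_def q_def)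
    have "1 - \<tau> * cnj \<beta>' = of_real \<gamma> * (1 - t * cnj \<beta>) / ((1 - cnj b1 * t) * cnj (1 - cnj b1 * \<beta>))"
      unfolding \<tau>t \<beta>'_def \<gamma>_def by (rule moeb_kernel) (use b1' t \<beta>1 in auto)
    then have 1: "(cmod (1 - \<tau> * cnj \<beta>'))\<^sup>2 = \<gamma>\<^sup>2 * (cmod (1 - t * cnj \<beta>))\<^sup>2 / (p * q)"
      unfolding p_def q_def by (simp only: norm_divide norm_mult power_divide power_mult_distrib complex_mod_cnj norm_of_real power2_abs)
    have 2: "1 - \<rho>\<^sup>2 = \<gamma> * (1 - (cmod \<beta>)\<^sup>2) / q"
      unfolding \<rho>_def \<beta>'_def q_def \<gamma>_def by (rule moeb_norm_sq) (use b1' \<beta>1 in auto)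
    have "(1 - k\<^sup>2) * (cmod (1 - \<tau> * cnj \<beta>'))\<^sup>2 = \<gamma> / (p * q) * ((1 - B) * (cmod (1 - t * cnj \<beta>))\<^sup>2)"
      unfolding 1 k1 using \<gamma> by (simp add: power2_eq_square)
    also have "\<dots> \<le> \<gamma> / (p * q) * ((1 - (cmod \<beta>)\<^sup>2) * p)"
      unfolding p_def by (rule mult_left_mono[OF julia[OF t]]) (use \<gamma> p in \<open>simp add: p_def\<close>)
    also have "\<dots> = 1 - \<rho>\<^sup>2" unfolding 2 using p by simp
    finally show ?thesis .
  qed
  note julia' = this
  \<comment> \<open>Rotates the target to \<open>- \<rho>\<close>. The Julia inequality is strongest
    at the boundary point \<open>cnj \<sigma>\<close>, and this is the point that the Siegel
    coordinates send to infinity.\<close>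
  define \<sigma> where "\<sigma> = (if \<beta>' = 0 then 1 else - cnj \<beta>' / of_real \<rho>)"
  have \<sigma>: "cmod \<sigma> = 1" "\<sigma> * \<beta>' = - of_real \<rho>"
    by (auto simp: \<sigma>_def \<rho>_def norm_divide) (simp add: mult.commute power2_eq_square flip: of_real_cmod_sq)
  have "cnj \<sigma> * cnj \<beta>' = - of_real \<rho>" using \<sigma>(2) by (metis complex_cnj_complex_of_real complex_cnj_minus complex_cnj_mult)
  then have "(1 - k\<^sup>2) * (cmod (of_real (1 + \<rho>)))\<^sup>2 \<le> 1 - \<rho>\<^sup>2" using julia'[of "cnj \<sigma>"] \<sigma>(1) by simp
  then have "(1 + \<rho>) * ((1 - k\<^sup>2) * (1 + \<rho>)) \<le> (1 + \<rho>) * (1 - \<rho>)"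
    unfolding norm_of_real power2_abs by (simp add: power2_eq_square algebra_simps)
  then have kr: "(1 - k\<^sup>2) * (1 + \<rho>) \<le> 1 - \<rho>" using \<rho> by simp
  \<comment> \<open>The Cayley image of \<open>- \<rho>\<close>: the value that the half-plane
    function must take at \<open>z 3\<close>.\<close>
  define T where "T = (1 - \<rho>) / (1 + \<rho>)"
  have T: "1 - k\<^sup>2 \<le> T" "T \<le> 1" using kr \<rho> by (auto simp: T_def field_simps)
  \<comment> \<open>For \<open>k = 0\<close> the division yields 0, which is consistent, because
    then \<open>1 - k\<^sup>2 \<le> T \<le> 1\<close> forces \<open>T = 1\<close>.\<close>
  define \<omega> where "\<omega> = (1 - T) / k\<^sup>2"
  have \<omega>: "0 \<le> \<omega>" "\<omega> \<le> 1" "1 - \<omega> * k\<^sup>2 = T"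
    using T by (auto simp: \<omega>_def divide_le_eq)
  define r where "r = sqrt (B - (cmod b1)\<^sup>2)"
  have "(norm b)\<^sup>2 = (cmod (cip b e))\<^sup>2 + (cmod (complex_of_real r))\<^sup>2"
    using Bb by (simp add: r_def b1_def[symmetric] B_def)
  then obtain n where n: "cip n n = 1" "cip n e = 0" "b = b1 *s e + of_real r *s n"
    using orthonormal_decomposition[OF d ee] unfolding b1_def by metis
  have en: "cip e n = 0" using n(2) cnj_cip[of n e] by simp
  define y1 where "y1 w = moeb b1 (cip w e)" for w
  define y2 where "y2 w = of_real (sqrt \<gamma>) * cip w n / (1 - cnj b1 * cip w e)" for w
  have ce: "cmod (cip w e) < 1" if "norm w < 1" for w using cip_bound[of w e] ne that by simp
  have dn: "1 - cnj b1 * cip w e \<noteq> 0" if "norm w < 1" for w using moeb_denom[OF b1', of "cip w e"] ce[OF that] by simp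
  have y12: "(cmod (y1 w))\<^sup>2 + (cmod (y2 w))\<^sup>2 < 1" if w: "norm w < 1" for w
  proof -
    define q where "q = (cmod (1 - cnj b1 * cip w e))\<^sup>2"
    have q: "q > 0" using dn[OF w] by (simp add: q_def)
    have 1: "1 - (cmod (y1 w))\<^sup>2 = \<gamma> * (1 - (cmod (cip w e))\<^sup>2) / q"
      unfolding y1_def q_def \<gamma>_def by (rule moeb_norm_sq) (use b1' ce[OF w] in auto)
    have 2: "(cmod (y2 w))\<^sup>2 = \<gamma> * (cmod (cip w n))\<^sup>2 / q"
      unfolding y2_def q_def using \<gamma> by (simp add: norm_mult norm_divide power_mult_distrib power_divide)
    have "(cmod (cip w e))\<^sup>2 + (cmod (cip w n))\<^sup>2 \<le> (norm w)\<^sup>2" by (rule cip_orthonormal_bound[OF ee n(1,2)])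
    also have "(norm w)\<^sup>2 < 1" using w by (simp add: abs_square_less_1)
    finally have "\<gamma> * (cmod (cip w n))\<^sup>2 / q < \<gamma> * (1 - (cmod (cip w e))\<^sup>2) / q"
      using \<gamma> q by (intro divide_strict_right_mono mult_strict_left_mono) auto
    then show ?thesis using 1 2 by linarith
  qed
  have y1n: "cmod (y1 w) < 1" if "norm w < 1" for w unfolding y1_def by (rule moeb_norm[OF b1' ce[OF that]])
  have sd: "1 - \<sigma> * y1 w \<noteq> 0" if "norm w < 1" for w
    using disc_mult_neq_1[of "y1 w" \<sigma>] y1n[OF that] \<sigma>(1) by (simp add: mult.commute)
  define W where "W w = (1 + \<sigma> * y1 w) / (1 - \<sigma> * y1 w)" for w
  define v where "v w = \<i> * y2 w / (1 - \<sigma> * y1 w)" for w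
  have siegel: "(cmod (v w))\<^sup>2 < Re (W w)" if w: "norm w < 1" for w
  proof -
    define q where "q = (cmod (1 - \<sigma> * y1 w))\<^sup>2"
    have q: "q > 0" using sd[OF w] by (simp add: q_def)
    define u where "u = \<sigma> * y1 w"
    have u: "cmod u = cmod (y1 w)" by (simp add: u_def norm_mult \<sigma>)
    have "Re ((1 + u) / (1 - u)) = (1 - (cmod u)\<^sup>2) / (cmod (1 - u))\<^sup>2"
      by (simp add: Re_divide cmod_power2) (simp add: power2_eq_square algebra_simps)
    then have "Re (W w) = (1 - (cmod (y1 w))\<^sup>2) / q" unfolding W_def q_def u_def[symmetric] u .
    moreover have "(cmod (v w))\<^sup>2 = (cmod (y2 w))\<^sup>2 / q" by (simp add: v_def q_def norm_mult norm_divide power_divide)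
    ultimately show ?thesis using y12[OF w] q by (simp add: divide_strict_right_mono)
  qed
  \<comment> \<open>At \<open>z 3\<close> one has \<open>W = 1\<close> and
    \<open>v = \<i> * k\<close>, so the middle term brings the value down to \<open>T\<close>. The
    last term vanishes there and on \<open>v = 0\<close>, hence leaves all three values
    unchanged.\<close>
  define X where "X \<epsilon> w = W w + of_real \<omega> * (v w)\<^sup>2 + of_real \<epsilon> * ((v w * (v w - \<i> * of_real k))\<^sup>2 / (1 + W w))" for \<epsilon> :: real and w
  have X: "Re (X \<epsilon> w) > 0" if "0 \<le> \<epsilon>" "\<epsilon> \<le> 1/8" "norm w < 1" for \<epsilon> w
    unfolding X_def by (rule siegel_bound[OF siegel]) (use that \<omega> k0 kk in auto)
  have W1: "1 + W w \<noteq> 0" if w: "norm w < 1" for w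
    using cayley_norm(2)[of "W w"] siegel[OF w] by (smt (verit) add.commute zero_le_power2)
  define F where "F \<epsilon> w = cnj \<sigma> * ((X \<epsilon> w - 1) / (X \<epsilon> w + 1))" for \<epsilon> w
  have \<sigma>\<sigma>: "cnj \<sigma> * \<sigma> = 1" using \<sigma>(1) by (simp add: mult.commute flip: of_real_cmod_sq)
  have val: "F \<epsilon> (z j) = moeb b1 (\<zeta> j)" for \<epsilon> j
  proof -
    have line: "F \<epsilon> w = y1 w" if w: "norm w < 1" "cip w n = 0" for w
    proof -
      have "X \<epsilon> w = W w" using w by (simp add: X_def v_def y2_def)
      moreover have "(W w - 1) / (W w + 1) = \<sigma> * y1 w"
      proof -
        define u where "u = \<sigma> * y1 w"
        have "1 - u \<noteq> 0" using sd[OF w(1)] by (simp add: u_def)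
        then have "W w - 1 = 2 * u / (1 - u)" "W w + 1 = 2 / (1 - u)"
          unfolding W_def u_def[symmetric] by (simp_all add: field_simps)
        then show ?thesis using \<open>1 - u \<noteq> 0\<close> by (simp add: u_def)
      qed
      ultimately show ?thesis unfolding F_def by (simp add: \<sigma>\<sigma> flip: mult.assoc)
    qed
    have "F \<epsilon> (z 1) = moeb b1 (\<zeta> 1)" using line[of "z 1"] z[of 1] by (simp add: z1 y1_def)
    moreover have "F \<epsilon> (z 2) = moeb b1 (\<zeta> 2)"
    proof -
      have "cip (z 2) n = 0" "cip (z 2) e = \<alpha>" unfolding z2 by (simp_all add: cip_simps en ee)
      then show ?thesis using line[of "z 2"] z[of 2] by (simp add: y1_def \<alpha>_def)
    qed
    moreover have "F \<epsilon> (z 3) = moeb b1 (\<zeta> 3)"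
    proof -
      have cb: "cip (z 3) e = b1" "cip (z 3) n = of_real r"
        unfolding b_def[symmetric] by (subst n(3), simp add: cip_simps ee en n(1,2))+
      have "y1 (z 3) = 0" by (simp add: y1_def cb)
      moreover have "y2 (z 3) = of_real k"
      proof -
        have "1 - cnj b1 * b1 = of_real \<gamma>" by (simp add: \<gamma>_def of_real_cmod_sq mult.commute)
        then have "y2 (z 3) = of_real (sqrt \<gamma> * r / \<gamma>)" unfolding y2_def cb by simp
        also have "sqrt \<gamma> * r / \<gamma> = r / sqrt \<gamma>" using \<gamma> by (simp add: field_simps)
        also have "\<dots> = k" by (simp add: r_def k_def real_sqrt_divide)
        finally show ?thesis .
      qed
      ultimately have "W (z 3) = 1" "v (z 3) = \<i> * of_real k" by (simp_all add: W_def v_def)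
      then have "X \<epsilon> (z 3) = of_real (1 - \<omega> * k\<^sup>2)" by (simp add: X_def power_mult_distrib)
      then have XT: "X \<epsilon> (z 3) = of_real T" by (simp only: \<omega>)
      have "(T - 1) / (T + 1) = - \<rho>" using \<rho> by (simp add: T_def field_simps)
      then have "(X \<epsilon> (z 3) - 1) / (X \<epsilon> (z 3) + 1) = - of_real \<rho>" unfolding XT
        by (metis of_real_1 of_real_add of_real_diff of_real_divide of_real_minus)
      then have "F \<epsilon> (z 3) = cnj \<sigma> * (\<sigma> * \<beta>')" by (simp add: F_def \<sigma>)
      then show ?thesis by (simp add: \<beta>'_def \<beta>_def \<sigma>\<sigma> flip: mult.assoc)
    qed
    ultimately show ?thesis using exhaust_3[of j] by auto
  qed
  have hol: "cn_holomorphic_on (F \<epsilon>) (ball 0 1)" if e: "0 \<le> \<epsilon>" "\<epsilon> \<le> 1/8" for \<epsilon>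
  proof -
    have h1: "cn_holomorphic_on y1 (ball 0 1)" unfolding y1_def moeb_def
      by (intro cn_holomorphic_intros cn_holomorphic_on_cip) (use dn in auto)
    have h2: "cn_holomorphic_on y2 (ball 0 1)" unfolding y2_def
      by (intro cn_holomorphic_intros cn_holomorphic_on_cip) (use dn in auto)
    have hW: "cn_holomorphic_on W (ball 0 1)" unfolding W_def
      by (intro cn_holomorphic_intros h1) (use sd in auto)
    have hv: "cn_holomorphic_on v (ball 0 1)" unfolding v_def
      by (intro cn_holomorphic_intros h1 h2) (use sd in auto)
    have hX: "cn_holomorphic_on (X \<epsilon>) (ball 0 1)" unfolding X_def
      by (intro cn_holomorphic_intros hv hW) (use W1 in auto)
    show ?thesis unfolding F_def
      by (intro cn_holomorphic_intros hX) (use X[OF e] cayley_norm(2) in auto)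
  qed
  have sol: "solves z (\<lambda>j. moeb b1 (\<zeta> j)) (F \<epsilon>)" if e: "0 \<le> \<epsilon>" "\<epsilon> \<le> 1/8" for \<epsilon>
  proof -
    have "cmod (F \<epsilon> w) < 1" if "norm w < 1" for w
      unfolding F_def norm_mult complex_mod_cnj \<sigma>(1) using cayley_norm(1)[OF X[OF e that]] by simp
    then show ?thesis unfolding solves_def using hol[OF e] val by blast
  qed
  \<comment> \<open>On the line spanned by \<open>n\<close> the function \<open>v\<close> is linear
    in the parameter with slope \<open>g\<close>, so at most one of 1/2 and 1/3 can hit
    \<open>\<i> * k\<close>.\<close>
  obtain w where w: "norm w < 1" "v w * (v w - \<i> * of_real k) \<noteq> 0"
  proof -
    define x where "x t = complex_of_real t *s n" for t
    have nn: "norm n = 1" using n(1) by (metis cip_self norm_ge_zero of_real_1 of_real_eq_iff power2_eq_1_iff abs_of_nonneg abs_1 abs_minus_cancel)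
    have xn: "norm (x t) = \<bar>t\<bar>" for t by (simp add: x_def norm_cscale nn)
    define g where "g = \<i> * (of_real (sqrt \<gamma>) / (1 + \<sigma> * b1))"
    have "1 + \<sigma> * b1 \<noteq> 0" using disc_mult_neq_1[of "b1" "- \<sigma>"] b1' \<sigma>(1) by (simp add: mult.commute)
    then have g: "g \<noteq> 0" using \<gamma> by (simp add: g_def)
    have vx: "v (x t) = of_real t * g" for t
      by (simp add: v_def y2_def y1_def x_def cip_simps n(1,2) moeb_def g_def)
    show thesis
    proof (cases "v (x (1/2)) = \<i> * of_real k")
      case True
      have "v (x (1/3)) \<noteq> v (x (1/2))" using g by (simp add: vx)
      then show ?thesis using that[of "x (1/3)"] True g by (simp add: xn vx)
    next
      case False
      then show ?thesis using that[of "x (1/2)"] g by (simp add: xn vx)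
    qed
  qed
  have "X (1/8) w - X 0 w = of_real (1/8) * ((v w * (v w - \<i> * of_real k))\<^sup>2 / (1 + W w))"
    unfolding X_def by (simp only: of_real_0 mult_zero_left add_0_right add_diff_cancel_left')
  moreover have "\<dots> \<noteq> 0" using w(2) W1[OF w(1)] by (simp only: mult_eq_0_iff divide_eq_0_iff power_eq_0_iff of_real_eq_0_iff) simp
  ultimately have "X 0 w \<noteq> X (1/8) w" by auto
  moreover have "X 0 w + 1 \<noteq> 0" "X (1/8) w + 1 \<noteq> 0" using X[of 0 w] X[of "1/8" w] w cayley_norm(2) by auto
  moreover have "\<sigma> \<noteq> 0" using \<sigma>(1) by auto
  ultimately have "F 0 w \<noteq> F (1/8) w" unfolding F_def by (simp add: frac_eq_eq) (simp add: algebra_simps)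
  then have "nonunique z (\<lambda>j. moeb b1 (\<zeta> j))"
    unfolding nonunique_def using sol[of 0] sol[of "1/8"] w(1) by force
  then show ?thesis by (rule nonunique_moeb[OF b1' \<zeta>])
qed

text \<open>\<open>0 \<le> pair_gap z \<zeta> i j\<close> says that the pseudohyperbolic distance of the targets does not exceed that of the points.\<close>

definition pair_gap :: "(3 \<Rightarrow> complex ^ 'n) \<Rightarrow> (3 \<Rightarrow> complex) \<Rightarrow> 3 \<Rightarrow> 3 \<Rightarrow> real" where
  "pair_gap z \<zeta> i j = (1 - (cmod (\<zeta> i))\<^sup>2) * (1 - (cmod (\<zeta> j))\<^sup>2) * (cmod (1 - cip (z i) (z j)))\<^sup>2
     - (1 - (norm (z i))\<^sup>2) * (1 - (norm (z j))\<^sup>2) * (cmod (1 - \<zeta> i * cnj (\<zeta> j)))\<^sup>2"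

text \<open>Moving the first point and the first target to 0 turns the vanishing gap into equality
  of moduli.\<close>

lemma nonunique_degenerate_12:
  fixes z :: "3 \<Rightarrow> complex ^ 'd"
  assumes d: "CARD('d) \<ge> 2" and z: "\<And>i. norm (z i) < 1" and \<zeta>: "\<And>i. cmod (\<zeta> i) < 1"
    and z12: "z 1 \<noteq> z 2" and tight: "pair_gap z \<zeta> 1 2 = 0"
    and dom: "pick_dominates (gram z) (cgram \<zeta>)"
  shows "nonunique z \<zeta>"
proof (rule nonunique_ballaut[of "z 1"], rule z, rule z, rule nonunique_moeb[of "\<zeta> 1"], rule \<zeta>, rule \<zeta>)
  let ?z = "\<lambda>j. ballaut (z 1) (z j)" and ?\<zeta> = "\<lambda>j. moeb (\<zeta> 1) (\<zeta> j)"
  obtain k where k: "\<And>i. k i \<noteq> 0" "gram ?z = gauge_mat k (gram z)"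
    using gram_ballaut[of "z 1" z] z by blast
  show "nonunique ?z ?\<zeta>"
  proof (rule nonunique_degenerate_0[OF d])
    show "norm (?z i) < 1" for i by (rule ballaut_norm[OF z z])
    show "cmod (?\<zeta> i) < 1" for i by (rule moeb_norm[OF \<zeta> \<zeta>])
    show "?z 1 = 0" by (rule ballaut_self[OF z])
    show "?z 2 \<noteq> 0"
    proof
      assume "?z 2 = 0"
      then have "z 2 = z 1" using ballaut_ballaut[OF z cip_neq_1[OF z z], of 1 2] by (simp add: ballaut_0)
      then show False using z12 by simp
    qed
    show "?\<zeta> 1 = 0" by simp
    show "pick_dominates (gram ?z) (cgram ?\<zeta>)"
      unfolding k(2) cgram_moeb[OF \<zeta> \<zeta>] by (rule iffD2[OF pick_dominates_gauge dom]) (use k(1) moeb_gauge_nz[OF \<zeta> \<zeta>] in auto)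
    define P where "P = (cmod (1 - cip (z 1) (z 2)))\<^sup>2"
    define Q where "Q = (cmod (1 - \<zeta> 1 * cnj (\<zeta> 2)))\<^sup>2"
    have P: "P > 0" "Q > 0" using cip_neq_1[OF z z, of 1 2] disc_mult_neq_1[of "\<zeta> 1" "cnj (\<zeta> 2)"] \<zeta>[of 1] \<zeta>[of 2]
      by (auto simp: P_def Q_def)
    have "cmod (1 - cip (z 2) (z 1)) = cmod (1 - cip (z 1) (z 2))"
      using complex_mod_cnj[of "1 - cip (z 1) (z 2)"] by (simp add: cnj_cip del: complex_mod_cnj)
    then have 1: "1 - (norm (?z 2))\<^sup>2 = (1 - (norm (z 1))\<^sup>2) * (1 - (norm (z 2))\<^sup>2) / P"
      by (simp add: ballaut_norm_sq[OF z z] P_def)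
    have "cmod (1 - cnj (\<zeta> 1) * \<zeta> 2) = cmod (1 - \<zeta> 1 * cnj (\<zeta> 2))"
      using complex_mod_cnj[of "1 - \<zeta> 1 * cnj (\<zeta> 2)"] by (simp del: complex_mod_cnj)
    then have 2: "1 - (cmod (?\<zeta> 2))\<^sup>2 = (1 - (cmod (\<zeta> 1))\<^sup>2) * (1 - (cmod (\<zeta> 2))\<^sup>2) / Q"
      by (simp add: moeb_norm_sq[OF \<zeta> less_imp_le[OF \<zeta>]] Q_def)
    have "(1 - (cmod (\<zeta> 1))\<^sup>2) * (1 - (cmod (\<zeta> 2))\<^sup>2) * P = (1 - (norm (z 1))\<^sup>2) * (1 - (norm (z 2))\<^sup>2) * Q"
      using tight unfolding pair_gap_def P_def Q_def by simp
    then have "1 - (cmod (?\<zeta> 2))\<^sup>2 = 1 - (norm (?z 2))\<^sup>2"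
      unfolding 1 2 using P by (subst frac_eq_eq) auto
    then have "(cmod (?\<zeta> 2))\<^sup>2 = (norm (?z 2))\<^sup>2" by simp
    then show "cmod (?\<zeta> 2) = norm (?z 2)" by (rule power2_eq_imp_eq) auto
  qed
qed

lemma nonunique_degenerate:
  fixes z :: "3 \<Rightarrow> complex ^ 'd"
  assumes d: "CARD('d) \<ge> 2" and z: "\<And>i. norm (z i) < 1" and \<zeta>: "\<And>i. cmod (\<zeta> i) < 1"
    and inj: "inj z" and ij: "i \<noteq> j" and tight: "pair_gap z \<zeta> i j = 0"
    and dom: "pick_dominates (gram z) (cgram \<zeta>)"
  shows "nonunique z \<zeta>"
proof -
  obtain \<pi> :: "3 \<Rightarrow> 3" where \<pi>: "bij \<pi>" "\<pi> 1 = i" "\<pi> 2 = j"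
  proof -
    have "card {i, j} \<noteq> CARD(3)" by (simp add: card_insert_if)
    then have "{i, j} \<noteq> UNIV" by auto
    then obtain k where k: "k \<noteq> i" "k \<noteq> j" by auto
    define \<pi> where "\<pi> x = (if x = 1 then i else if x = 2 then j else k)" for x :: 3
    have "inj \<pi>" unfolding inj_def forall_3 \<pi>_def using k ij by auto
    then have "bij \<pi>" by (simp add: bij_def finite_UNIV_inj_surj)
    moreover have "\<pi> 1 = i" "\<pi> 2 = j" by (auto simp: \<pi>_def)
    ultimately show ?thesis using that by blast
  qed
  show ?thesis
  proof (rule nonunique_permute[OF \<pi>(1)], rule nonunique_degenerate_12[OF d])
    show "z (\<pi> 1) \<noteq> z (\<pi> 2)" using \<pi> ij inj by (auto dest: injD)
    show "pair_gap (\<lambda>j. z (\<pi> j)) (\<lambda>j. \<zeta> (\<pi> j)) 1 2 = 0" using tight by (simp add: pair_gap_def \<pi>)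
    show "pick_dominates (gram (\<lambda>j. z (\<pi> j))) (cgram (\<lambda>j. \<zeta> (\<pi> j)))"
      using pick_dominates_permute[OF \<pi>(1) dom] by (simp add: gram_def[abs_def] cgram_def[abs_def])
  qed (use z \<zeta> in auto)
qed

section \<open>Criticality of the nodes\<close>

lemma tendsto_qform:
  assumes "\<And>i j. ((\<lambda>t. M t i j) \<longlongrightarrow> N i j) F" "\<And>i. ((\<lambda>t. v t i) \<longlongrightarrow> w i) F"
  shows "((\<lambda>t. qform (M t) (v t)) \<longlongrightarrow> qform N w) F"
  unfolding qform_def using assms by (intro tendsto_intros)

lemma qform_add: "qform (\<lambda>i j. M i j + of_real t * D i j) v = qform M v + t * qform D v"
  unfolding qform_def sum_3 by (simp add: algebra_simps)

lemma qform_scale: "qform M (\<lambda>i. c * v i) = (cmod c)\<^sup>2 * qform M v"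
proof -
  have "(\<Sum>i\<in>UNIV. \<Sum>j\<in>UNIV. c * v i * cnj (c * v j) * M i j) = of_real ((cmod c)\<^sup>2) * (\<Sum>i\<in>UNIV. \<Sum>j\<in>UNIV. v i * cnj (v j) * M i j)"
    by (simp add: sum_3 of_real_cmod_sq algebra_simps)
  then show ?thesis unfolding qform_def by (simp del: of_real_power)
qed

text \<open>By compactness of the unit sphere: failures of \<open>pd\<close> at parameters tending
  to 0 have normalised witnesses with a limit \<open>w\<close>, null for \<open>M\<close>. As
  \<open>M\<close> contributes nonnegatively, the difference quotients are nonpositive on the
  witnesses, and so is \<open>D\<close> on \<open>w\<close>.\<close>

lemma pd_perturbation:
  assumes M: "psd M"
    and D: "\<And>i j. ((\<lambda>t. (N t i j - M i j) / of_real t) \<longlongrightarrow> D i j) (at_right 0)"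
    and ker: "\<And>w. \<exists>i. w i \<noteq> 0 \<Longrightarrow> qform M w = 0 \<Longrightarrow> 0 < qform D w"
  shows "eventually (\<lambda>t. pd (N t)) (at_right (0::real))"
proof (rule ccontr)
  assume "\<not> ?thesis"
  then have "\<exists>t>0. t < inverse (real (Suc n)) \<and> \<not> pd (N t)" for n
    unfolding eventually_at_right_field by (metis inverse_positive_iff_positive of_nat_0_less_iff zero_less_Suc)
  then obtain t where t: "\<And>n. 0 < t n" "\<And>n. t n < inverse (real (Suc n))" "\<And>n. \<not> pd (N (t n))" by metis
  have "\<exists>v :: complex ^ 3. v \<in> sphere 0 1 \<and> qform (N (t n)) (\<lambda>i. v $ i) \<le> 0" for n
  proof -
    obtain u i where u: "u i \<noteq> 0" "qform (N (t n)) u \<le> 0"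
      using t(3)[of n] unfolding pd_def by (metis linorder_not_less)
    define y :: "complex ^ 3" where "y = (\<chi> i. u i)"
    have y: "norm y \<noteq> 0" using u by (metis norm_eq_zero y_def vec_lambda_beta zero_index)
    define v where "v = (1 / of_real (norm y)) *s y"
    have "norm v = 1" using y by (simp add: v_def norm_cscale norm_divide)
    moreover have eq: "(\<lambda>i. v $ i) = (\<lambda>i. (1 / of_real (norm y)) * u i)" by (simp add: v_def y_def fun_eq_iff)
    have "qform (N (t n)) (\<lambda>i. v $ i) \<le> 0" unfolding eq qform_scale using u by (simp add: mult_nonneg_nonpos)
    ultimately show ?thesis by auto
  qed
  then obtain v :: "nat \<Rightarrow> complex ^ 3" where v: "\<And>n. v n \<in> sphere 0 1" "\<And>n. qform (N (t n)) (\<lambda>i. v n $ i) \<le> 0" by metis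
  obtain w r where w: "w \<in> sphere (0 :: complex ^ 3) 1" "strict_mono r" "(v \<circ> r) \<longlonglongrightarrow> w"
    using compact_sphere[of "0 :: complex ^ 3" 1] v(1) unfolding compact_def by blast
  define T where "T n = t (r n)" for n
  define E where "E n i j = (N (T n) i j - M i j) / of_real (T n)" for n i j
  have T0: "T n > 0" for n using t by (simp add: T_def)
  have "t \<longlonglongrightarrow> 0"
    by (rule tendsto_sandwich[OF _ _ tendsto_const LIMSEQ_inverse_real_of_nat]) (intro always_eventually allI less_imp_le t)+
  then have Tl: "T \<longlonglongrightarrow> 0" unfolding T_def using LIMSEQ_subseq_LIMSEQ[OF _ w(2), of t 0] by (simp add: comp_def)
  then have "filterlim T (at_right 0) sequentially"
    by (intro tendsto_imp_filterlim_at_right always_eventually allI T0)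
  then have El: "(\<lambda>n. E n i j) \<longlonglongrightarrow> D i j" for i j
    unfolding E_def using filterlim_compose[OF D] by blast
  have vl: "(\<lambda>n. v (r n) $ i) \<longlonglongrightarrow> w $ i" for i
    using tendsto_vec_nth[OF w(3)] by (simp add: comp_def)
  have NE: "N (T n) = (\<lambda>i j. M i j + of_real (T n) * E n i j)" for n
    using T0[of n] by (simp add: E_def fun_eq_iff)
  have le: "qform M (\<lambda>i. v (r n) $ i) + T n * qform (E n) (\<lambda>i. v (r n) $ i) \<le> 0" for n
    using v(2)[of "r n"] unfolding T_def[symmetric] NE qform_add .
  have M0: "0 \<le> qform M u" for u using M by (simp add: psd_def)
  have l1: "(\<lambda>n. qform (E n) (\<lambda>i. v (r n) $ i)) \<longlonglongrightarrow> qform D (\<lambda>i. w $ i)" by (rule tendsto_qform[OF El vl])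
  have l2: "(\<lambda>n. qform M (\<lambda>i. v (r n) $ i)) \<longlonglongrightarrow> qform M (\<lambda>i. w $ i)" by (rule tendsto_qform[OF tendsto_const vl])
  have "(\<lambda>n. qform M (\<lambda>i. v (r n) $ i) + T n * qform (E n) (\<lambda>i. v (r n) $ i)) \<longlonglongrightarrow> qform M (\<lambda>i. w $ i) + 0 * qform D (\<lambda>i. w $ i)"
    by (intro tendsto_intros l1 l2 Tl)
  then have "qform M (\<lambda>i. w $ i) + 0 * qform D (\<lambda>i. w $ i) \<le> 0"
    by (rule LIMSEQ_le_const2) (use le in blast)
  then have "qform M (\<lambda>i. w $ i) = 0" using M0[of "\<lambda>i. w $ i"] by simp
  moreover have "\<exists>i. w $ i \<noteq> 0"
  proof (rule ccontr)
    assume "\<not> ?thesis"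
    then have "w = 0" by (simp add: vec_eq_iff)
    then show False using w(1) by simp
  qed
  ultimately have pos: "0 < qform D (\<lambda>i. w $ i)" by (intro ker)
  have le2: "T n * qform (E n) (\<lambda>i. v (r n) $ i) \<le> 0" for n using le[of n] M0[of "\<lambda>i. v (r n) $ i"] by linarith
  have "qform (E n) (\<lambda>i. v (r n) $ i) \<le> 0" for n using le2[of n] T0[of n] by (simp add: mult_le_0_iff)
  then have "qform D (\<lambda>i. w $ i) \<le> 0" using LIMSEQ_le_const2[OF l1] by blast
  then show False using pos by simp
qed

text \<open>The derivative of \<open>pick G\<close> at the nodes \<open>l\<close> in the direction \<open>d\<close>.\<close>

definition dpick :: "(3 \<Rightarrow> 3 \<Rightarrow> complex) \<Rightarrow> (3 \<Rightarrow> complex) \<Rightarrow> (3 \<Rightarrow> complex) \<Rightarrow> 3 \<Rightarrow> 3 \<Rightarrow> complex" where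
  "dpick G l d i j = pick G l i j * (d i * cnj (l j) + l i * cnj (d j)) / (1 - l i * cnj (l j))"

lemma tendsto_dpick:
  assumes l: "\<And>i. cmod (l i) < 1"
  shows "((\<lambda>t. (pick G (\<lambda>k. l k + of_real t * d k) i j - pick G l i j) / of_real t) \<longlongrightarrow> dpick G l d i j) (at_right 0)"
proof -
  define X where "X t = (l i + of_real t * d i) * cnj (l j + of_real t * d j)" for t :: real
  have n: "1 - l i * cnj (l j) \<noteq> 0" using disc_mult_neq_1[of "l i" "cnj (l j)"] l[of i] l[of j] by simp
  have Xl: "(X \<longlongrightarrow> l i * cnj (l j)) (at_right 0)"
    unfolding X_def by (auto intro!: tendsto_eq_intros)
  then have ev: "eventually (\<lambda>t. X t \<noteq> 1) (at_right 0)"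
    by (rule tendsto_imp_eventually_ne) (use n in auto)
  have "((\<lambda>t. pick G l i j * (d i * cnj (l j) + l i * cnj (d j) + of_real t * (d i * cnj (d j))) / (1 - X t)) \<longlongrightarrow>
     pick G l i j * (d i * cnj (l j) + l i * cnj (d j) + of_real 0 * (d i * cnj (d j))) / (1 - l i * cnj (l j))) (at_right 0)"
    by (intro tendsto_intros Xl n)
  then have "((\<lambda>t. pick G l i j * (d i * cnj (l j) + l i * cnj (d j) + of_real t * (d i * cnj (d j))) / (1 - X t)) \<longlongrightarrow> dpick G l d i j) (at_right 0)"
    by (simp add: dpick_def)
  moreover have "eventually (\<lambda>t. pick G l i j * (d i * cnj (l j) + l i * cnj (d j) + of_real t * (d i * cnj (d j))) / (1 - X t)
      = (pick G (\<lambda>k. l k + of_real t * d k) i j - pick G l i j) / of_real t) (at_right 0)"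
    using ev eventually_at_right_less[of 0]
  proof eventually_elim
    case (elim t)
    define N where "N = 1 - l i * cnj (l j)"
    define S where "S = d i * cnj (l j) + l i * cnj (d j) + of_real t * (d i * cnj (d j))"
    have XN: "1 - X t = N - of_real t * S" by (simp add: X_def N_def S_def algebra_simps)
    have nz: "1 - X t \<noteq> 0" "N \<noteq> 0" "t \<noteq> 0" using elim n by (auto simp: N_def)
    have "G i j / (1 - X t) - G i j / N = (G i j * N - G i j * (1 - X t)) / ((1 - X t) * N)"
      by (rule diff_frac_eq[OF nz(1,2)])
    also have "G i j * N - G i j * (1 - X t) = of_real t * (G i j * S)" unfolding XN by (simp add: algebra_simps)
    finally have "(G i j / (1 - X t) - G i j / N) / of_real t = G i j / N * S / (1 - X t)"
      using nz by (simp add: mult.commute)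
    then show ?case by (simp add: pick_def X_def N_def S_def)
  qed
  ultimately show ?thesis by (rule Lim_transform_eventually)
qed

text \<open>First-order form of domination: a direction that is positive on the null vectors for the
  points makes their Pick matrix definite for small parameters, so the target matrix stays
  semidefinite along it, and at its null vector \<open>v\<close> the form can only grow.\<close>

lemma pick_dominates_derivative:
  assumes dom: "pick_dominates G G'" and l: "\<And>i. cmod (l i) < 1" and P: "psd (pick G l)"
    and ker: "\<And>w. \<exists>i. w i \<noteq> 0 \<Longrightarrow> qform (pick G l) w = 0 \<Longrightarrow> 0 < qform (dpick G l d) w"
    and v: "qform (pick G' l) v = 0"
  shows "0 \<le> qform (dpick G' l d) v"
proof -
  define L where "L t k = l k + of_real t * d k" for t :: real and k
  have "eventually (\<lambda>t. pd (pick G (L t))) (at_right 0)"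
    unfolding L_def by (rule pd_perturbation[OF P tendsto_dpick[OF l] ker])
  moreover have "eventually (\<lambda>t. \<forall>k\<in>UNIV. cmod (L t k) < 1) (at_right 0)"
  proof (rule eventually_ball_finite, simp, rule ballI)
    fix k
    have "((\<lambda>t. cmod (L t k)) \<longlongrightarrow> cmod (l k + of_real 0 * d k)) (at_right 0)"
      unfolding L_def by (intro tendsto_intros)
    then have "((\<lambda>t. cmod (L t k)) \<longlongrightarrow> cmod (l k)) (at_right 0)" by simp
    then show "eventually (\<lambda>t. cmod (L t k) < 1) (at_right 0)" by (rule order_tendstoD(2)[OF _ l])
  qed
  ultimately have "eventually (\<lambda>t. 0 \<le> qform (\<lambda>i j. (pick G' (L t) i j - pick G' l i j) / of_real t) v) (at_right 0)"
    using eventually_at_right_less[of 0]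
  proof eventually_elim
    case (elim t)
    have "psd (pick G' (L t))" using dom elim unfolding pick_dominates_def by auto
    then have "0 \<le> qform (pick G' (L t)) v" by (simp add: psd_def)
    moreover have "pick G' (L t) = (\<lambda>i j. pick G' l i j + of_real t * ((pick G' (L t) i j - pick G' l i j) / of_real t))"
      using elim by (simp add: fun_eq_iff)
    then have "qform (pick G' (L t)) v = qform (\<lambda>i j. pick G' l i j + of_real t * ((pick G' (L t) i j - pick G' l i j) / of_real t)) v"
      by (rule arg_cong)
    then have "qform (pick G' (L t)) v = qform (pick G' l) v + t * qform (\<lambda>i j. (pick G' (L t) i j - pick G' l i j) / of_real t) v"
      unfolding qform_add .
    ultimately show ?case using v elim by (simp add: zero_le_mult_iff)
  qed
  moreover have "((\<lambda>t. qform (\<lambda>i j. (pick G' (L t) i j - pick G' l i j) / of_real t) v) \<longlongrightarrow> qform (dpick G' l d) v) (at_right 0)"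
    unfolding L_def by (intro tendsto_qform tendsto_dpick l tendsto_const)
  ultimately show ?thesis by (intro tendsto_lowerbound[where F = "at_right (0::real)"]) auto
qed

lemma qform_two:
  assumes "i \<noteq> j"
  shows "qform M (\<lambda>k. if k = i then a else if k = j then b else 0) =
    Re (a * cnj a * M i i + a * cnj b * M i j + b * cnj a * M j i + b * cnj b * M j j)"
  using exhaust_3[of i] exhaust_3[of j] assms by (auto simp: qform_def sum_3)

text \<open>At coinciding nodes the vector with entries 1 and -1 gives a negative multiple of the
  squared distance of the two points.\<close>

lemma psd_pick_inj:
  assumes P: "psd (pick (gram z) l)" and l: "\<And>i. cmod (l i) < 1" and z: "inj z"
  shows "inj l"
proof (rule injI, rule ccontr)
  fix i j assume e: "l i = l j" and ij: "i \<noteq> j"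
  define n where "n = 1 - (cmod (l j))\<^sup>2"
  have n: "n > 0" using l[of j] by (simp add: n_def abs_square_less_1)
  have ll: "1 - l j * cnj (l j) = of_real n" by (simp add: n_def of_real_cmod_sq)
  have "qform (pick (gram z) l) (\<lambda>k. if k = i then 1 else if k = j then - 1 else 0)
     = Re (gram z i i - gram z i j - gram z j i + gram z j j) / n"
    unfolding qform_two[OF ij] pick_def e ll by (simp add: diff_divide_distrib add_divide_distrib)
  also have "Re (gram z i i - gram z i j - gram z j i + gram z j j) = - (norm (z i - z j))\<^sup>2"
    unfolding norm_diff_sq_cip using arg_cong[OF cnj_cip[of "z i" "z j"], of Re] by (simp add: gram_def cip_self)
  finally have "0 \<le> - (norm (z i - z j))\<^sup>2 / n" using P unfolding psd_def by metis
  then have "z i = z j" using n by (simp add: divide_le_0_iff)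
  then show False using z ij by (auto dest: injD)
qed

text \<open>A rank-one square minus a nonnegative form: \<open>gram z\<close> is nonpositive on the
  plane \<open>x 1 + x 2 + x 3 = 0\<close> and so has at most one positive eigenvalue.\<close>

lemma qform_gram: "qform (gram z) x = (cmod (x 1 + x 2 + x 3))\<^sup>2 - (norm (x 1 *s z 1 + x 2 *s z 2 + x 3 *s z 3))\<^sup>2"
proof -
  have "(\<Sum>i\<in>UNIV. \<Sum>j\<in>UNIV. x i * cnj (x j) * gram z i j)
    = (x 1 + x 2 + x 3) * cnj (x 1 + x 2 + x 3) - cip (x 1 *s z 1 + x 2 *s z 2 + x 3 *s z 3) (x 1 *s z 1 + x 2 *s z 2 + x 3 *s z 3)"
    by (simp add: sum_3 gram_def cip_simps algebra_simps)
  also have "\<dots> = of_real ((cmod (x 1 + x 2 + x 3))\<^sup>2 - (norm (x 1 *s z 1 + x 2 *s z 2 + x 3 *s z 3))\<^sup>2)"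
    by (simp only: of_real_diff of_real_power of_real_cmod_sq cip_self)
  finally show ?thesis unfolding qform_def by simp
qed

text \<open>When \<open>u\<close> varies in coordinate \<open>i\<close> alone, the linear term is
  \<open>2 * Re (a * S)\<close>; for nonzero \<open>S\<close> a small negative multiple of
  \<open>cnj S\<close> would make the form negative.\<close>

lemma psd_kernel:
  assumes M: "psd M" and herm: "\<And>i j. M j i = cnj (M i j)" and u: "qform M u = 0"
  shows "(\<Sum>j\<in>UNIV. cnj (u j) * M i j) = 0"
proof (rule ccontr)
  define S where "S = (\<Sum>j\<in>UNIV. cnj (u j) * M i j)"
  assume "(\<Sum>j\<in>UNIV. cnj (u j) * M i j) \<noteq> 0"
  then have S: "(cmod S)\<^sup>2 > 0" by (simp add: S_def)
  define m where "m = Re (M i i)"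
  have h1: "M 2 1 = cnj (M 1 2)" "M 3 1 = cnj (M 1 3)" "M 3 2 = cnj (M 2 3)" by (rule herm)+
  have h2: "Im (M k k) = 0" for k using arg_cong[OF herm[of k k], of Im] by simp
  have e: "qform M (\<lambda>k. u k + (if k = i then a else 0)) = qform M u + 2 * Re (a * S) + (cmod a)\<^sup>2 * m" for a
    using exhaust_3[of i] unfolding qform_def S_def m_def sum_3 cmod_power2
    by (elim disjE; simp add: h1 h2; simp add: power2_eq_square algebra_simps)
  define s where "s = 1 / (\<bar>m\<bar> + 1)"
  have s: "s > 0" by (simp add: s_def)
  have "m < \<bar>m\<bar> + 1" by linarith
  then have "s * m < 1" by (simp add: s_def pos_divide_less_eq)
  have "0 \<le> qform M (\<lambda>k. u k + (if k = i then - of_real s * cnj S else 0))" using M by (simp add: psd_def)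
  also have "\<dots> = 2 * Re (- of_real s * cnj S * S) + (cmod (- of_real s * cnj S))\<^sup>2 * m" unfolding e u by simp
  also have "Re (- of_real s * cnj S * S) = - s * (cmod S)\<^sup>2" by (simp add: cmod_power2) (simp add: power2_eq_square algebra_simps)
  also have "(cmod (- of_real s * cnj S))\<^sup>2 = s\<^sup>2 * (cmod S)\<^sup>2" by (simp add: norm_mult power_mult_distrib)
  also have "2 * (- s * (cmod S)\<^sup>2) + s\<^sup>2 * (cmod S)\<^sup>2 * m = s * (cmod S)\<^sup>2 * (s * m - 2)"
    by (simp add: power2_eq_square algebra_simps)
  finally have "s * m - 2 \<ge> 0" using mult_pos_neg[OF mult_pos_pos[OF s S], of "s * m - 2"] by linarith
  then show False using \<open>s * m < 1\<close> by simp
qed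

text \<open>The cross product of the two coefficient vectors; the remaining cases treat proportional
  vectors.\<close>

lemma two_equations:
  fixes p q :: "3 \<Rightarrow> complex"
  obtains x :: "3 \<Rightarrow> complex" where "\<exists>i. x i \<noteq> 0" "p 1 * x 1 + p 2 * x 2 + p 3 * x 3 = 0" "q 1 * x 1 + q 2 * x 2 + q 3 * x 3 = 0"
proof -
  define mk :: "complex \<Rightarrow> complex \<Rightarrow> complex \<Rightarrow> 3 \<Rightarrow> complex" where "mk a b c i = (if i = 1 then a else if i = 2 then b else c)" for a b c i
  have mk: "mk a b c 1 = a" "mk a b c 2 = b" "mk a b c 3 = c" for a b c by (auto simp: mk_def)
  define c1 where "c1 = p 2 * q 3 - p 3 * q 2"
  define c2 where "c2 = p 3 * q 1 - p 1 * q 3"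
  define c3 where "c3 = p 1 * q 2 - p 2 * q 1"
  consider "c1 \<noteq> 0 \<or> c2 \<noteq> 0 \<or> c3 \<noteq> 0" | "c1 = 0" "c2 = 0" "c3 = 0" "p 1 \<noteq> 0 \<or> p 2 \<noteq> 0"
    | "c1 = 0" "c2 = 0" "c3 = 0" "p 1 = 0" "p 2 = 0" "q 1 \<noteq> 0 \<or> q 2 \<noteq> 0"
    | "p 1 = 0" "p 2 = 0" "q 1 = 0" "q 2 = 0" by blast
  then show thesis
  proof cases
    case 1
    have "\<exists>i. mk c1 c2 c3 i \<noteq> 0" using 1 mk by metis
    then show ?thesis by (rule that) (simp_all add: mk c1_def c2_def c3_def algebra_simps)
  next
    case 2
    have "\<exists>i. mk (p 2) (- p 1) 0 i \<noteq> 0" using 2(4) mk by (metis neg_equal_0_iff_equal)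
    then show ?thesis by (rule that) (use 2 in \<open>simp_all add: mk c3_def algebra_simps\<close>)
  next
    case 3
    then have "p 3 = 0" by (auto simp: c1_def c2_def)
    have "\<exists>i. mk (q 2) (- q 1) 0 i \<noteq> 0" using 3(6) mk by (metis neg_equal_0_iff_equal)
    then show ?thesis by (rule that) (use 3 \<open>p 3 = 0\<close> in \<open>simp_all add: mk algebra_simps\<close>)
  next
    case 4
    have "\<exists>i. mk 1 0 0 i \<noteq> 0" using mk(1)[of 1 0 0] by (metis one_neq_zero)
    then show ?thesis by (rule that) (use 4 in \<open>simp_all add: mk\<close>)
  qed
qed

text \<open>The weights of the divided difference of second order at the nodes \<open>l\<close>.\<close>

definition ddiff :: "(3 \<Rightarrow> complex) \<Rightarrow> 3 \<Rightarrow> complex" where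
  "ddiff l i = (if i = 1 then 1 / ((l 1 - l 2) * (l 1 - l 3)) else if i = 2 then 1 / ((l 2 - l 1) * (l 2 - l 3))
     else 1 / ((l 3 - l 1) * (l 3 - l 2)))"

lemma ddiff_simps: "ddiff l 1 = 1 / ((l 1 - l 2) * (l 1 - l 3))" "ddiff l 2 = 1 / ((l 2 - l 1) * (l 2 - l 3))"
  "ddiff l 3 = 1 / ((l 3 - l 1) * (l 3 - l 2))"
  by (auto simp: ddiff_def)

lemma cnj_ddiff: "cnj (ddiff l i) = ddiff (\<lambda>j. cnj (l j)) i"
  by (simp add: ddiff_def)

context
  fixes l :: "3 \<Rightarrow> complex" assumes inj: "inj l"
begin

lemma nodes_neq: "l 1 - l 2 \<noteq> 0" "l 1 - l 3 \<noteq> 0" "l 2 - l 3 \<noteq> 0" "l 2 - l 1 \<noteq> 0" "l 3 - l 1 \<noteq> 0" "l 3 - l 2 \<noteq> 0"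
  using inj by (auto simp: inj_eq)

lemma ddiff_nz: "ddiff l i \<noteq> 0"
  using nodes_neq by (simp add: ddiff_def)

lemma ddiff_sum:
  "ddiff l 1 * r1 + ddiff l 2 * r2 + ddiff l 3 * r3 =
    ((l 2 - l 3) * r1 - (l 1 - l 3) * r2 + (l 1 - l 2) * r3) / ((l 1 - l 2) * (l 1 - l 3) * (l 2 - l 3))"
proof -
  define a where "a = l 1 - l 2"
  define b where "b = l 1 - l 3"
  define c where "c = l 2 - l 3"
  have m: "l 2 - l 1 = - a" "l 3 - l 1 = - b" "l 3 - l 2 = - c" by (simp_all add: a_def b_def c_def)
  have "a \<noteq> 0" "b \<noteq> 0" "c \<noteq> 0" using nodes_neq by (auto simp: a_def b_def c_def)
  then have "1 / (a * b) * r1 + 1 / (- a * c) * r2 + 1 / (- b * - c) * r3 = (c * r1 - b * r2 + a * r3) / (a * b * c)"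
    by (simp add: add_divide_distrib diff_divide_distrib)
  then show ?thesis
    unfolding ddiff_simps m a_def[symmetric] b_def[symmetric] c_def[symmetric] .
qed

lemma ddiff_1: "ddiff l 1 + ddiff l 2 + ddiff l 3 = 0"
  and ddiff_id: "ddiff l 1 * l 1 + ddiff l 2 * l 2 + ddiff l 3 * l 3 = 0"
  using ddiff_sum[of 1 1 1] ddiff_sum[of "l 1" "l 2" "l 3"] by (simp_all add: algebra_simps)

text \<open>Second divided differences of \<open>t / (1 - c * t)\<close> and of
  \<open>t\<^sup>2 / (1 - c * t)\<close>. They arise because differentiating a Pick matrix brings in
  the kernel factor once more.\<close>

lemma ddiff_geometric:
  assumes c: "\<And>i. 1 - c * l i \<noteq> 0"
  defines "D \<equiv> (1 - c * l 1) * (1 - c * l 2) * (1 - c * l 3)"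
  shows "ddiff l 1 * (l 1 / (1 - c * l 1)) + ddiff l 2 * (l 2 / (1 - c * l 2)) + ddiff l 3 * (l 3 / (1 - c * l 3)) = c / D"
    and "ddiff l 1 * ((l 1)\<^sup>2 / (1 - c * l 1)) + ddiff l 2 * ((l 2)\<^sup>2 / (1 - c * l 2)) + ddiff l 3 * ((l 3)\<^sup>2 / (1 - c * l 3)) = 1 / D"
proof -
  define V where "V = (l 1 - l 2) * (l 1 - l 3) * (l 2 - l 3)"
  define e where "e i = 1 - c * l i" for i
  have e: "e 1 \<noteq> 0" "e 2 \<noteq> 0" "e 3 \<noteq> 0" using c by (auto simp: e_def)
  have V: "V \<noteq> 0" using nodes_neq by (simp add: V_def)
  have s: "ddiff l 1 * (r1 / e 1) + ddiff l 2 * (r2 / e 2) + ddiff l 3 * (r3 / e 3)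
     = ((l 2 - l 3) * r1 * (e 2 * e 3) - (l 1 - l 3) * r2 * (e 1 * e 3) + (l 1 - l 2) * r3 * (e 1 * e 2)) / V / (e 1 * e 2 * e 3)" for r1 r2 r3
  proof -
    have "(l 2 - l 3) * (r1 / e 1) - (l 1 - l 3) * (r2 / e 2) + (l 1 - l 2) * (r3 / e 3) =
      ((l 2 - l 3) * r1 * (e 2 * e 3) - (l 1 - l 3) * r2 * (e 1 * e 3) + (l 1 - l 2) * r3 * (e 1 * e 2)) / (e 1 * e 2 * e 3)"
      using e by (simp add: add_divide_distrib diff_divide_distrib)
    then show ?thesis unfolding ddiff_sum V_def by simp
  qed
  have 1: "(l 2 - l 3) * l 1 * (e 2 * e 3) - (l 1 - l 3) * l 2 * (e 1 * e 3) + (l 1 - l 2) * l 3 * (e 1 * e 2) = c * V"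
    "(l 2 - l 3) * (l 1)\<^sup>2 * (e 2 * e 3) - (l 1 - l 3) * (l 2)\<^sup>2 * (e 1 * e 3) + (l 1 - l 2) * (l 3)\<^sup>2 * (e 1 * e 2) = V"
    unfolding e_def V_def by (simp_all add: algebra_simps power2_eq_square)
  show "ddiff l 1 * (l 1 / (1 - c * l 1)) + ddiff l 2 * (l 2 / (1 - c * l 2)) + ddiff l 3 * (l 3 / (1 - c * l 3)) = c / D"
    using s[of "l 1" "l 2" "l 3"] V unfolding 1 by (simp add: e_def D_def)
  show "ddiff l 1 * ((l 1)\<^sup>2 / (1 - c * l 1)) + ddiff l 2 * ((l 2)\<^sup>2 / (1 - c * l 2)) + ddiff l 3 * ((l 3)\<^sup>2 / (1 - c * l 3)) = 1 / D"
    using s[of "(l 1)\<^sup>2" "(l 2)\<^sup>2" "(l 3)\<^sup>2"] V unfolding 1 by (simp add: e_def D_def)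
qed

lemma vandermonde:
  obtains \<sigma> :: "3 \<Rightarrow> complex" where "\<sigma> 1 + \<sigma> 2 + \<sigma> 3 = a" "\<sigma> 1 * l 1 + \<sigma> 2 * l 2 + \<sigma> 3 * l 3 = b"
    "\<sigma> 1 * (l 1)\<^sup>2 + \<sigma> 2 * (l 2)\<^sup>2 + \<sigma> 3 * (l 3)\<^sup>2 = c"
proof -
  define V where "V = (l 1 - l 2) * (l 1 - l 3) * (l 2 - l 3)"
  define n1 where "n1 = (c - (l 2 + l 3) * b + l 2 * l 3 * a) * (l 2 - l 3)"
  define n2 where "n2 = - (c - (l 1 + l 3) * b + l 1 * l 3 * a) * (l 1 - l 3)"
  define n3 where "n3 = (c - (l 1 + l 2) * b + l 1 * l 2 * a) * (l 1 - l 2)"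
  define \<sigma> :: "3 \<Rightarrow> complex" where "\<sigma> i = (if i = 1 then n1 else if i = 2 then n2 else n3) / V" for i
  have \<sigma>: "\<sigma> 1 = n1 / V" "\<sigma> 2 = n2 / V" "\<sigma> 3 = n3 / V" by (auto simp: \<sigma>_def)
  have V: "V \<noteq> 0" using nodes_neq by (simp add: V_def)
  have n: "n1 + n2 + n3 = a * V" "n1 * l 1 + n2 * l 2 + n3 * l 3 = b * V"
    "n1 * (l 1)\<^sup>2 + n2 * (l 2)\<^sup>2 + n3 * (l 3)\<^sup>2 = c * V"
    unfolding n1_def n2_def n3_def V_def by (simp_all add: algebra_simps power2_eq_square)
  show thesis
    by (rule that[of \<sigma>]) (use n V in \<open>simp_all add: \<sigma> flip: add_divide_distrib\<close>)
qed

lemma vandermonde_zero: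
  fixes x :: "3 \<Rightarrow> complex"
  assumes "x 1 + x 2 + x 3 = 0" "x 1 * l 1 + x 2 * l 2 + x 3 * l 3 = 0" "x 1 * (l 1)\<^sup>2 + x 2 * (l 2)\<^sup>2 + x 3 * (l 3)\<^sup>2 = 0"
  shows "x i = 0"
proof -
  have "x 1 * ((l 1 - l 2) * (l 1 - l 3)) = 0" "x 2 * ((l 2 - l 1) * (l 2 - l 3)) = 0" "x 3 * ((l 3 - l 1) * (l 3 - l 2)) = 0"
    using assms by algebra+
  then have "x 1 = 0" "x 2 = 0" "x 3 = 0" using nodes_neq by auto
  then show ?thesis using exhaust_3[of i] by auto
qed

lemma ddiff_zero_affine:
  assumes "ddiff l 1 * r 1 + ddiff l 2 * r 2 + ddiff l 3 * r 3 = 0"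
  obtains p q where "\<And>j. r j = p + q * l j"
proof -
  define q where "q = (r 1 - r 2) / (l 1 - l 2)"
  have q: "q * (l 1 - l 2) = r 1 - r 2" using nodes_neq by (simp add: q_def)
  have "r 1 * (l 2 - l 3) - r 2 * (l 1 - l 3) + r 3 * (l 1 - l 2) = 0"
  proof -
    have "(l 2 - l 3) * r 1 - (l 1 - l 3) * r 2 + (l 1 - l 2) * r 3 = 0"
      using assms nodes_neq unfolding ddiff_sum divide_eq_0_iff mult_eq_0_iff by blast
    then show ?thesis by (simp add: mult.commute)
  qed
  then have "(r 3 - (r 1 - q * l 1 + q * l 3)) * (l 1 - l 2) = 0" using q by algebra
  then have "r 3 = r 1 - q * l 1 + q * l 3" using nodes_neq by simp
  moreover have "r 2 = r 1 - q * l 1 + q * l 2" using q by algebra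
  ultimately have "r j = (r 1 - q * l 1) + q * l j" for j using exhaust_3[of j] by auto
  then show ?thesis by (rule that)
qed

end

lemma pick_hermitian:
  assumes "\<And>i j. G j i = cnj (G i j)" shows "pick G l j i = cnj (pick G l i j)"
  using assms[of j i] by (simp add: pick_def mult.commute)

lemma gram_hermitian: "gram z j i = cnj (gram z i j)"
  by (simp add: gram_def cnj_cip)

lemma cgram_hermitian: "cgram \<zeta> j i = cnj (cgram \<zeta> i j)"
  by (simp add: cgram_def mult.commute)

text \<open>The two terms of \<open>dpick\<close> are exchanged by transposition and conjugation, so
  together they give twice a real part.\<close>

lemma qform_dpick:
  assumes G: "\<And>i j. G j i = cnj (G i j)"
  shows "qform (dpick G l d) w =
    2 * Re (\<Sum>i\<in>UNIV. w i * d i * (\<Sum>j\<in>UNIV. cnj (w j) * cnj (l j) * pick G l i j / (1 - l i * cnj (l j))))"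
proof -
  define T where "T i j = w i * d i * (cnj (w j) * cnj (l j) * pick G l i j / (1 - l i * cnj (l j)))" for i j
  have "w i * cnj (w j) * dpick G l d i j = T i j + cnj (T j i)" for i j
  proof -
    have "pick G l j i = cnj (pick G l i j)" by (rule pick_hermitian[OF G])
    then have h: "cnj (pick G l j i) = pick G l i j" by (simp only: complex_cnj_cnj)
    have c: "cnj (T j i) = w i * cnj (w j) * (pick G l i j * (l i * cnj (d j)) / (1 - l i * cnj (l j)))"
      by (simp add: T_def h mult_ac)
    show ?thesis unfolding c by (simp add: T_def dpick_def distrib_left add_divide_distrib mult_ac)
  qed
  then have "qform (dpick G l d) w = Re (\<Sum>i\<in>UNIV. \<Sum>j\<in>UNIV. T i j) + Re (\<Sum>i\<in>UNIV. \<Sum>j\<in>UNIV. cnj (T j i))"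
    unfolding qform_def by (simp add: sum.distrib)
  also have "(\<Sum>i\<in>UNIV. \<Sum>j\<in>UNIV. cnj (T j i)) = cnj (\<Sum>i\<in>UNIV. \<Sum>j\<in>UNIV. T i j)"
    by (subst sum.swap) simp
  finally have "qform (dpick G l d) w = 2 * Re (\<Sum>i\<in>UNIV. \<Sum>j\<in>UNIV. T i j)" by simp
  then show ?thesis unfolding T_def sum_distrib_left .
qed

text \<open>Directional derivative of the Pick form at a null vector \<open>u\<close>, when the Pick matrix becomes affine in the nodes
  after rescaling \<open>u\<close> to the divided difference.\<close>

lemma qform_dpick_affine:
  fixes a g :: real and b :: complex and l u \<sigma> :: "3 \<Rightarrow> complex"
  assumes G: "\<And>i j. G j i = cnj (G i j)" and inj: "inj l" and l: "\<And>i. cmod (l i) < 1"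
    and P: "\<And>i j. u i * cnj (u j) * pick G l i j = ddiff l i * cnj (ddiff l j) * (a + b * l i + cnj b * cnj (l j) + g * (l i * cnj (l j)))"
    and d: "\<And>i. d i = \<sigma> i * ((1 - l i * cnj (l 1)) * (1 - l i * cnj (l 2)) * (1 - l i * cnj (l 3))) / ddiff l i"
  shows "qform (dpick G l d) u = 2 * Re (cnj b * (\<sigma> 1 + \<sigma> 2 + \<sigma> 3) + of_real (a + g) * (\<sigma> 1 * l 1 + \<sigma> 2 * l 2 + \<sigma> 3 * l 3)
     + b * (\<sigma> 1 * (l 1)\<^sup>2 + \<sigma> 2 * (l 2)\<^sup>2 + \<sigma> 3 * (l 3)\<^sup>2))"
proof -
  define L where "L j = cnj (l j)" for j
  have injL: "inj L" using inj by (simp add: L_def inj_def)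
  have n: "1 - l i * L j \<noteq> 0" for i j using disc_mult_neq_1[of "l i" "L j"] l[of i] l[of j] by (simp add: L_def)
  \<comment> \<open>The common denominator in \<open>ddiff_geometric\<close>. The direction
    \<open>d\<close> carries this factor, divided by \<open>ddiff l\<close>, so that
    \<open>\<sigma>\<close> enters the derivative without weights.\<close>
  define D where "D i = (1 - l i * L 1) * (1 - l i * L 2) * (1 - l i * L 3)" for i
  have D0: "D i \<noteq> 0" for i using n by (simp add: D_def)
  have v0: "ddiff l i \<noteq> 0" for i by (rule ddiff_nz[OF inj])
  have summand: "u i * d i * (\<Sum>j\<in>UNIV. cnj (u j) * cnj (l j) * pick G l i j / (1 - l i * cnj (l j)))
    = \<sigma> i * (cnj b + (a + g) * l i + b * (l i)\<^sup>2)" for i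
  proof -
    have t: "u i * (cnj (u j) * cnj (l j) * pick G l i j / (1 - l i * cnj (l j)))
       = ddiff l i * ((a + b * l i) * (ddiff L j * (L j / (1 - l i * L j))) + (cnj b + g * l i) * (ddiff L j * ((L j)\<^sup>2 / (1 - l i * L j))))" for j
    proof -
      have "u i * (cnj (u j) * cnj (l j) * pick G l i j / (1 - l i * cnj (l j))) = (u i * cnj (u j) * pick G l i j) * L j / (1 - l i * L j)"
        by (simp add: L_def mult_ac)
      also have "\<dots> = ddiff l i * (ddiff L j * (((a + b * l i) * L j + (cnj b + g * l i) * (L j)\<^sup>2) / (1 - l i * L j)))"
        unfolding P cnj_ddiff L_def[symmetric] by (simp add: algebra_simps power2_eq_square)
      also have "((a + b * l i) * L j + (cnj b + g * l i) * (L j)\<^sup>2) / (1 - l i * L j)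
          = (a + b * l i) * (L j / (1 - l i * L j)) + (cnj b + g * l i) * ((L j)\<^sup>2 / (1 - l i * L j))"
        by (simp add: add_divide_distrib)
      finally show ?thesis by (simp add: algebra_simps)
    qed
    define S1 where "S1 = ddiff L 1 * (L 1 / (1 - l i * L 1)) + ddiff L 2 * (L 2 / (1 - l i * L 2)) + ddiff L 3 * (L 3 / (1 - l i * L 3))"
    define S2 where "S2 = ddiff L 1 * ((L 1)\<^sup>2 / (1 - l i * L 1)) + ddiff L 2 * ((L 2)\<^sup>2 / (1 - l i * L 2)) + ddiff L 3 * ((L 3)\<^sup>2 / (1 - l i * L 3))"
    have S: "S1 = l i / D i" "S2 = 1 / D i"
      unfolding S1_def S2_def D_def by (rule ddiff_geometric[OF injL n])+
    have "u i * (\<Sum>j\<in>UNIV. cnj (u j) * cnj (l j) * pick G l i j / (1 - l i * cnj (l j)))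
      = ddiff l i * ((a + b * l i) * S1 + (cnj b + g * l i) * S2)"
      unfolding sum_distrib_left t unfolding sum_3 S1_def S2_def by (simp only: distrib_left add_ac)
    also have "\<dots> = ddiff l i * ((cnj b + (a + g) * l i + b * (l i)\<^sup>2) / D i)"
      unfolding S by (simp add: algebra_simps power2_eq_square add_divide_distrib)
    finally have e: "u i * (\<Sum>j\<in>UNIV. cnj (u j) * cnj (l j) * pick G l i j / (1 - l i * cnj (l j)))
      = ddiff l i * ((cnj b + (a + g) * l i + b * (l i)\<^sup>2) / D i)" .
    have e2: "u i * d i * (\<Sum>j\<in>UNIV. cnj (u j) * cnj (l j) * pick G l i j / (1 - l i * cnj (l j)))
      = d i * (ddiff l i * ((cnj b + (a + g) * l i + b * (l i)\<^sup>2) / D i))"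
      unfolding e[symmetric] by (simp only: mult_ac)
    have "d i = \<sigma> i * D i / ddiff l i" by (simp add: d D_def L_def)
    then show ?thesis unfolding e2 using D0[of i] v0[of i] by simp
  qed
  show ?thesis unfolding qform_dpick[OF G] summand by (simp add: sum_3 algebra_simps)
qed

lemma sum_UNIV_3:
  fixes f :: "3 \<Rightarrow> 'a::comm_monoid_add"
  assumes "i \<noteq> a" "i \<noteq> b" "a \<noteq> b" shows "sum f UNIV = f i + f a + f b"
  using exhaust_3[of i] exhaust_3[of a] exhaust_3[of b] assms by (auto simp: sum_3 add_ac)

lemma exhaust_distinct_3:
  fixes i a b :: 3
  assumes "i \<noteq> a" "i \<noteq> b" "a \<noteq> b" shows "k = i \<or> k = a \<or> k = b"
  using exhaust_3[of i] exhaust_3[of a] exhaust_3[of b] exhaust_3[of k] assms by auto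

lemma pick_gram_diag:
  assumes "norm (z k) < 1" "cmod (l k) < 1"
  obtains m where "m > 0" "pick (gram z) l k k = complex_of_real m"
proof (rule that)
  show "pick (gram z) l k k = of_real ((1 - (norm (z k))\<^sup>2) / (1 - (cmod (l k))\<^sup>2))"
    by (simp add: pick_def gram_def cip_self of_real_cmod_sq)
  show "(1 - (norm (z k))\<^sup>2) / (1 - (cmod (l k))\<^sup>2) > 0"
    using assms by (intro divide_pos_pos) (auto simp: abs_square_less_1)
qed

text \<open>A degenerate \<open>2 \<times> 2\<close> minor of the Pick matrix forces rank one, because \<open>gram z\<close> has at most one positive
  eigenvalue.\<close>

lemma pick_rank_one:
  fixes z :: "3 \<Rightarrow> complex ^ 'n" and l u :: "3 \<Rightarrow> complex"
  assumes z: "\<And>i. norm (z i) < 1" and l: "\<And>i. cmod (l i) < 1" and inj: "inj l"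
    and P: "psd (pick (gram z) l)" and u: "qform (pick (gram z) l) u = 0" "\<exists>k. u k \<noteq> 0" "u i = 0"
  obtains h where "\<And>k j. pick (gram z) l k j = h k * cnj (h j)"
proof -
  define p where "p = pick (gram z) l"
  have herm: "p j k = cnj (p k j)" for j k unfolding p_def by (rule pick_hermitian[OF gram_hermitian])
  obtain a b where ab: "i \<noteq> a" "i \<noteq> b" "a \<noteq> b"
  proof -
    consider "i = 1" | "i = 2" | "i = 3" using exhaust_3 by blast
    then show ?thesis by cases (use that[of 2 3] that[of 1 3] that[of 1 2] in auto)
  qed
  have ker: "cnj (u a) * p k a + cnj (u b) * p k b = 0" for k
  proof -
    have "(\<Sum>j\<in>UNIV. cnj (u j) * p k j) = 0"
      by (rule psd_kernel[OF P[folded p_def] herm u(1)[folded p_def]])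
    then show ?thesis using u(3) by (simp add: sum_UNIV_3[OF ab])
  qed
  have diag: "p k k \<noteq> 0" for k using pick_gram_diag[of z k l, OF z l] unfolding p_def by (metis less_irrefl of_real_eq_0_iff)
  have "u a \<noteq> 0 \<or> u b \<noteq> 0" using u(2,3) exhaust_distinct_3[OF ab] by metis
  then have ub: "u b \<noteq> 0" using ker[of a] diag[of a] by auto
  define \<rho> where "\<rho> = - cnj (u a) / cnj (u b)"
  have pb: "p k b = \<rho> * p k a" for k using ker[of k] ub by (simp add: \<rho>_def field_simps eq_neg_iff_add_eq_0)
  obtain m where m: "m > 0" "p a a = of_real m" using pick_gram_diag[of z a l, OF z l] unfolding p_def by blast
  define r where "r = sqrt m"
  have r: "r > 0" "of_real r * of_real r = p a a" using m by (auto simp: r_def simp flip: of_real_mult)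
  define h where "h k = p k a / of_real r" for k
  have ha: "h a = of_real r" using r by (simp add: h_def flip: r(2))
  have pa: "p k a = h k * cnj (h a)" for k using r(1) by (simp add: ha) (simp add: h_def)
  have "cnj (h b) = \<rho> * of_real r"
  proof -
    have "cnj (h b) = p a b / of_real r" by (simp add: h_def herm[of b a])
    also have "\<dots> = \<rho> * (p a a / of_real r)" by (simp add: pb)
    also have "p a a / of_real r = of_real r" using r by (simp flip: r(2))
    finally show ?thesis .
  qed
  then have pb': "p k b = h k * cnj (h b)" for k unfolding pb pa by (simp add: ha)
  obtain mi where mi: "p i i = of_real mi" using pick_gram_diag[of z i l, OF z l] unfolding p_def by blast
  \<comment> \<open>Columns \<open>a\<close> and \<open>b\<close> being proportional, Hermitian
    symmetry fixes every entry but \<open>p i i\<close>; \<open>\<epsilon>\<close> is its excess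
    over the rank-one value.\<close>
  define \<epsilon> where "\<epsilon> = mi - (cmod (h i))\<^sup>2"
  have pij: "p k j = h k * cnj (h j) + (if k = i \<and> j = i then of_real \<epsilon> else 0)" for k j
  proof -
    have "p i i = h i * cnj (h i) + of_real \<epsilon>" by (simp add: mi \<epsilon>_def of_real_cmod_sq)
    moreover have "p a i = h a * cnj (h i)" "p b i = h b * cnj (h i)"
      using herm[of a i] herm[of b i] pa[of i] pb'[of i] by simp_all
    ultimately show ?thesis using exhaust_distinct_3[OF ab, of k] exhaust_distinct_3[OF ab, of j] pa pb' ab by auto
  qed
  have qp: "qform p x = (cmod (x i * h i + x a * h a + x b * h b))\<^sup>2 + \<epsilon> * (cmod (x i))\<^sup>2" for x
  proof -
    have "(\<Sum>k\<in>UNIV. \<Sum>j\<in>UNIV. x k * cnj (x j) * p k j) =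
      (x i * h i + x a * h a + x b * h b) * cnj (x i * h i + x a * h a + x b * h b) + of_real \<epsilon> * (x i * cnj (x i))"
      unfolding sum_UNIV_3[OF ab] pij using ab by (simp add: algebra_simps)
    also have "\<dots> = of_real ((cmod (x i * h i + x a * h a + x b * h b))\<^sup>2 + \<epsilon> * (cmod (x i))\<^sup>2)"
      by (simp only: of_real_add of_real_mult of_real_power of_real_cmod_sq)
    finally show ?thesis by (simp add: qform_def)
  qed
  have gp: "gram z k j = p k j * (1 - l k * cnj (l j))" for k j
    unfolding p_def pick_def using disc_mult_neq_1[of "l k" "cnj (l j)"] l[of k] l[of j] by simp
  have qg: "qform (gram z) x = (cmod (x i * h i + x a * h a + x b * h b))\<^sup>2
     - (cmod (x i * (h i * l i) + x a * (h a * l a) + x b * (h b * l b)))\<^sup>2 + \<epsilon> * (1 - (cmod (l i))\<^sup>2) * (cmod (x i))\<^sup>2" for x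
  proof -
    have "(\<Sum>k\<in>UNIV. \<Sum>j\<in>UNIV. x k * cnj (x j) * gram z k j) =
      (x i * h i + x a * h a + x b * h b) * cnj (x i * h i + x a * h a + x b * h b)
      - (x i * (h i * l i) + x a * (h a * l a) + x b * (h b * l b)) * cnj (x i * (h i * l i) + x a * (h a * l a) + x b * (h b * l b))
      + of_real \<epsilon> * (1 - l i * cnj (l i)) * (x i * cnj (x i))"
      unfolding sum_UNIV_3[OF ab] gp pij using ab by (simp add: algebra_simps)
    also have "\<dots> = of_real ((cmod (x i * h i + x a * h a + x b * h b))\<^sup>2
     - (cmod (x i * (h i * l i) + x a * (h a * l a) + x b * (h b * l b)))\<^sup>2 + \<epsilon> * (1 - (cmod (l i))\<^sup>2) * (cmod (x i))\<^sup>2)"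
      by (simp only: of_real_add of_real_diff of_real_mult of_real_power of_real_cmod_sq of_real_1)
    finally show ?thesis by (simp add: qform_def)
  qed
  have h0: "h a \<noteq> 0" "h b \<noteq> 0"
    using diag[of a] diag[of b] pa[of a] pb'[of b] by auto
  have "0 \<le> \<epsilon>"
  proof -
    define x where "x k = (if k = i then 1 else if k = a then - h i / h a else 0)" for k
    have "x i = 1" "x a = - h i / h a" "x b = 0" using ab by (auto simp: x_def)
    then have "qform p x = \<epsilon>" using h0 by (simp add: qp)
    then show ?thesis using P unfolding psd_def p_def by metis
  qed
  moreover have "\<not> 0 < \<epsilon>"
  proof
    assume \<epsilon>: "0 < \<epsilon>"
    \<comment> \<open>The first condition makes \<open>gram z\<close> nonpositive at
      \<open>x\<close>, the second removes the subtracted square in \<open>qg\<close>.\<close>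
    obtain x :: "3 \<Rightarrow> complex" where x: "\<exists>i. x i \<noteq> 0" "1 * x 1 + 1 * x 2 + 1 * x 3 = 0"
      "(h 1 * l 1) * x 1 + (h 2 * l 2) * x 2 + (h 3 * l 3) * x 3 = 0"
      using two_equations[of "\<lambda>k. 1" "\<lambda>k. h k * l k"] by blast
    have "(\<Sum>k\<in>UNIV. x k * (h k * l k)) = 0" using x(3) by (simp add: sum_3 mult.commute)
    then have s2: "x i * (h i * l i) + x a * (h a * l a) + x b * (h b * l b) = 0" by (simp add: sum_UNIV_3[OF ab])
    have "qform (gram z) x \<le> 0" unfolding qform_gram using x(2) by simp
    then have le: "(cmod (x i * h i + x a * h a + x b * h b))\<^sup>2 + \<epsilon> * (1 - (cmod (l i))\<^sup>2) * (cmod (x i))\<^sup>2 \<le> 0"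
      unfolding qg s2 by simp
    have pos: "\<epsilon> * (1 - (cmod (l i))\<^sup>2) > 0" using \<epsilon> l[of i] by (simp add: abs_square_less_1)
    then have "\<epsilon> * (1 - (cmod (l i))\<^sup>2) * (cmod (x i))\<^sup>2 \<ge> 0" by simp
    then have "(cmod (x i * h i + x a * h a + x b * h b))\<^sup>2 = 0" "\<epsilon> * (1 - (cmod (l i))\<^sup>2) * (cmod (x i))\<^sup>2 = 0"
      using le zero_le_power2[of "cmod (x i * h i + x a * h a + x b * h b)"] by linarith+
    then have xi: "x i = 0" and s1: "x a * h a + x b * h b = 0" using pos by auto
    have "x a * h a * (l a - l b) = 0" using s1 s2 xi by algebra
    then have "x a = 0" using h0 ab inj by (auto simp: inj_eq)
    then have "x b = 0" using s1 h0 by simp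
    then show False using x(1) \<open>x a = 0\<close> xi exhaust_distinct_3[OF ab] by metis
  qed
  ultimately have "\<epsilon> = 0" by simp
  then show ?thesis using that[of h] pij unfolding p_def by auto
qed

lemma qform_affine:
  fixes a g :: real and l y :: "3 \<Rightarrow> complex"
  assumes h: "\<And>i. h i \<noteq> 0" and M: "\<And>i j. M i j = h i * cnj (h j) * (a + b * (l i * cnj (l j)) + g * (l i * cnj (l j))\<^sup>2)"
    and b: "b = of_real c"
  shows "qform M (\<lambda>i. y i / h i) = a * (cmod (y 1 + y 2 + y 3))\<^sup>2 + c * (cmod (y 1 * l 1 + y 2 * l 2 + y 3 * l 3))\<^sup>2
    + g * (cmod (y 1 * (l 1)\<^sup>2 + y 2 * (l 2)\<^sup>2 + y 3 * (l 3)\<^sup>2))\<^sup>2"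
proof -
  have e: "y i / h i * cnj (y j / h j) * M i j = y i * cnj (y j) * (a + b * (l i * cnj (l j)) + g * (l i * cnj (l j))\<^sup>2)" for i j
    unfolding M using h[of i] h[of j] by simp
  have "(\<Sum>i\<in>UNIV. \<Sum>j\<in>UNIV. y i / h i * cnj (y j / h j) * M i j) =
    a * ((y 1 + y 2 + y 3) * cnj (y 1 + y 2 + y 3)) + c * ((y 1 * l 1 + y 2 * l 2 + y 3 * l 3) * cnj (y 1 * l 1 + y 2 * l 2 + y 3 * l 3))
    + g * ((y 1 * (l 1)\<^sup>2 + y 2 * (l 2)\<^sup>2 + y 3 * (l 3)\<^sup>2) * cnj (y 1 * (l 1)\<^sup>2 + y 2 * (l 2)\<^sup>2 + y 3 * (l 3)\<^sup>2))"
    unfolding e b sum_3 by (simp add: algebra_simps power_mult_distrib)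
  also have "\<dots> = of_real (a * (cmod (y 1 + y 2 + y 3))\<^sup>2 + c * (cmod (y 1 * l 1 + y 2 * l 2 + y 3 * l 3))\<^sup>2
    + g * (cmod (y 1 * (l 1)\<^sup>2 + y 2 * (l 2)\<^sup>2 + y 3 * (l 3)\<^sup>2))\<^sup>2)"
    by (simp only: of_real_add of_real_mult of_real_power of_real_cmod_sq)
  finally show ?thesis by (simp only: qform_def Re_complex_of_real)
qed

text \<open>After rescaling, the kernel relation says that each row has vanishing second divided
  difference at the conjugate nodes, hence is affine in \<open>cnj (l j)\<close>; by Hermitian
  symmetry the columns are affine in \<open>l i\<close>.\<close>

lemma kernel_affine:
  fixes l u :: "3 \<Rightarrow> complex" and p :: "3 \<Rightarrow> 3 \<Rightarrow> complex"
  assumes inj: "inj l" and herm: "\<And>i j. p j i = cnj (p i j)" and u: "\<And>i. u i \<noteq> 0"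
    and ker: "\<And>i. (\<Sum>j\<in>UNIV. cnj (u j) * p i j) = 0"
  obtains a g b where
    "\<And>i j. u i * cnj (u j) * p i j = ddiff l i * cnj (ddiff l j) * (complex_of_real a + b * l i + cnj b * cnj (l j) + complex_of_real g * (l i * cnj (l j)))"
proof -
  define v where "v = ddiff l"
  have v0: "v i \<noteq> 0" for i unfolding v_def by (rule ddiff_nz[OF inj])
  define R where "R i j = u i * cnj (u j) * p i j / (v i * cnj (v j))" for i j
  have R: "u i * cnj (u j) * p i j = v i * cnj (v j) * R i j" for i j using v0 by (simp add: R_def)
  have Rh: "cnj (R j i) = R i j" for i j unfolding R_def by (simp add: herm[of i j] mult_ac)
  define L where "L j = cnj (l j)" for j
  have injL: "inj L" using inj by (simp add: L_def inj_def)
  have "\<exists>p q. \<forall>j. R i j = p + q * L j" for i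
  proof -
    have "cnj (v j) * R i j = u i / v i * (cnj (u j) * p i j)" for j using v0[of i] v0[of j] by (simp add: R_def)
    then have "(\<Sum>j\<in>UNIV. cnj (v j) * R i j) = u i / v i * (\<Sum>j\<in>UNIV. cnj (u j) * p i j)"
      by (simp only: sum_distrib_left)
    then have "(\<Sum>j\<in>UNIV. cnj (v j) * R i j) = 0" unfolding ker by simp
    then have "ddiff L 1 * R i 1 + ddiff L 2 * R i 2 + ddiff L 3 * R i 3 = 0" by (simp add: sum_3 v_def cnj_ddiff L_def[abs_def])
    then show ?thesis using ddiff_zero_affine[OF injL] by metis
  qed
  then obtain P Q where PQ: "\<And>i j. R i j = P i + Q i * L j" by metis
  define \<delta> where "\<delta> = L 1 - L 2"
  have \<delta>: "\<delta> \<noteq> 0" using nodes_neq[OF injL] by (simp add: \<delta>_def)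
  have Ri: "R i k = cnj (P k) + cnj (Q k) * l i" for i k
    using Rh[of k i] PQ[of k i] by (simp add: L_def)
  define \<beta>' where "\<beta>' = (cnj (P 1) - cnj (P 2)) / \<delta>"
  define \<gamma> where "\<gamma> = (cnj (Q 1) - cnj (Q 2)) / \<delta>"
  define \<alpha> where "\<alpha> = cnj (P 1) - \<beta>' * L 1"
  define \<beta> where "\<beta> = cnj (Q 1) - \<gamma> * L 1"
  have Qi: "Q i = \<beta>' + \<gamma> * l i" for i
  proof -
    have "Q i * \<delta> = R i 1 - R i 2" unfolding PQ \<delta>_def by (simp add: algebra_simps)
    also have "\<dots> = (\<beta>' + \<gamma> * l i) * \<delta>" unfolding Ri \<beta>'_def \<gamma>_def using \<delta> by (simp add: field_simps)
    finally show ?thesis using \<delta> by simp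
  qed
  have Pi: "P i = \<alpha> + \<beta> * l i" for i
  proof -
    have "P i = R i 1 - Q i * L 1" unfolding PQ by simp
    then show ?thesis unfolding Ri Qi \<alpha>_def \<beta>_def by (simp add: algebra_simps)
  qed
  have R1: "R i j = \<alpha> + \<beta> * l i + \<beta>' * L j + \<gamma> * (l i * L j)" for i j
    unfolding PQ Pi Qi by (simp add: algebra_simps)
  \<comment> \<open>Averaging \<open>R i j\<close> with \<open>cnj (R j i)\<close> symmetrises the
    four coefficients without comparing them one by one.\<close>
  define b where "b = (\<beta> + cnj \<beta>') / 2"
  have "R i j = of_real (Re \<alpha>) + b * l i + cnj b * L j + of_real (Re \<gamma>) * (l i * L j)" for i j
  proof -
    have re: "of_real (Re x) = (x + cnj x) / 2" for x using complex_add_cnj[of x] by simp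
    have "R i j = (R i j + cnj (R j i)) / 2" unfolding Rh by simp
    also have "\<dots> = of_real (Re \<alpha>) + b * l i + cnj b * L j + of_real (Re \<gamma>) * (l i * L j)"
      unfolding R1 re b_def L_def by (simp add: field_simps)
    finally show ?thesis .
  qed
  then show ?thesis using that[of "Re \<alpha>" b "Re \<gamma>"] R unfolding v_def L_def by metis
qed

text \<open>The criticality argument. A perturbation of the nodes that keeps the Pick matrix of the points positive definite
  must not destroy positivity of the Pick matrix of the targets; at first order this kills the mixed coefficient \<open>b\<close>.\<close>

lemma nonunique_critical:
  fixes z :: "3 \<Rightarrow> complex ^ 'd" and l :: "3 \<Rightarrow> complex"
  assumes d: "CARD('d) \<ge> 2" and z: "\<And>i. norm (z i) < 1" and injz: "inj z" and l: "\<And>i. cmod (l i) < 1"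
    and P: "psd (pick (gram z) l)" and dom: "pick_dominates (gram z) (cgram (\<lambda>i. (l i)\<^sup>2))"
  shows "nonunique z (\<lambda>i. (l i)\<^sup>2)"
proof -
  have inj: "inj l" by (rule psd_pick_inj[OF P l injz])
  define p where "p = pick (gram z) l"
  have herm: "p j i = cnj (p i j)" for j i unfolding p_def by (rule pick_hermitian[OF gram_hermitian])
  have X1: "1 - l k * cnj (l j) \<noteq> 0" for k j using disc_mult_neq_1[of "l k" "cnj (l j)"] l[of k] l[of j] by simp
  have gp: "gram z k j = p k j * (1 - l k * cnj (l j))" for k j unfolding p_def pick_def using X1 by simp
  have finish: "nonunique z (\<lambda>i. (l i)\<^sup>2)"
    if "\<And>k j. p k j = h k * cnj (h j) * (1 + of_real (s\<^sup>2) * (l k * cnj (l j)))" "0 \<le> s" "s \<le> 1" for h and s :: real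
  proof (rule nonunique_normal_form[OF d z _ l that(2,3)])
    show "z 1 \<noteq> z 2" using injz by (simp add: inj_eq)
    show "1 - cip (z i) (z j) = h i * cnj (h j) * ((1 - l i * cnj (l j)) * (1 + of_real (s\<^sup>2) * (l i * cnj (l j))))" for i j
      using gp[of i j] unfolding gram_def that(1) by (simp add: mult_ac)
  qed
  show ?thesis
  \<comment> \<open>A null vector with a zero entry forces rank one, which is the normal form with
    \<open>s = 0\<close>; otherwise null vectors may be divided by entrywise.\<close>
  proof (cases "\<exists>u i. qform p u = 0 \<and> (\<exists>k. u k \<noteq> 0) \<and> u i = 0")
    case True
    then obtain h where "\<And>k j. p k j = h k * cnj (h j)"
      using pick_rank_one[OF z l inj P] unfolding p_def by metis
    then show ?thesis using finish[of h 0] by simp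
  next
    case False
    then have nk: "u i \<noteq> 0" if "qform p u = 0" "\<exists>k. u k \<noteq> 0" for u i using that by blast
    define G' where "G' = cgram (\<lambda>i. (l i)\<^sup>2)"
    \<comment> \<open>The target Pick matrix has rank two; its null vector is the divided
      difference, which annihilates 1 and \<open>l\<close>.\<close>
    have Q: "pick G' l i j = 1 + l i * cnj (l j)" for i j
    proof -
      have "G' i j = (1 + l i * cnj (l j)) * (1 - l i * cnj (l j))"
        by (simp add: G'_def cgram_def power2_eq_square algebra_simps)
      then show ?thesis unfolding pick_def using X1[of i j] by simp
    qed
    define D where "D \<sigma> i = \<sigma> i * ((1 - l i * cnj (l 1)) * (1 - l i * cnj (l 2)) * (1 - l i * cnj (l 3))) / ddiff l i" for \<sigma> i
    have v0: "qform (pick G' l) (ddiff l) = 0"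
    proof -
      have "(\<Sum>i\<in>UNIV. \<Sum>j\<in>UNIV. ddiff l i * cnj (ddiff l j) * pick G' l i j) =
        (ddiff l 1 + ddiff l 2 + ddiff l 3) * cnj (ddiff l 1 + ddiff l 2 + ddiff l 3)
        + (ddiff l 1 * l 1 + ddiff l 2 * l 2 + ddiff l 3 * l 3) * cnj (ddiff l 1 * l 1 + ddiff l 2 * l 2 + ddiff l 3 * l 3)"
        unfolding sum_3 Q by (simp add: algebra_simps)
      then show ?thesis unfolding qform_def ddiff_1[OF inj] ddiff_id[OF inj] by simp
    qed
    \<comment> \<open>For the targets \<open>a = g = 1\<close> and \<open>b = 0\<close>, so the
      derivative is four times the real part shown; no direction admissible for the points can make
      it negative.\<close>
    have no_descent: "0 \<le> Re (\<sigma> 1 * l 1 + \<sigma> 2 * l 2 + \<sigma> 3 * l 3)"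
      if ker: "\<And>w. \<exists>i. w i \<noteq> 0 \<Longrightarrow> qform p w = 0 \<Longrightarrow> 0 < qform (dpick (gram z) l (D \<sigma>)) w" for \<sigma>
    proof -
      have "0 \<le> qform (dpick G' l (D \<sigma>)) (ddiff l)"
        by (rule pick_dominates_derivative[OF dom[folded G'_def] l P _ v0]) (use ker in \<open>simp add: p_def\<close>)
      also have "\<dots> = 2 * Re (cnj 0 * (\<sigma> 1 + \<sigma> 2 + \<sigma> 3) + of_real (1 + 1) * (\<sigma> 1 * l 1 + \<sigma> 2 * l 2 + \<sigma> 3 * l 3)
         + 0 * (\<sigma> 1 * (l 1)\<^sup>2 + \<sigma> 2 * (l 2)\<^sup>2 + \<sigma> 3 * (l 3)\<^sup>2))"
      proof (rule qform_dpick_affine[OF _ inj l])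
        show "G' j i = cnj (G' i j)" for i j unfolding G'_def by (rule cgram_hermitian)
      qed (simp_all add: Q D_def)
      finally show ?thesis by simp
    qed
    \<comment> \<open>If the Pick matrix of the points were definite, every direction would be
      admissible, even one for which that sum is -1.\<close>
    have "\<exists>u. qform p u = 0 \<and> (\<exists>k. u k \<noteq> 0)"
    proof (rule ccontr)
      assume no: "\<not> ?thesis"
      obtain \<sigma> :: "3 \<Rightarrow> complex" where "\<sigma> 1 + \<sigma> 2 + \<sigma> 3 = 0" "\<sigma> 1 * l 1 + \<sigma> 2 * l 2 + \<sigma> 3 * l 3 = - 1"
        "\<sigma> 1 * (l 1)\<^sup>2 + \<sigma> 2 * (l 2)\<^sup>2 + \<sigma> 3 * (l 3)\<^sup>2 = 0" by (rule vandermonde[OF inj])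
      moreover have "0 \<le> Re (\<sigma> 1 * l 1 + \<sigma> 2 * l 2 + \<sigma> 3 * l 3)" by (rule no_descent) (use no in auto)
      ultimately show False by simp
    qed
    then obtain u where u: "qform p u = 0" "\<exists>k. u k \<noteq> 0" by blast
    have u0: "u i \<noteq> 0" for i by (rule nk[OF u])
    have kr: "(\<Sum>j\<in>UNIV. cnj (w j) * p i j) = 0" if "qform p w = 0" for w i
      by (rule psd_kernel[OF P[folded p_def] herm that])
    \<comment> \<open>Subtracting the multiple of \<open>u\<close> that kills the first entry leaves
      a null vector with a zero entry, which must vanish in this case.\<close>
    have multiple: "\<exists>c. w = (\<lambda>i. c * u i)" if w: "qform p w = 0" for w
    proof -
      define c where "c = w 1 / u 1"
      define w' where "w' i = w i - c * u i" for i
      have "(\<Sum>j\<in>UNIV. cnj (w' j) * p i j) = (\<Sum>j\<in>UNIV. cnj (w j) * p i j) - cnj c * (\<Sum>j\<in>UNIV. cnj (u j) * p i j)" for i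
        by (simp add: w'_def sum_3 algebra_simps)
      then have "(\<Sum>j\<in>UNIV. cnj (w' j) * p i j) = 0" for i by (simp add: kr[OF w] kr[OF u(1)])
      then have "(\<Sum>i\<in>UNIV. w' i * (\<Sum>j\<in>UNIV. cnj (w' j) * p i j)) = 0" by simp
      then have "qform p w' = 0" unfolding qform_def sum_distrib_left by (simp add: mult.assoc)
      moreover have "w' 1 = 0" using u0[of 1] by (simp add: w'_def c_def)
      ultimately have "w' i = 0" for i using nk[of w' 1] by auto
      then have "w = (\<lambda>i. c * u i)" by (simp add: w'_def fun_eq_iff)
      then show ?thesis by blast
    qed
    obtain a g b where R: "\<And>i j. u i * cnj (u j) * p i j = ddiff l i * cnj (ddiff l j) * (complex_of_real a + b * l i + cnj b * cnj (l j) + complex_of_real g * (l i * cnj (l j)))"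
      by (rule kernel_affine[OF inj herm u0 kr[OF u(1)]]) (rule that)
    have "b = 0"
    proof (rule ccontr)
      assume b: "b \<noteq> 0"
      define k where "k = \<bar>a + g\<bar> + 1"
      have k: "k > 0" by (simp add: k_def)
      \<comment> \<open>So small that the gain \<open>|b|^2\<close> in the derivative for the points
        outweighs \<open>(a + g) * e\<close>, while the targets only see \<open>- e\<close>.\<close>
      define e where "e = (cmod b)\<^sup>2 / (2 * k)"
      have e: "e > 0" using b k by (simp add: e_def)
      have "(a + g) * e \<le> \<bar>a + g\<bar> * e" using e by (simp add: mult_right_mono)
      also have "\<dots> < k * e" using e by (simp add: k_def)
      also have "\<dots> = (cmod b)\<^sup>2 / 2" unfolding e_def using k by simp
      finally have ae: "(a + g) * e < (cmod b)\<^sup>2 / 2" .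
      obtain \<sigma> :: "3 \<Rightarrow> complex" where \<sigma>: "\<sigma> 1 + \<sigma> 2 + \<sigma> 3 = b" "\<sigma> 1 * l 1 + \<sigma> 2 * l 2 + \<sigma> 3 * l 3 = - of_real e"
        "\<sigma> 1 * (l 1)\<^sup>2 + \<sigma> 2 * (l 2)\<^sup>2 + \<sigma> 3 * (l 3)\<^sup>2 = 0" by (rule vandermonde[OF inj])
      have "qform (dpick (gram z) l (D \<sigma>)) u = 2 * Re (cnj b * (\<sigma> 1 + \<sigma> 2 + \<sigma> 3) + of_real (a + g) * (\<sigma> 1 * l 1 + \<sigma> 2 * l 2 + \<sigma> 3 * l 3)
         + b * (\<sigma> 1 * (l 1)\<^sup>2 + \<sigma> 2 * (l 2)\<^sup>2 + \<sigma> 3 * (l 3)\<^sup>2))"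
        by (rule qform_dpick_affine[OF gram_hermitian inj l R[unfolded p_def]]) (simp add: D_def)
      also have "\<dots> = 2 * ((cmod b)\<^sup>2 - (a + g) * e)"
        unfolding \<sigma> by (simp add: mult.commute[of "cnj b"] flip: of_real_cmod_sq)
      also have "\<dots> > 0"
      proof (rule mult_pos_pos)
        show "0 < (cmod b)\<^sup>2 - (a + g) * e" using ae zero_le_power2[of "cmod b"] by linarith
      qed simp
      finally have pos: "0 < qform (dpick (gram z) l (D \<sigma>)) u" .
      have "0 \<le> Re (\<sigma> 1 * l 1 + \<sigma> 2 * l 2 + \<sigma> 3 * l 3)"
      proof (rule no_descent)
        fix w :: "3 \<Rightarrow> complex" assume w: "\<exists>i. w i \<noteq> 0" "qform p w = 0"
        then obtain c where c: "w = (\<lambda>i. c * u i)" using multiple by blast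
        then have "c \<noteq> 0" using w(1) by auto
        then show "0 < qform (dpick (gram z) l (D \<sigma>)) w" unfolding c qform_scale using pos by simp
      qed
      then show False unfolding \<sigma> using e by simp
    qed
    define h where "h i = ddiff l i / u i" for i
    have h0: "h i \<noteq> 0" for i using ddiff_nz[OF inj] u0 by (simp add: h_def)
    have pij: "p i j = h i * cnj (h j) * (of_real a + of_real g * (l i * cnj (l j)))" for i j
    proof -
      have "u i * cnj (u j) * p i j = ddiff l i * cnj (ddiff l j) * (of_real a + of_real g * (l i * cnj (l j)))"
        using R[of i j] unfolding \<open>b = 0\<close> by simp
      then show ?thesis using u0[of i] u0[of j] by (simp add: h_def field_simps)
    qed
    have qp: "qform p (\<lambda>i. y i / h i) = a * (cmod (y 1 + y 2 + y 3))\<^sup>2 + g * (cmod (y 1 * l 1 + y 2 * l 2 + y 3 * l 3))\<^sup>2" for y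
      using qform_affine[where M = p and a = a and g = 0 and b = "of_real g" and c = g and h = h and l = l, OF h0] pij by simp
    have psd: "0 \<le> qform p x" for x using P unfolding psd_def p_def by blast
    have a0: "0 \<le> a"
    proof -
      obtain y :: "3 \<Rightarrow> complex" where "y 1 + y 2 + y 3 = 1" "y 1 * l 1 + y 2 * l 2 + y 3 * l 3 = 0"
        "y 1 * (l 1)\<^sup>2 + y 2 * (l 2)\<^sup>2 + y 3 * (l 3)\<^sup>2 = 0" by (rule vandermonde[OF inj])
      then show ?thesis using qp[of y] psd[of "\<lambda>i. y i / h i"] by simp
    qed
    have g0: "0 \<le> g"
    proof -
      obtain y :: "3 \<Rightarrow> complex" where "y 1 + y 2 + y 3 = 0" "y 1 * l 1 + y 2 * l 2 + y 3 * l 3 = 1"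
        "y 1 * (l 1)\<^sup>2 + y 2 * (l 2)\<^sup>2 + y 3 * (l 3)\<^sup>2 = 0" by (rule vandermonde[OF inj])
      then show ?thesis using qp[of y] psd[of "\<lambda>i. y i / h i"] by simp
    qed
    show ?thesis
    proof (cases "a = 0")
      case True
      \<comment> \<open>Rank one again, with the nodes absorbed into the factors.\<close>
      define h' where "h' i = of_real (sqrt g) * h i * l i" for i
      have gg: "complex_of_real (sqrt g) * of_real (sqrt g) = of_real g" using g0 by (simp flip: of_real_mult)
      have "p k j = h' k * cnj (h' j)" for k j unfolding pij True h'_def gg[symmetric] by simp
      then show ?thesis using finish[of h' 0] by simp
    next
      case False
      then have ap: "a > 0" using a0 by simp
      \<comment> \<open>Multiplying back by the kernel gives coefficients \<open>a\<close>,
        \<open>g - a\<close>, \<open>- g\<close> at the powers of \<open>l i * cnj (l j)\<close>;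
        for \<open>g > a\<close> two of them would be positive, one more than the signature of
        \<open>gram z\<close> allows.\<close>
      have "g \<le> a"
      proof (rule ccontr)
        assume "\<not> g \<le> a"
        then have ga: "g - a > 0" by simp
        obtain x :: "3 \<Rightarrow> complex" where x: "\<exists>i. x i \<noteq> 0" "1 * x 1 + 1 * x 2 + 1 * x 3 = 0"
          "(h 1 * (l 1)\<^sup>2) * x 1 + (h 2 * (l 2)\<^sup>2) * x 2 + (h 3 * (l 3)\<^sup>2) * x 3 = 0"
          using two_equations[of "\<lambda>k. 1" "\<lambda>k. h k * (l k)\<^sup>2"] by blast
        define y where "y i = x i * h i" for i
        have xy: "x = (\<lambda>i. y i / h i)" using h0 by (simp add: y_def)
        have y2: "y 1 * (l 1)\<^sup>2 + y 2 * (l 2)\<^sup>2 + y 3 * (l 3)\<^sup>2 = 0" using x(3) by (simp add: y_def mult_ac)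
        have gij: "gram z i j = h i * cnj (h j) * (of_real a + of_real (g - a) * (l i * cnj (l j)) + of_real (- g) * (l i * cnj (l j))\<^sup>2)" for i j
          unfolding gp pij by (simp add: algebra_simps power2_eq_square)
        have "qform (gram z) x \<le> 0" unfolding qform_gram using x(2) by simp
        then have le: "a * (cmod (y 1 + y 2 + y 3))\<^sup>2 + (g - a) * (cmod (y 1 * l 1 + y 2 * l 2 + y 3 * l 3))\<^sup>2 \<le> 0"
          unfolding xy qform_affine[where M = "gram z" and a = a and g = "- g" and c = "g - a" and h = h and l = l, OF h0 gij refl] y2 by simp
        have "a * (cmod (y 1 + y 2 + y 3))\<^sup>2 \<ge> 0" "(g - a) * (cmod (y 1 * l 1 + y 2 * l 2 + y 3 * l 3))\<^sup>2 \<ge> 0"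
          using ap ga by simp_all
        then have "a * (cmod (y 1 + y 2 + y 3))\<^sup>2 = 0" "(g - a) * (cmod (y 1 * l 1 + y 2 * l 2 + y 3 * l 3))\<^sup>2 = 0" using le by linarith+
        then have "y 1 + y 2 + y 3 = 0" "y 1 * l 1 + y 2 * l 2 + y 3 * l 3 = 0" using ap ga by simp_all
        then have "y i = 0" for i using vandermonde_zero[OF inj _ _ y2] by blast
        then show False using x(1) h0 by (auto simp: y_def)
      qed
      define s where "s = sqrt (g / a)"
      have s: "0 \<le> s" "s \<le> 1" "s\<^sup>2 = g / a" using g0 ap \<open>g \<le> a\<close> by (auto simp: s_def divide_le_eq)
      define h' where "h' i = of_real (sqrt a) * h i" for i
      have aa: "complex_of_real (sqrt a) * of_real (sqrt a) = of_real a" using a0 by (simp flip: of_real_mult)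
      have "p k j = h' k * cnj (h' j) * (1 + of_real (s\<^sup>2) * (l k * cnj (l j)))" for k j
      proof -
        have "h' k * cnj (h' j) * (1 + of_real (s\<^sup>2) * (l k * cnj (l j))) = of_real a * (h k * cnj (h j)) * (1 + of_real (g / a) * (l k * cnj (l j)))"
          unfolding h'_def s aa[symmetric] by (simp only: complex_cnj_mult complex_cnj_complex_of_real mult_ac)
        also have "\<dots> = p k j" unfolding pij using ap by (simp add: field_simps)
        finally show ?thesis by simp
      qed
      then show ?thesis using finish[of h' s] s by blast
    qed
  qed
qed

section \<open>Singular Pick matrices\<close>

lemma nonunique_rotate:
  assumes \<tau>: "cmod \<tau> = 1" and n: "nonunique z (\<lambda>j. \<tau> * \<zeta> j)"
  shows "nonunique z \<zeta>"
proof -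
  have t: "cnj \<tau> * \<tau> = 1" using \<tau> by (simp add: mult.commute flip: of_real_cmod_sq)
  have "solves z \<zeta> (\<lambda>w. cnj \<tau> * f w)" if "solves z (\<lambda>j. \<tau> * \<zeta> j) f" for f
    using that t \<tau> unfolding solves_def
    by (auto intro!: cn_holomorphic_intros simp: norm_mult simp flip: mult.assoc)
  moreover have "\<tau> \<noteq> 0" using \<tau> by auto
  ultimately show ?thesis using n unfolding nonunique_def by (metis complex_cnj_zero_iff mult_cancel_left)
qed

lemma cgram_rotate: assumes "cmod \<tau> = 1" shows "cgram (\<lambda>j. \<tau> * \<zeta> j) = cgram \<zeta>"
proof -
  have "\<tau> * cnj \<tau> = 1" using assms by (simp flip: of_real_cmod_sq)
  then have t: "\<tau> * a * (cnj \<tau> * b) = a * b" for a b by (metis mult.assoc mult.commute mult.left_neutral)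
  show ?thesis by (simp only: cgram_def[abs_def] complex_cnj_mult t)
qed

text \<open>The reduced Pick inequality compares pseudohyperbolic distances.\<close>

lemma reduced_pick_moeb:
  assumes l: "cmod l2 < 1" "cmod l3 < 1" and g: "cmod g2 < 1" "cmod g3 < 1"
  defines "x \<equiv> (cmod l2)\<^sup>2" and "y \<equiv> (cmod l3)\<^sup>2" and "w \<equiv> l2 * cnj l3"
  shows "(1 - x) * (1 - y) * (cmod (w - (l2 * g2) * cnj (l3 * g3)))\<^sup>2
      - (x - (cmod (l2 * g2))\<^sup>2) * (y - (cmod (l3 * g3))\<^sup>2) * (cmod (1 - w))\<^sup>2
    = x * y * (cmod (1 - w))\<^sup>2 * (cmod (1 - g2 * cnj g3))\<^sup>2 * ((cmod (moeb g2 g3))\<^sup>2 - (cmod (moeb l2 l3))\<^sup>2)"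
proof -
  have c: "cmod (1 - cnj u * t) = cmod (1 - u * cnj t)" for u t
    using complex_mod_cnj[of "1 - u * cnj t"] by (simp del: complex_mod_cnj)
  define N where "N = (cmod (1 - g2 * cnj g3))\<^sup>2"
  define W where "W = (cmod (1 - w))\<^sup>2"
  have N: "N \<noteq> 0" using disc_mult_neq_1[of g2 "cnj g3"] g by (simp add: N_def)
  have W: "W \<noteq> 0" using disc_mult_neq_1[of l2 "cnj l3"] l by (simp add: W_def w_def)
  have m: "(1 - x) * (1 - y) = (1 - (cmod (moeb l2 l3))\<^sup>2) * W"
    using l W by (simp add: moeb_norm_sq c x_def y_def w_def W_def)
  have n: "(1 - (cmod g2)\<^sup>2) * (1 - (cmod g3)\<^sup>2) = (1 - (cmod (moeb g2 g3))\<^sup>2) * N"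
    using g N by (simp add: moeb_norm_sq c N_def)
  have "w - (l2 * g2) * cnj (l3 * g3) = l2 * cnj l3 * (1 - g2 * cnj g3)" by (simp add: w_def algebra_simps)
  then have 1: "(cmod (w - (l2 * g2) * cnj (l3 * g3)))\<^sup>2 = x * y * N"
    by (simp add: norm_mult power_mult_distrib x_def y_def N_def)
  have 2: "(x - (cmod (l2 * g2))\<^sup>2) * (y - (cmod (l3 * g3))\<^sup>2) = x * y * ((1 - (cmod g2)\<^sup>2) * (1 - (cmod g3)\<^sup>2))"
    by (simp add: norm_mult power_mult_distrib x_def y_def algebra_simps)
  show ?thesis unfolding 1 2 m n N_def[symmetric] W_def[symmetric] by (simp add: algebra_simps)
qed

text \<open>Equality in the Schwarz-Pick inequality: \<open>moeb l2\<close>, followed by the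
  rotation by \<open>t\<close> and by \<open>moeb (- g2)\<close>, carries both nodes to their
  targets; this composition is rewritten as a rotation after \<open>moeb k\<close>.\<close>

lemma blaschke_two_points:
  assumes l: "cmod l2 < 1" "l2 \<noteq> l3" "cmod l3 < 1" and g: "cmod g2 < 1" "cmod g3 < 1"
    and eq: "cmod (moeb g2 g3) = cmod (moeb l2 l3)"
  obtains \<tau> k where "cmod \<tau> = 1" "cmod k < 1" "g2 = \<tau> * moeb k l2" "g3 = \<tau> * moeb k l3"
proof -
  define m where "m = moeb l2 l3"
  define n where "n = moeb g2 g3"
  have e: "1 - cnj l2 * l3 \<noteq> 0" using moeb_denom[of l2 l3] l by simp
  have m0: "m \<noteq> 0" using l e by (simp add: m_def moeb_def)
  define t where "t = n / m"
  have t: "cmod t = 1" using eq m0 by (simp add: t_def n_def m_def norm_divide)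
  have tt: "t * cnj t = 1" using t by (simp flip: of_real_cmod_sq)
  have tm: "t * m = n" using m0 by (simp add: t_def)
  \<comment> \<open>The composition is \<open>p * u - q\<close> over
    \<open>t * cnj p - t * cnj q * u\<close>.\<close>
  define p where "p = t - g2 * cnj l2"
  define q where "q = t * l2 - g2"
  have cp: "t * cnj p = 1 - cnj g2 * t * l2" "t * cnj q = cnj l2 - cnj g2 * t"
    using tt by (simp_all add: p_def q_def right_diff_distrib)
  have "p * cnj p - q * cnj q = (1 - g2 * cnj g2) * (1 - l2 * cnj l2)"
    unfolding p_def q_def using tt by (simp add: algebra_simps)
  then have "complex_of_real ((cmod p)\<^sup>2 - (cmod q)\<^sup>2) = of_real ((1 - (cmod g2)\<^sup>2) * (1 - (cmod l2)\<^sup>2))"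
    by (simp only: of_real_add of_real_diff of_real_mult of_real_power of_real_cmod_sq of_real_1)
  then have "(cmod p)\<^sup>2 - (cmod q)\<^sup>2 = (1 - (cmod g2)\<^sup>2) * (1 - (cmod l2)\<^sup>2)" using of_real_eq_iff by blast
  also have "\<dots> > 0" using l g by (simp add: abs_square_less_1)
  finally have "(cmod q)\<^sup>2 < (cmod p)\<^sup>2" by simp
  then have qp: "cmod q < cmod p" by (rule power_less_imp_less_base) simp
  then have p0: "p \<noteq> 0" by auto
  define k where "k = q / p"
  define \<tau> where "\<tau> = p / (t * cnj p)"
  have k: "cmod k < 1" using qp p0 by (simp add: k_def norm_divide)
  have t0: "t \<noteq> 0" using t by auto
  have \<tau>: "cmod \<tau> = 1" using t p0 by (simp add: \<tau>_def norm_divide norm_mult)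
  have val: "\<tau> * moeb k u = (p * u - q) / (t * cnj p - t * cnj q * u)" for u
  proof -
    have "u - k = (p * u - q) / p" "1 - cnj k * u = (t * cnj p - t * cnj q * u) / (t * cnj p)"
      using p0 t0 by (simp_all add: k_def diff_divide_distrib)
    then have "\<tau> * moeb k u = p / (t * cnj p) * ((p * u - q) / p / ((t * cnj p - t * cnj q * u) / (t * cnj p)))"
      by (simp add: \<tau>_def moeb_def)
    also have "\<dots> = (p * u - q) / (t * cnj p - t * cnj q * u)" using p0 t0 by simp
    finally show ?thesis .
  qed
  have "1 - l2 * cnj l2 \<noteq> 0" using disc_mult_neq_1[of l2 "cnj l2"] l by simp
  moreover have "p * l2 - q = g2 * (1 - l2 * cnj l2)" "t * cnj p - t * cnj q * l2 = 1 - l2 * cnj l2"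
    unfolding cp by (simp add: p_def q_def algebra_simps, simp add: algebra_simps)
  ultimately have "g2 = \<tau> * moeb k l2" unfolding val by simp
  moreover have "g3 = \<tau> * moeb k l3"
  proof -
    have md: "m * (1 - cnj l2 * l3) = l3 - l2" using e by (simp add: m_def moeb_def)
    have "p * l3 - q = (1 - cnj l2 * l3) * (n + g2)"
      unfolding tm[symmetric] p_def q_def using md by algebra
    moreover have "t * cnj p - t * cnj q * l3 = (1 - cnj l2 * l3) * (1 + cnj g2 * n)"
      unfolding cp tm[symmetric] using md by algebra
    ultimately have "\<tau> * moeb k l3 = (n + g2) / (1 + cnj g2 * n)" unfolding val using e by simp
    also have "\<dots> = moeb (- g2) n" by (simp add: moeb_def)
    also have "\<dots> = g3" unfolding n_def using moeb_moeb[of g2 g3] g by simp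
    finally show ?thesis by simp
  qed
  ultimately show ?thesis using that[OF \<tau> k] by blast
qed

text \<open>A Blaschke product of degree two is a square in suitable coordinates: \<open>e\<close> is its critical point.\<close>

lemma blaschke_square:
  assumes k: "cmod k < 1"
  obtains e where "cmod e < 1"
    "\<And>u. cmod u < 1 \<Longrightarrow> moeb (- (e\<^sup>2)) (u * moeb k u) = (moeb e u)\<^sup>2"
proof -
  define s where "s = sqrt (1 - (cmod k)\<^sup>2)"
  have s: "s > 0" "s\<^sup>2 = 1 - (cmod k)\<^sup>2" using k by (auto simp: s_def abs_square_less_1 abs_square_le_1)
  \<comment> \<open>The hyperbolic midpoint of the two zeros 0 and \<open>k\<close>; the identity
    \<open>K\<close> is the equation for the critical point.\<close>
  define e where "e = k / of_real (1 + s)"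
  have s1: "1 + complex_of_real s \<noteq> 0" using s by (simp add: complex_eq_iff)
  have kk: "k * cnj k = (1 - of_real s) * (1 + of_real s)"
  proof -
    have "k * cnj k = of_real (1 - s\<^sup>2)" by (simp add: s of_real_cmod_sq)
    then show ?thesis by (simp add: power2_eq_square algebra_simps)
  qed
  have "e * cnj e = k * cnj k / ((1 + of_real s) * (1 + of_real s))" by (simp add: e_def)
  then have ee: "e * cnj e = (1 - of_real s) / (1 + of_real s)" unfolding kk using s1 by simp
  have "cmod e = cmod k / (1 + s)" unfolding e_def norm_divide norm_of_real using s by simp
  then have e1: "cmod e < 1" using k s by (simp add: divide_less_eq)
  have ke: "k = e * (1 + of_real s)" using s1 by (simp add: e_def)
  have K: "k + e\<^sup>2 * cnj k = 2 * e"
  proof -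
    have "k + e\<^sup>2 * cnj k = e * (1 + of_real s) * (1 + e * cnj e)" by (simp add: ke power2_eq_square algebra_simps)
    also have "\<dots> = 2 * e" unfolding ee using s1 by (simp add: field_simps)
    finally show ?thesis .
  qed
  have K': "cnj k + (cnj e)\<^sup>2 * k = 2 * cnj e" using arg_cong[OF K, of cnj] by simp
  show thesis
  proof (rule that[OF e1])
    fix u assume u: "cmod u < 1"
    have d: "1 - cnj k * u \<noteq> 0" "1 - cnj e * u \<noteq> 0" using moeb_denom k e1 u by simp_all
    have 1: "u * (u - k) + e\<^sup>2 * (1 - cnj k * u) = (u - e)\<^sup>2" using K by (simp add: power2_eq_square) algebra
    have 2: "1 - cnj k * u + (cnj e)\<^sup>2 * (u * (u - k)) = (1 - cnj e * u)\<^sup>2" using K' by (simp add: power2_eq_square) algebra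
    have "moeb (- (e\<^sup>2)) (u * moeb k u) = (u * (u - k) / (1 - cnj k * u) + e\<^sup>2) / (1 + (cnj e)\<^sup>2 * (u * (u - k) / (1 - cnj k * u)))"
      by (simp add: moeb_def)
    also have "u * (u - k) / (1 - cnj k * u) + e\<^sup>2 = (u - e)\<^sup>2 / (1 - cnj k * u)"
      unfolding 1[symmetric] using d by (simp add: add_divide_distrib)
    also have "1 + (cnj e)\<^sup>2 * (u * (u - k) / (1 - cnj k * u)) = (1 - cnj e * u)\<^sup>2 / (1 - cnj k * u)"
      unfolding 2[symmetric] using d by (simp add: add_divide_distrib)
    also have "(u - e)\<^sup>2 / (1 - cnj k * u) / ((1 - cnj e * u)\<^sup>2 / (1 - cnj k * u)) = (moeb e u)\<^sup>2"
      using d by (simp add: moeb_def power_divide)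
    finally show "moeb (- (e\<^sup>2)) (u * moeb k u) = (moeb e u)\<^sup>2" .
  qed
qed

text \<open>One step of the Schur algorithm: by \<open>reduced_pick_moeb\<close>, the equality
  \<open>eq\<close> means that the quotients \<open>g2\<close>, \<open>g3\<close> attain equality in
  Schwarz-Pick, so the interpolant is a rotated \<open>u * moeb k u\<close>, which changes of
  coordinates turn into a square.\<close>

lemma nonunique_singular:
  fixes z :: "3 \<Rightarrow> complex ^ 'd" and l \<zeta> :: "3 \<Rightarrow> complex"
  assumes d: "CARD('d) \<ge> 2" and z: "\<And>i. norm (z i) < 1" and injz: "inj z"
    and \<zeta>: "\<And>i. cmod (\<zeta> i) < 1" "\<zeta> 1 = 0" and l: "\<And>i. cmod (l i) < 1" "l 1 = 0"
    and P: "psd (pick (gram z) l)" and dom: "pick_dominates (gram z) (cgram \<zeta>)"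
    and lt: "cmod (\<zeta> 2) < cmod (l 2)" "cmod (\<zeta> 3) < cmod (l 3)"
    and eq: "(1 - (cmod (l 2))\<^sup>2) * (1 - (cmod (l 3))\<^sup>2) * (cmod (l 2 * cnj (l 3) - \<zeta> 2 * cnj (\<zeta> 3)))\<^sup>2
      = ((cmod (l 2))\<^sup>2 - (cmod (\<zeta> 2))\<^sup>2) * ((cmod (l 3))\<^sup>2 - (cmod (\<zeta> 3))\<^sup>2) * (cmod (1 - l 2 * cnj (l 3)))\<^sup>2"
  shows "nonunique z \<zeta>"
proof -
  have inj: "inj l" by (rule psd_pick_inj[OF P l(1) injz])
  have l0: "l 2 \<noteq> 0" "l 3 \<noteq> 0" using lt by auto
  define g2 where "g2 = \<zeta> 2 / l 2"
  define g3 where "g3 = \<zeta> 3 / l 3"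
  have g: "cmod g2 < 1" "cmod g3 < 1" using lt by (auto simp: g2_def g3_def norm_divide divide_less_eq)
  have lg: "l 2 * g2 = \<zeta> 2" "l 3 * g3 = \<zeta> 3" using l0 by (auto simp: g2_def g3_def)
  have "(cmod (l 2))\<^sup>2 * (cmod (l 3))\<^sup>2 * (cmod (1 - l 2 * cnj (l 3)))\<^sup>2 * (cmod (1 - g2 * cnj g3))\<^sup>2
      * ((cmod (moeb g2 g3))\<^sup>2 - (cmod (moeb (l 2) (l 3)))\<^sup>2) = 0"
    using reduced_pick_moeb[OF l(1)[of 2] l(1)[of 3] g] eq unfolding lg by simp
  moreover have "1 - l 2 * cnj (l 3) \<noteq> 0" "1 - g2 * cnj g3 \<noteq> 0"
    using disc_mult_neq_1[of "l 2" "cnj (l 3)"] disc_mult_neq_1[of g2 "cnj g3"] l(1)[of 2] l(1)[of 3] g by simp_all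
  ultimately have "(cmod (moeb g2 g3))\<^sup>2 = (cmod (moeb (l 2) (l 3)))\<^sup>2" using l0 by simp
  then have "cmod (moeb g2 g3) = cmod (moeb (l 2) (l 3))" by (rule power2_eq_imp_eq) auto
  moreover have "l 2 \<noteq> l 3" using inj by (simp add: inj_eq)
  ultimately obtain \<tau> k where \<tau>: "cmod \<tau> = 1" "cmod k < 1" "g2 = \<tau> * moeb k (l 2)" "g3 = \<tau> * moeb k (l 3)"
    using blaschke_two_points[OF l(1) _ l(1) g] by metis
  obtain e where e: "cmod e < 1" "\<And>u. cmod u < 1 \<Longrightarrow> moeb (- (e\<^sup>2)) (u * moeb k u) = (moeb e u)\<^sup>2"
    using blaschke_square[OF \<tau>(2)] by blast
  have tt: "cnj \<tau> * \<tau> = 1" using \<tau>(1) by (simp add: mult.commute flip: of_real_cmod_sq)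
  have \<zeta>B: "cnj \<tau> * \<zeta> j = l j * moeb k (l j)" for j
  proof -
    have "cnj \<tau> * (u * (\<tau> * v)) = u * v" for u v using tt by (metis mult.left_commute mult.assoc mult.left_neutral)
    then have "cnj \<tau> * \<zeta> 2 = l 2 * moeb k (l 2)" "cnj \<tau> * \<zeta> 3 = l 3 * moeb k (l 3)" unfolding lg[symmetric] \<tau>(3,4) by simp_all
    then show ?thesis using exhaust_3[of j] l(2) \<zeta>(2) by auto
  qed
  have e2: "cmod (- (e\<^sup>2)) < 1" using e(1) by (simp add: norm_power abs_square_less_1)
  have \<tau>': "cmod (cnj \<tau>) = 1" using \<tau>(1) by simp
  have n1: "cmod (cnj \<tau> * \<zeta> j) < 1" for j using \<zeta>(1) \<tau>(1) by (simp add: norm_mult)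
  have sq: "(\<lambda>j. moeb (- (e\<^sup>2)) (cnj \<tau> * \<zeta> j)) = (\<lambda>j. (moeb e (l j))\<^sup>2)"
    unfolding \<zeta>B using e(2)[OF l(1)] by simp
  show ?thesis
  proof (rule nonunique_rotate[OF \<tau>'], rule nonunique_moeb[OF e2 n1], unfold sq, rule nonunique_critical[OF d z injz])
    show "cmod (moeb e (l i)) < 1" for i by (rule moeb_norm[OF e(1) l(1)])
    show "psd (pick (gram z) (\<lambda>i. moeb e (l i)))" by (rule iffD2[OF pick_moeb_pd(2) P]) (use e l in auto)
    have "pick_dominates (gram z) (cgram (\<lambda>j. cnj \<tau> * \<zeta> j))" using dom cgram_rotate[OF \<tau>'] by simp
    then have "pick_dominates (gauge_mat (\<lambda>i. 1) (gram z)) (gauge_mat (\<lambda>j. moeb_gauge (- (e\<^sup>2)) (cnj \<tau> * \<zeta> j)) (cgram (\<lambda>j. cnj \<tau> * \<zeta> j)))"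
      by (rule iffD2[OF pick_dominates_gauge, rotated 2]) (use moeb_gauge_nz[OF e2 n1] in auto)
    moreover have "gauge_mat (\<lambda>i. 1) (gram z) = gram z" by (simp add: gauge_mat_def fun_eq_iff)
    ultimately show "pick_dominates (gram z) (cgram (\<lambda>i. (moeb e (l i))\<^sup>2))"
      unfolding sq[symmetric] cgram_moeb[OF e2 n1] by simp
  qed
qed

section \<open>Schwarz-Pick inequalities and necessity of the conditions\<close>

lemma ballaut_disc_holomorphic:
  assumes p: "norm p < 1" and c: "c holomorphic_on S" and n: "\<And>t. t \<in> S \<Longrightarrow> norm (c t *s V) < 1"
  shows "(\<lambda>t. ballaut p (c t *s V) $ i) holomorphic_on S"
proof -
  have "1 - c t * cip V p \<noteq> 0" if "t \<in> S" for t
    using cip_neq_1[OF n[OF that] p] by (simp add: cip_scale_left)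
  moreover have "1 + complex_of_real (sqrt (1 - (norm p)\<^sup>2)) \<noteq> 0"
  proof -
    have "sqrt (1 - (norm p)\<^sup>2) \<ge> 0" using p by (simp add: abs_square_le_1)
    then have "1 + sqrt (1 - (norm p)\<^sup>2) \<noteq> 0" by linarith
    then show ?thesis by (metis of_real_1 of_real_add of_real_eq_0_iff)
  qed
  ultimately show ?thesis
    unfolding ballaut_def Let_def cip_scale_left by (auto intro!: holomorphic_intros c)
qed

lemma schwarz_pick_disc:
  assumes h: "h holomorphic_on ball 0 1" "\<And>z. cmod z < 1 \<Longrightarrow> cmod (h z) < 1" and ab: "cmod a < 1" "cmod b < 1"
  shows "cmod (moeb (h a) (h b)) \<le> cmod (moeb a b)"
proof -
  define u where "u \<xi> = moeb (h a) (h (moeb (- a) \<xi>))" for \<xi>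
  have a: "cmod (- a) < 1" using ab by simp
  have im: "moeb (- a) ` ball 0 1 \<subseteq> ball 0 1" using moeb_norm[OF a] by auto
  have "(h \<circ> moeb (- a)) holomorphic_on ball 0 1"
    by (rule holomorphic_on_compose_gen[OF moeb_holomorphic[OF a] h(1) im])
  then have "(moeb (h a) \<circ> (h \<circ> moeb (- a))) holomorphic_on ball 0 1"
    by (rule holomorphic_on_compose_gen[OF _ moeb_holomorphic[OF h(2)[OF ab(1)]]]) (use im h(2) in auto)
  then have "u holomorphic_on ball 0 1" by (simp add: u_def[abs_def] comp_def)
  moreover have "u 0 = 0" by (simp add: u_def moeb_def)
  moreover have "cmod (u \<xi>) < 1" if "cmod \<xi> < 1" for \<xi>
    unfolding u_def by (intro moeb_norm h ab a that)
  ultimately have "cmod (u (moeb a b)) \<le> cmod (moeb a b)"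
    by (rule Schwarz_Lemma(1)) (assumption | rule moeb_norm[OF ab])+
  then show ?thesis unfolding u_def using moeb_moeb[of a b] ab by simp
qed

text \<open>Write \<open>F z = z * h z\<close> and apply the two-point inequality to
  \<open>h\<close>; rotations, where \<open>h\<close> has modulus 1, are treated apart.\<close>

lemma schwarz_pick_three:
  assumes F: "F holomorphic_on ball 0 1" "\<And>z. cmod z < 1 \<Longrightarrow> cmod (F z) < 1" and F0: "F 0 = 0"
    and l: "cmod l2 < 1" "cmod l3 < 1" "l2 \<noteq> 0" "l3 \<noteq> 0"
  shows "cmod (F l2) \<le> cmod l2" "cmod (F l3) \<le> cmod l3"
    and "(1 - (cmod l2)\<^sup>2) * (1 - (cmod l3)\<^sup>2) * (cmod (l2 * cnj l3 - F l2 * cnj (F l3)))\<^sup>2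
      \<le> ((cmod l2)\<^sup>2 - (cmod (F l2))\<^sup>2) * ((cmod l3)\<^sup>2 - (cmod (F l3))\<^sup>2) * (cmod (1 - l2 * cnj l3))\<^sup>2"
proof -
  show le: "cmod (F l2) \<le> cmod l2" "cmod (F l3) \<le> cmod l3"
    using Schwarz_Lemma(1)[OF F(1) F0 F(2)] l by auto
  show "(1 - (cmod l2)\<^sup>2) * (1 - (cmod l3)\<^sup>2) * (cmod (l2 * cnj l3 - F l2 * cnj (F l3)))\<^sup>2
      \<le> ((cmod l2)\<^sup>2 - (cmod (F l2))\<^sup>2) * ((cmod l3)\<^sup>2 - (cmod (F l3))\<^sup>2) * (cmod (1 - l2 * cnj l3))\<^sup>2"
  proof (cases "(\<exists>z. norm z < 1 \<and> z \<noteq> 0 \<and> norm (F z) = norm z) \<or> norm (deriv F 0) = 1")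
    case True
    then obtain \<alpha> where \<alpha>: "\<forall>z. norm z < 1 \<longrightarrow> F z = \<alpha> * z" "norm \<alpha> = 1"
      using Schwarz_Lemma(3)[OF F(1) F0 F(2), of 0] by auto
    have "\<alpha> * cnj \<alpha> = 1" using \<alpha>(2) by (simp flip: of_real_cmod_sq)
    moreover have "F l2 * cnj (F l3) = \<alpha> * cnj \<alpha> * (l2 * cnj l3)" using \<alpha>(1) l by (simp add: mult_ac)
    ultimately have e: "F l2 * cnj (F l3) = l2 * cnj l3" by simp
    have "cmod (F l2) = cmod l2" using \<alpha> l by (simp add: norm_mult)
    then show ?thesis unfolding e by simp
  next
    case False
    obtain h where h: "h holomorphic_on ball 0 1" "\<And>z. norm z < 1 \<Longrightarrow> F z = z * h z" "deriv F 0 = h 0"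
      by (rule Schwarz3[OF F(1) F0]) auto
    have h1: "cmod (h z) < 1" if z: "cmod z < 1" for z
    proof (cases "z = 0")
      case True
      then show ?thesis using False h(3) Schwarz_Lemma(2)[OF F(1) F0 F(2), of 0] by auto
    next
      case nz: False
      have "cmod (F z) \<le> cmod z" by (rule Schwarz_Lemma(1)[OF F(1) F0 F(2) z])
      moreover have "cmod (F z) \<noteq> cmod z" using False z nz by blast
      ultimately show ?thesis using h(2)[OF z] nz by (simp add: norm_mult)
    qed
    have "(cmod (moeb (h l2) (h l3)))\<^sup>2 \<le> (cmod (moeb l2 l3))\<^sup>2"
      by (rule power_mono[OF schwarz_pick_disc[OF h(1) h1 l(1,2)]]) auto
    then have "(cmod l2)\<^sup>2 * (cmod l3)\<^sup>2 * (cmod (1 - l2 * cnj l3))\<^sup>2 * (cmod (1 - h l2 * cnj (h l3)))\<^sup>2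
      * ((cmod (moeb (h l2) (h l3)))\<^sup>2 - (cmod (moeb l2 l3))\<^sup>2) \<le> 0"
      by (intro mult_nonneg_nonpos) auto
    then show ?thesis unfolding h(2)[OF l(1)] h(2)[OF l(2)]
      using reduced_pick_moeb[OF l(1,2) h1[OF l(1)] h1[OF l(2)]] by simp
  qed
qed

text \<open>Restriction of \<open>f\<close> to the disc through \<open>p\<close> and
  \<open>q\<close>, the image under \<open>ballaut p\<close> of a straight disc through 0.\<close>

lemma schwarz_pick_ball:
  assumes f: "cn_holomorphic_on f (ball 0 1)" "\<And>w. norm w < 1 \<Longrightarrow> cmod (f w) < 1" and pq: "norm p < 1" "norm q < 1"
  shows "cmod (moeb (f p) (f q)) \<le> norm (ballaut p q)"
proof (cases "ballaut p q = 0")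
  case True
  then have "q = p" using ballaut_ballaut[OF pq(1) cip_neq_1[OF pq(2,1)]] by (simp add: ballaut_0)
  then show ?thesis by simp
next
  case False
  define V where "V = ballaut p q"
  define r where "r = norm V"
  have r: "0 < r" "r < 1" using False ballaut_norm[OF pq] by (auto simp: r_def V_def)
  define \<phi> where "\<phi> t = ballaut p ((t / of_real r) *s V)" for t
  have nV: "norm ((t / of_real r) *s V) = cmod t" for t using r by (simp add: norm_cscale norm_divide flip: r_def)
  have \<phi>n: "norm (\<phi> t) < 1" if "cmod t < 1" for t
    unfolding \<phi>_def by (rule ballaut_norm[OF pq(1)]) (simp add: nV that)
  have "(\<lambda>t. \<phi> t $ i) holomorphic_on ball 0 1" for i
    unfolding \<phi>_def by (rule ballaut_disc_holomorphic[OF pq(1)]) (auto simp: nV intro!: holomorphic_intros r less_imp_neq[THEN not_sym])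
  then have "(\<lambda>t. f (\<phi> t)) holomorphic_on ball 0 1"
    by (intro holomorphic_on_compose_disc[OF f(1)]) (use \<phi>n in auto)
  then have "cmod (moeb (f (\<phi> 0)) (f (\<phi> (of_real r)))) \<le> cmod (moeb 0 (of_real r))"
    by (rule schwarz_pick_disc) (use f \<phi>n r in auto)
  moreover have "\<phi> 0 = p" by (simp add: \<phi>_def ballaut_0)
  moreover have "\<phi> (of_real r) = q" unfolding \<phi>_def V_def using r ballaut_ballaut[OF pq(1) cip_neq_1[OF pq(2,1)]] by simp
  ultimately show ?thesis using r by (simp add: r_def V_def)
qed

lemma pair_gap_nonneg:
  assumes f: "solves z \<zeta> f" and z: "\<And>i. norm (z i) < 1"
  shows "0 \<le> pair_gap z \<zeta> i j"
proof -
  have f': "cn_holomorphic_on f (ball 0 1)" "\<And>w. norm w < 1 \<Longrightarrow> cmod (f w) < 1" "\<And>j. f (z j) = \<zeta> j"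
    using f by (auto simp: solves_def)
  have \<zeta>: "cmod (\<zeta> j) < 1" for j using f'(2)[OF z] f'(3) by metis
  have "cmod (moeb (\<zeta> i) (\<zeta> j)) \<le> norm (ballaut (z i) (z j))"
    using schwarz_pick_ball[OF f'(1,2) z z, of i j] by (simp add: f'(3))
  then have le: "(cmod (moeb (\<zeta> i) (\<zeta> j)))\<^sup>2 \<le> (norm (ballaut (z i) (z j)))\<^sup>2" by (intro power_mono) auto
  define P where "P = (cmod (1 - cip (z i) (z j)))\<^sup>2"
  define Q where "Q = (cmod (1 - \<zeta> i * cnj (\<zeta> j)))\<^sup>2"
  have P: "P > 0" "Q > 0" using cip_neq_1[OF z z, of i j] disc_mult_neq_1[of "\<zeta> i" "cnj (\<zeta> j)"] \<zeta>[of i] \<zeta>[of j]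
    by (auto simp: P_def Q_def)
  have "cmod (1 - cip (z j) (z i)) = cmod (1 - cip (z i) (z j))"
    using complex_mod_cnj[of "1 - cip (z i) (z j)"] by (simp add: cnj_cip del: complex_mod_cnj)
  then have 1: "(1 - (norm (z i))\<^sup>2) * (1 - (norm (z j))\<^sup>2) = (1 - (norm (ballaut (z i) (z j)))\<^sup>2) * P"
    using P by (simp add: ballaut_norm_sq[OF z z] P_def)
  have "cmod (1 - cnj (\<zeta> i) * \<zeta> j) = cmod (1 - \<zeta> i * cnj (\<zeta> j))"
    using complex_mod_cnj[of "1 - \<zeta> i * cnj (\<zeta> j)"] by (simp del: complex_mod_cnj)
  then have 2: "(1 - (cmod (\<zeta> i))\<^sup>2) * (1 - (cmod (\<zeta> j))\<^sup>2) = (1 - (cmod (moeb (\<zeta> i) (\<zeta> j)))\<^sup>2) * Q"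
    using P by (simp add: moeb_norm_sq[OF \<zeta> less_imp_le[OF \<zeta>]] Q_def)
  have "pair_gap z \<zeta> i j = ((norm (ballaut (z i) (z j)))\<^sup>2 - (cmod (moeb (\<zeta> i) (\<zeta> j)))\<^sup>2) * (P * Q)"
    unfolding pair_gap_def P_def[symmetric] Q_def[symmetric] 1 2 by (simp add: algebra_simps)
  then show ?thesis using le P by simp
qed

text \<open>A positive definite Pick matrix yields a disc \<open>t \<mapsto> t \<psi>(t)\<close> through the points, where \<open>\<psi>\<close> interpolates
  \<open>z\<^sub>i / l\<^sub>i\<close>; composing with a solution gives the scalar Pick condition.\<close>

lemma solves_pick_dominates:
  assumes f: "solves z \<zeta> f" and z: "\<And>i. norm (z i) < 1" and z1: "z 1 = 0" "\<zeta> 1 = 0"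
  shows "pick_dominates (gram z) (cgram \<zeta>)"
  unfolding pick_dominates_def
proof (intro allI impI)
  fix l0 :: "3 \<Rightarrow> complex" assume l0: "\<forall>i. cmod (l0 i) < 1" and pd0: "pd (pick (gram z) l0)"
  define l where "l i = moeb (l0 1) (l0 i)" for i
  have l: "cmod (l i) < 1" for i unfolding l_def using l0 by (intro moeb_norm) auto
  have l1: "l 1 = 0" by (simp add: l_def)
  have f': "cn_holomorphic_on f (ball 0 1)" "\<And>w. norm w < 1 \<Longrightarrow> cmod (f w) < 1" "\<And>j. f (z j) = \<zeta> j"
    using f by (auto simp: solves_def)
  have "pd (pick (gram z) l)" unfolding l_def by (rule iffD2[OF pick_moeb_pd(1) pd0]) (use l0 in auto)
  then have pd: "(norm (z 2))\<^sup>2 < (cmod (l 2))\<^sup>2" "(norm (z 3))\<^sup>2 < (cmod (l 3))\<^sup>2"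
    "(1 - (cmod (l 2))\<^sup>2) * (1 - (cmod (l 3))\<^sup>2) * (cmod (l 2 * cnj (l 3) - cip (z 2) (z 3)))\<^sup>2
      < ((cmod (l 2))\<^sup>2 - (norm (z 2))\<^sup>2) * ((cmod (l 3))\<^sup>2 - (norm (z 3))\<^sup>2) * (cmod (1 - l 2 * cnj (l 3)))\<^sup>2"
    using pick_reduced(1)[where G = "gram z" and A = "(norm (z 2))\<^sup>2" and B = "(norm (z 3))\<^sup>2" and m = "cip (z 2) (z 3)" and l = l]
      l l1 by (simp_all add: gram_def z1 cip_self cnj_cip)
  have lz: "norm (z 2) < cmod (l 2)" "norm (z 3) < cmod (l 3)" using pd(1,2) by (auto intro: power_less_imp_less_base)
  have ln: "l 2 \<noteq> 0" "l 3 \<noteq> 0" using lz by auto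
  define a where "a = (1 / l 2) *s z 2"
  define b where "b = (1 / l 3) *s z 3"
  have ab: "z 2 = l 2 *s a" "z 3 = l 3 *s b" using ln by (auto simp: a_def b_def vec_eq_iff)
  have na: "norm a < 1" "norm b < 1" using lz by (auto simp: a_def b_def norm_cscale norm_divide divide_less_eq)
  define V where "V = ballaut a b"
  define m where "m = moeb (l 2) (l 3)"
  \<comment> \<open>With the common zero at node 0 divided out, the strict Pick inequality compares
    the distance of \<open>a\<close> and \<open>b\<close> with that of their nodes.\<close>
  have Vm: "norm V < cmod m"
  proof -
    define N where "N = (cmod (1 - cip a b))\<^sup>2"
    define W where "W = (cmod (1 - l 2 * cnj (l 3)))\<^sup>2"
    have N: "N > 0" using cip_neq_1[OF na] by (simp add: N_def)
    have W: "W > 0" using disc_mult_neq_1[of "l 2" "cnj (l 3)"] l[of 2] l[of 3] by (simp add: W_def)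
    have c1: "cmod (1 - cip b a) = cmod (1 - cip a b)"
      using complex_mod_cnj[of "1 - cip a b"] by (simp add: cnj_cip del: complex_mod_cnj)
    have c2: "cmod (1 - cnj (l 2) * l 3) = cmod (1 - l 2 * cnj (l 3))"
      using complex_mod_cnj[of "1 - l 2 * cnj (l 3)"] by (simp del: complex_mod_cnj)
    have 1: "(1 - (cmod (l 2))\<^sup>2) * (1 - (cmod (l 3))\<^sup>2) = (1 - (cmod m)\<^sup>2) * W"
      unfolding m_def using W l by (simp add: moeb_norm_sq less_imp_le c2 W_def)
    have 2: "(1 - (norm a)\<^sup>2) * (1 - (norm b)\<^sup>2) = (1 - (norm V)\<^sup>2) * N"
      unfolding V_def using N by (simp add: ballaut_norm_sq[OF na] c1 N_def)
    define K where "K = (cmod (l 2))\<^sup>2 * (cmod (l 3))\<^sup>2"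
    have K: "K > 0" using ln by (simp add: K_def)
    have "l 2 * cnj (l 3) - cip (z 2) (z 3) = l 2 * cnj (l 3) * (1 - cip a b)"
      unfolding ab by (simp add: cip_simps algebra_simps)
    then have 3: "(cmod (l 2 * cnj (l 3) - cip (z 2) (z 3)))\<^sup>2 = K * N"
      by (simp add: norm_mult power_mult_distrib K_def N_def)
    have 4: "((cmod (l 2))\<^sup>2 - (norm (z 2))\<^sup>2) * ((cmod (l 3))\<^sup>2 - (norm (z 3))\<^sup>2) = K * ((1 - (norm a)\<^sup>2) * (1 - (norm b)\<^sup>2))"
      unfolding ab norm_cscale power_mult_distrib K_def by (simp add: algebra_simps)
    have "(K * N * W) * (1 - (cmod m)\<^sup>2) < (K * N * W) * (1 - (norm V)\<^sup>2)"
      using pd(3) unfolding 1 3 4 2 W_def[symmetric] by (simp add: mult_ac)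
    then have "1 - (cmod m)\<^sup>2 < 1 - (norm V)\<^sup>2" using K N W by (simp add: mult_less_cancel_left)
    then have "(norm V)\<^sup>2 < (cmod m)\<^sup>2" by simp
    then show ?thesis by (rule power_less_imp_less_base) simp
  qed
  then have m0: "m \<noteq> 0" by auto
  \<comment> \<open>Equal to \<open>a\<close> at \<open>l 2\<close> and to \<open>b\<close> at
    \<open>l 3\<close>; \<open>Vm\<close> keeps the argument of \<open>ballaut a\<close> in the
    ball.\<close>
  define \<psi> where "\<psi> t = ballaut a ((moeb (l 2) t / m) *s V)" for t
  have arg: "norm ((moeb (l 2) t / m) *s V) < 1" if "cmod t < 1" for t
  proof -
    have "cmod (moeb (l 2) t) < 1" by (rule moeb_norm[OF l that])
    moreover have "norm V / cmod m < 1" using Vm m0 by (simp add: divide_less_eq)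
    ultimately have "cmod (moeb (l 2) t) * (norm V / cmod m) < 1"
      using mult_strict_mono'[of "cmod (moeb (l 2) t)" 1 "norm V / cmod m" 1] by simp
    then show ?thesis by (simp add: norm_cscale norm_divide)
  qed
  have \<psi>n: "norm (\<psi> t) < 1" if "cmod t < 1" for t unfolding \<psi>_def by (rule ballaut_norm[OF na(1) arg[OF that]])
  have \<psi>h: "(\<lambda>t. \<psi> t $ i) holomorphic_on ball 0 1" for i
    unfolding \<psi>_def by (rule ballaut_disc_holomorphic[OF na(1)]) (use arg m0 l moeb_holomorphic in \<open>auto intro!: holomorphic_intros\<close>)
  define \<phi> where "\<phi> t = t *s \<psi> t" for t
  have \<phi>n: "norm (\<phi> t) < 1" if "cmod t < 1" for t
    using mult_strict_mono'[of "cmod t" 1 "norm (\<psi> t)" 1] \<psi>n[OF that] that unfolding \<phi>_def norm_cscale by simp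
  have hol: "(\<lambda>t. f (\<phi> t)) holomorphic_on ball 0 1"
    by (rule holomorphic_on_compose_disc[OF f'(1)]) (use \<phi>n \<psi>h in \<open>auto simp: \<phi>_def intro!: holomorphic_intros\<close>)
  have "\<phi> 0 = z 1" by (simp add: \<phi>_def z1)
  moreover have "\<phi> (l 2) = z 2" by (simp add: \<phi>_def \<psi>_def ballaut_0 ab)
  moreover have "\<psi> (l 3) = b"
    unfolding \<psi>_def m_def[symmetric] using m0 ballaut_ballaut[OF na(1) cip_neq_1[OF na(2,1)]] by (simp add: V_def)
  then have "\<phi> (l 3) = z 3" by (simp add: \<phi>_def ab)
  ultimately have vals: "f (\<phi> 0) = 0" "f (\<phi> (l 2)) = \<zeta> 2" "f (\<phi> (l 3)) = \<zeta> 3"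
    using f'(3)[of 1] f'(3)[of 2] f'(3)[of 3] z1(2) by simp_all
  have fb: "cmod (f (\<phi> t)) < 1" if "cmod t < 1" for t by (rule f'(2)[OF \<phi>n[OF that]])
  note sp = schwarz_pick_three[OF hol fb vals(1) l l ln, unfolded vals]
  have "(cmod (\<zeta> 2))\<^sup>2 \<le> (cmod (l 2))\<^sup>2" "(cmod (\<zeta> 3))\<^sup>2 \<le> (cmod (l 3))\<^sup>2"
    using sp(1,2) by (auto intro: power_mono)
  then have "psd (pick (cgram \<zeta>) l)"
    using pick_reduced(2)[where G = "cgram \<zeta>" and A = "(cmod (\<zeta> 2))\<^sup>2" and B = "(cmod (\<zeta> 3))\<^sup>2" and m = "\<zeta> 2 * cnj (\<zeta> 3)" and l = l]
      sp(3) l l1 by (simp add: cgram_def z1 of_real_cmod_sq mult.commute)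
  then show "psd (pick (cgram \<zeta>) l0)" unfolding l_def[abs_def]
    by (rule iffD1[OF pick_moeb_pd(2), rotated -1]) (use l0 in auto)
qed

section \<open>Scaling to the threshold\<close>

lemma continuous_on_pair_gap: "continuous_on S (\<lambda>t. pair_gap z (\<lambda>k. of_real t * \<zeta> k) i j)"
  unfolding pair_gap_def by (intro continuous_intros)

lemma continuous_on_qform_pick:
  "continuous_on S (\<lambda>t. qform (pick (cgram (\<lambda>k. of_real t * \<zeta> k)) l) v)"
  unfolding qform_def pick_def cgram_def sum_3 divide_inverse by (intro continuous_intros)

text \<open>When no pair of nodes is extremal by itself, the discs that witness the failure of the Pick condition just beyond
  the critical scaling cannot degenerate, so that in the limit they give a singular scalar Pick matrix.\<close>

lemma nonunique_at_threshold:
  fixes z :: "3 \<Rightarrow> complex ^ 'd" and \<zeta> :: "3 \<Rightarrow> complex" and t :: "nat \<Rightarrow> real"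
  assumes d: "CARD('d) \<ge> 2" and z: "\<And>i. norm (z i) < 1" and injz: "inj z" and z1: "z 1 = 0" "\<zeta> 1 = 0"
    and \<zeta>: "\<And>i. cmod (\<zeta> i) < 1"
    and dom: "pick_dominates (gram z) (cgram \<zeta>)"
    and gap: "pair_gap z \<zeta> 1 2 > 0" "pair_gap z \<zeta> 1 3 > 0" "pair_gap z \<zeta> 2 3 > 0"
    and t: "t \<longlonglongrightarrow> 1"
    and tgap: "\<And>n. pair_gap z (\<lambda>k. of_real (t n) * \<zeta> k) 1 2 \<ge> 0" "\<And>n. pair_gap z (\<lambda>k. of_real (t n) * \<zeta> k) 1 3 \<ge> 0"
    and ndom: "\<And>n. \<not> pick_dominates (gram z) (cgram (\<lambda>k. of_real (t n) * \<zeta> k))"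
  shows "nonunique z \<zeta>"
proof -
  define A where "A = (norm (z 2))\<^sup>2"
  define B where "B = (norm (z 3))\<^sup>2"
  define m where "m = cip (z 2) (z 3)"
  define A' where "A' = (cmod (\<zeta> 2))\<^sup>2"
  define B' where "B' = (cmod (\<zeta> 3))\<^sup>2"
  define q where "q = \<zeta> 2 * cnj (\<zeta> 3)"
  have gaps: "A' < A" "B' < B" using gap(1,2) by (simp_all add: pair_gap_def z1 A_def B_def A'_def B'_def)
  have tgaps: "(t n)\<^sup>2 * A' \<le> A" "(t n)\<^sup>2 * B' \<le> B" for n
    using tgap[of n] by (simp_all add: pair_gap_def z1 A_def B_def A'_def B'_def norm_mult power_mult_distrib)
  have "\<exists>l. l 1 = 0 \<and> (\<forall>i. cmod (l i) < 1) \<and> pd (pick (gram z) l) \<and> \<not> psd (pick (cgram (\<lambda>k. of_real (t n) * \<zeta> k)) l)" for n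
  proof -
    obtain l0 where l0: "\<forall>i. cmod (l0 i) < 1" "pd (pick (gram z) l0)" "\<not> psd (pick (cgram (\<lambda>k. of_real (t n) * \<zeta> k)) l0)"
      using ndom[of n] unfolding pick_dominates_def by blast
    define l where "l = (\<lambda>i. moeb (l0 1) (l0 i))"
    have "l 1 = 0" by (simp add: l_def)
    moreover have "cmod (l i) < 1" for i unfolding l_def using l0(1) by (intro moeb_norm) auto
    moreover have "pd (pick (gram z) l)"
      unfolding l_def by (rule iffD2[OF pick_moeb_pd(1) l0(2)]) (use l0(1) in auto)
    moreover have "psd (pick (cgram (\<lambda>k. of_real (t n) * \<zeta> k)) l) \<longleftrightarrow> psd (pick (cgram (\<lambda>k. of_real (t n) * \<zeta> k)) l0)"
      unfolding l_def by (rule pick_moeb_pd(2)) (use l0(1) in auto)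
    ultimately show ?thesis using l0(3) by blast
  qed
  then obtain L where L: "\<And>n. L n 1 = 0" "\<And>n i. cmod (L n i) < 1" "\<And>n. pd (pick (gram z) (L n))"
    "\<And>n. \<not> psd (pick (cgram (\<lambda>k. of_real (t n) * \<zeta> k)) (L n))" by metis
  define x where "x a = (cmod (fst a))\<^sup>2" for a :: "complex \<times> complex"
  define y where "y a = (cmod (snd a))\<^sup>2" for a :: "complex \<times> complex"
  define w where "w a = fst a * cnj (snd a)" for a :: "complex \<times> complex"
  define N where "N n = (L n 2, L n 3)" for n
  have Gz: "gram z 1 j = 1" "gram z j 1 = 1" "gram z 2 2 = of_real (1 - A)" "gram z 3 3 = of_real (1 - B)"
    "gram z 2 3 = 1 - m" "gram z 3 2 = cnj (1 - m)" for j
    by (simp_all add: gram_def z1 A_def B_def m_def cip_self cnj_cip)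
  have Gs: "cgram (\<lambda>k. of_real s * \<zeta> k) 1 j = 1" "cgram (\<lambda>k. of_real s * \<zeta> k) j 1 = 1"
    "cgram (\<lambda>k. of_real s * \<zeta> k) 2 2 = of_real (1 - s\<^sup>2 * A')" "cgram (\<lambda>k. of_real s * \<zeta> k) 3 3 = of_real (1 - s\<^sup>2 * B')"
    "cgram (\<lambda>k. of_real s * \<zeta> k) 2 3 = 1 - of_real (s\<^sup>2) * q" "cgram (\<lambda>k. of_real s * \<zeta> k) 3 2 = cnj (1 - of_real (s\<^sup>2) * q)" for j and s :: real
    by (simp_all add: cgram_def z1 A'_def B'_def q_def of_real_cmod_sq) (simp_all add: power2_eq_square mult_ac)
  have Gs1: "cgram \<zeta> 1 j = 1" "cgram \<zeta> j 1 = 1" "cgram \<zeta> 2 2 = of_real (1 - A')" "cgram \<zeta> 3 3 = of_real (1 - B')"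
    "cgram \<zeta> 2 3 = 1 - q" "cgram \<zeta> 3 2 = cnj (1 - q)" for j
    using Gs[of 1] by simp_all
  have pdL: "A < x (N n)" "B < y (N n)" "(1 - x (N n)) * (1 - y (N n)) * (cmod (w (N n) - m))\<^sup>2
      < (x (N n) - A) * (y (N n) - B) * (cmod (1 - w (N n)))\<^sup>2" for n
    using L(3)[of n] unfolding pick_reduced(1)[where G = "gram z" and l = "L n" and A = A and B = B and m = m, OF Gz L(1) L(2)]
    by (simp_all add: N_def x_def y_def w_def)
  \<comment> \<open>The two diagonal conditions hold by \<open>tgaps\<close>, so it is the
    determinant inequality that fails.\<close>
  have psdL: "(x (N n) - (t n)\<^sup>2 * A') * (y (N n) - (t n)\<^sup>2 * B') * (cmod (1 - w (N n)))\<^sup>2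
      < (1 - x (N n)) * (1 - y (N n)) * (cmod (w (N n) - of_real ((t n)\<^sup>2) * q))\<^sup>2" for n
  proof -
    have "(t n)\<^sup>2 * A' \<le> x (N n)" "(t n)\<^sup>2 * B' \<le> y (N n)" using tgaps[of n] pdL(1,2)[of n] by simp_all
    then show ?thesis
      using L(4)[of n] unfolding pick_reduced(2)[where G = "cgram (\<lambda>k. of_real (t n) * \<zeta> k)" and A = "(t n)\<^sup>2 * A'" and B = "(t n)\<^sup>2 * B'"
        and m = "of_real ((t n)\<^sup>2) * q" and l = "L n", OF Gs L(1) L(2)]
      by (simp add: N_def x_def y_def w_def)
  qed
  have dL: "(1 - x (N n)) * (1 - y (N n)) * (cmod (w (N n) - q))\<^sup>2
      \<le> (x (N n) - A') * (y (N n) - B') * (cmod (1 - w (N n)))\<^sup>2" for n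
  proof -
    have "psd (pick (cgram \<zeta>) (L n))" using dom L(2,3) unfolding pick_dominates_def by blast
    then show ?thesis using pick_reduced(2)[where G = "cgram \<zeta>" and l = "L n" and A = A' and B = B' and m = q, OF Gs1 L(1) L(2)]
      by (simp add: N_def x_def y_def w_def)
  qed
  have xy1: "x (N n) < 1" "y (N n) < 1" for n using L(2) by (auto simp: N_def x_def y_def abs_square_less_1)
  \<comment> \<open>Compactness is available only in the closed bidisc, so limit nodes may lie on
    the unit circle.\<close>
  have "N n \<in> cball 0 1 \<times> cball 0 1" for n using L(2) by (auto simp: N_def less_imp_le)
  moreover have "compact (cball (0 :: complex) 1 \<times> cball (0 :: complex) 1)" by (intro compact_Times compact_cball)
  ultimately obtain a r where a: "strict_mono r" "(N \<circ> r) \<longlonglongrightarrow> a" unfolding compact_def by metis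
  have Nl: "(\<lambda>n. N (r n)) \<longlonglongrightarrow> a" using a(2) by (simp add: comp_def)
  have tl: "(\<lambda>n. t (r n)) \<longlonglongrightarrow> 1" using LIMSEQ_subseq_LIMSEQ[OF t a(1)] by (simp add: comp_def)
  have xl: "(\<lambda>n. x (N (r n))) \<longlonglongrightarrow> x a" and yl: "(\<lambda>n. y (N (r n))) \<longlonglongrightarrow> y a" and wl: "(\<lambda>n. w (N (r n))) \<longlonglongrightarrow> w a"
    unfolding x_def y_def w_def by (intro tendsto_intros Nl)+
  have lim: "A \<le> x a" "B \<le> y a" "x a \<le> 1" "y a \<le> 1"
    by (rule LIMSEQ_le_const[OF xl] LIMSEQ_le_const[OF yl] LIMSEQ_le_const2[OF xl] LIMSEQ_le_const2[OF yl],
        use pdL(1,2) xy1 in \<open>auto simp: less_imp_le\<close>)+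
  have E1: "(\<lambda>n. (1 - x (N (r n))) * (1 - y (N (r n))) * (cmod (w (N (r n)) - m))\<^sup>2) \<longlonglongrightarrow> (1 - x a) * (1 - y a) * (cmod (w a - m))\<^sup>2"
    by (intro tendsto_intros xl yl wl)
  have E2: "(\<lambda>n. (x (N (r n)) - A) * (y (N (r n)) - B) * (cmod (1 - w (N (r n))))\<^sup>2) \<longlonglongrightarrow> (x a - A) * (y a - B) * (cmod (1 - w a))\<^sup>2"
    by (intro tendsto_intros xl yl wl)
  have E3: "(\<lambda>n. (1 - x (N (r n))) * (1 - y (N (r n))) * (cmod (w (N (r n)) - q))\<^sup>2) \<longlonglongrightarrow> (1 - x a) * (1 - y a) * (cmod (w a - q))\<^sup>2"
    by (intro tendsto_intros xl yl wl)
  have E4: "(\<lambda>n. (x (N (r n)) - A') * (y (N (r n)) - B') * (cmod (1 - w (N (r n))))\<^sup>2) \<longlonglongrightarrow> (x a - A') * (y a - B') * (cmod (1 - w a))\<^sup>2"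
    by (intro tendsto_intros xl yl wl)
  have E5: "(\<lambda>n. (x (N (r n)) - (t (r n))\<^sup>2 * A') * (y (N (r n)) - (t (r n))\<^sup>2 * B') * (cmod (1 - w (N (r n))))\<^sup>2)
      \<longlonglongrightarrow> (x a - 1\<^sup>2 * A') * (y a - 1\<^sup>2 * B') * (cmod (1 - w a))\<^sup>2"
    by (intro tendsto_intros xl yl wl tl)
  have E6: "(\<lambda>n. (1 - x (N (r n))) * (1 - y (N (r n))) * (cmod (w (N (r n)) - of_real ((t (r n))\<^sup>2) * q))\<^sup>2)
      \<longlonglongrightarrow> (1 - x a) * (1 - y a) * (cmod (w a - of_real (1\<^sup>2) * q))\<^sup>2"
    by (intro tendsto_intros xl yl wl tl)
  have l1: "(1 - x a) * (1 - y a) * (cmod (w a - m))\<^sup>2 \<le> (x a - A) * (y a - B) * (cmod (1 - w a))\<^sup>2"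
    by (rule LIMSEQ_le[OF E1 E2]) (use pdL(3) in \<open>auto intro: less_imp_le\<close>)
  have l2: "(1 - x a) * (1 - y a) * (cmod (w a - q))\<^sup>2 \<le> (x a - A') * (y a - B') * (cmod (1 - w a))\<^sup>2"
    by (rule LIMSEQ_le[OF E3 E4]) (use dL in auto)
  \<comment> \<open>The reversed inequality, inherited from the violated ones as the scalings tend
    to 1; with \<open>l2\<close> it gives the equality that \<open>nonunique_singular\<close>
    needs.\<close>
  have l3: "(x a - A') * (y a - B') * (cmod (1 - w a))\<^sup>2 \<le> (1 - x a) * (1 - y a) * (cmod (w a - q))\<^sup>2"
    using LIMSEQ_le[OF E5 E6] psdL by (force intro: less_imp_le)
  have pos: "x a - A' > 0" "y a - B' > 0" using lim gaps by simp_all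
  show ?thesis
  proof (cases "x a < 1 \<and> y a < 1")
    case True
    define l :: "3 \<Rightarrow> complex" where "l i = (if i = 1 then 0 else if i = 2 then fst a else snd a)" for i
    have l: "l 1 = 0" "l 2 = fst a" "l 3 = snd a" by (auto simp: l_def)
    have "cmod (fst a) < 1" "cmod (snd a) < 1" using True by (auto simp: x_def y_def abs_square_less_1)
    then have ln: "cmod (l i) < 1" for i using exhaust_3[of i] l by auto
    show ?thesis
    proof (rule nonunique_singular[where z = z and \<zeta> = \<zeta> and l = l, OF d z injz \<zeta> z1(2) ln l(1) _ dom])
      show "psd (pick (gram z) l)"
        using pick_reduced(2)[where G = "gram z" and A = A and B = B and m = m and l = l, OF Gz l(1) ln] lim(1,2) l1
        by (simp add: l x_def y_def w_def)
      have "(cmod (\<zeta> 2))\<^sup>2 < (cmod (l 2))\<^sup>2" "(cmod (\<zeta> 3))\<^sup>2 < (cmod (l 3))\<^sup>2"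
        using pos by (simp_all add: A'_def B'_def x_def y_def l)
      then show "cmod (\<zeta> 2) < cmod (l 2)" "cmod (\<zeta> 3) < cmod (l 3)" by (auto intro: power_less_imp_less_base)
      show "(1 - (cmod (l 2))\<^sup>2) * (1 - (cmod (l 3))\<^sup>2) * (cmod (l 2 * cnj (l 3) - \<zeta> 2 * cnj (\<zeta> 3)))\<^sup>2
        = ((cmod (l 2))\<^sup>2 - (cmod (\<zeta> 2))\<^sup>2) * ((cmod (l 3))\<^sup>2 - (cmod (\<zeta> 3))\<^sup>2) * (cmod (1 - l 2 * cnj (l 3)))\<^sup>2"
        using antisym[OF l2 l3] by (simp add: l x_def y_def w_def A'_def B'_def q_def)
    qed
  next
    case False
    then have "(1 - x a) * (1 - y a) = 0" using lim by auto
    then have "(x a - A') * (y a - B') * (cmod (1 - w a))\<^sup>2 \<le> 0" using l3 by (metis mult_zero_left)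
    \<comment> \<open>If one limit node is on the circle, both are, and they coincide.\<close>
    then have "1 - w a = 0" using mult_pos_pos[OF mult_pos_pos[OF pos], of "(cmod (1 - w a))\<^sup>2"] by (cases "1 - w a = 0") auto
    then have wa: "w a = 1" by simp
    have "x a * y a = (cmod (w a))\<^sup>2" by (simp add: x_def y_def w_def norm_mult power_mult_distrib)
    then have "x a * y a = 1" by (simp add: wa)
    moreover have "0 \<le> x a" "0 \<le> y a" by (auto simp: x_def y_def)
    ultimately have xy: "x a = 1" "y a = 1" using lim(3,4) mult_left_le[of "y a" "x a"] mult_right_le_one_le[of "y a" "x a"] by (auto simp: mult_left_le)
    \<comment> \<open>Multiplying the inequality for the points by the reversed one for the targets
      cancels the degenerating factors \<open>(1 - x) * (1 - y)\<close> and
      \<open>|1 - w|^2\<close>; the limit contradicts the positive gap of points 2 and 3.\<close>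
    have ineq: "(cmod (w (N n) - m))\<^sup>2 * ((x (N n) - (t n)\<^sup>2 * A') * (y (N n) - (t n)\<^sup>2 * B'))
        \<le> (x (N n) - A) * (y (N n) - B) * (cmod (w (N n) - of_real ((t n)\<^sup>2) * q))\<^sup>2" for n
    proof -
      define E where "E = (1 - x (N n)) * (1 - y (N n))"
      define C where "C = (x (N n) - (t n)\<^sup>2 * A') * (y (N n) - (t n)\<^sup>2 * B')"
      define C0 where "C0 = (x (N n) - A) * (y (N n) - B)"
      have E: "E > 0" using xy1[of n] by (simp add: E_def)
      have C: "C \<ge> 0" "C0 \<ge> 0" using pdL(1,2)[of n] tgaps[of n] by (auto simp: C_def C0_def)
      have "E * ((cmod (w (N n) - m))\<^sup>2 * C) = (E * (cmod (w (N n) - m))\<^sup>2) * C" by simp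
      also have "\<dots> \<le> (C0 * (cmod (1 - w (N n)))\<^sup>2) * C"
        by (rule mult_right_mono[OF _ C(1)]) (use pdL(3)[of n] in \<open>simp add: E_def C0_def\<close>)
      also have "\<dots> = C0 * (C * (cmod (1 - w (N n)))\<^sup>2)" by simp
      also have "\<dots> \<le> C0 * (E * (cmod (w (N n) - of_real ((t n)\<^sup>2) * q))\<^sup>2)"
        by (rule mult_left_mono[OF _ C(2)]) (use psdL[of n] in \<open>simp add: E_def C_def\<close>)
      also have "\<dots> = E * (C0 * (cmod (w (N n) - of_real ((t n)\<^sup>2) * q))\<^sup>2)" by simp
      finally show ?thesis unfolding C_def[symmetric] C0_def[symmetric] using E by (rule mult_left_le_imp_le)
    qed
    have F1: "(\<lambda>n. (cmod (w (N (r n)) - m))\<^sup>2 * ((x (N (r n)) - (t (r n))\<^sup>2 * A') * (y (N (r n)) - (t (r n))\<^sup>2 * B')))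
      \<longlonglongrightarrow> (cmod (w a - m))\<^sup>2 * ((x a - 1\<^sup>2 * A') * (y a - 1\<^sup>2 * B'))"
      by (intro tendsto_intros xl yl wl tl)
    have F2: "(\<lambda>n. (x (N (r n)) - A) * (y (N (r n)) - B) * (cmod (w (N (r n)) - of_real ((t (r n))\<^sup>2) * q))\<^sup>2)
      \<longlonglongrightarrow> (x a - A) * (y a - B) * (cmod (w a - of_real (1\<^sup>2) * q))\<^sup>2"
      by (intro tendsto_intros xl yl wl tl)
    have "(cmod (w a - m))\<^sup>2 * ((x a - 1\<^sup>2 * A') * (y a - 1\<^sup>2 * B')) \<le> (x a - A) * (y a - B) * (cmod (w a - of_real (1\<^sup>2) * q))\<^sup>2"
      by (rule LIMSEQ_le[OF F1 F2]) (use ineq in auto)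
    then have "(cmod (1 - m))\<^sup>2 * ((1 - A') * (1 - B')) \<le> (1 - A) * (1 - B) * (cmod (1 - q))\<^sup>2" by (simp add: xy wa)
    then have "pair_gap z \<zeta> 2 3 \<le> 0" by (simp add: pair_gap_def A_def B_def A'_def B'_def m_def q_def mult_ac)
    then show ?thesis using gap(3) by simp
  qed
qed

text \<open>Scale the targets up to the largest factor \<open>T\<close> that all necessary conditions allow. The scaled problem has two
  solutions; extremality forces \<open>T = 1\<close>.\<close>

lemma nonunique_extremal_0:
  fixes z :: "3 \<Rightarrow> complex ^ 'd" and \<zeta> :: "3 \<Rightarrow> complex"
  assumes d: "CARD('d) \<ge> 2" and z: "\<And>i. norm (z i) < 1" and injz: "inj z" and z1: "z 1 = 0" "\<zeta> 1 = 0"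
    and f: "solves z \<zeta> f"
    and ext: "\<And>F r. r < 1 \<Longrightarrow> cn_holomorphic_on F (ball 0 1) \<Longrightarrow> (\<And>w. norm w < 1 \<Longrightarrow> cmod (F w) \<le> r) \<Longrightarrow> (\<And>j. F (z j) = \<zeta> j) \<Longrightarrow> False"
  shows "nonunique z \<zeta>"
proof -
  define Z where "Z t = (\<lambda>k. of_real t * \<zeta> k)" for t :: real
  \<comment> \<open>The pair inequalities are imposed beside domination because their tightness at
    the threshold selects the case.\<close>
  define S where "S = {t. 1 \<le> t \<and> (\<forall>i j. i \<noteq> j \<longrightarrow> 0 \<le> pair_gap z (Z t) i j) \<and> pick_dominates (gram z) (cgram (Z t))}"
  have Z1: "Z 1 = \<zeta>" by (simp add: Z_def)
  have "1 \<in> S" unfolding S_def using pair_gap_nonneg[OF f z] solves_pick_dominates[OF f z z1] by (simp add: Z1)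
  have "closed S"
    unfolding S_def pick_dominates_def psd_def Z_def
    by (intro closed_Collect_conj closed_Collect_all closed_Collect_imp open_Collect_const closed_Collect_le
        continuous_intros continuous_on_pair_gap continuous_on_qform_pick)
  \<comment> \<open>Targets that are all 0 are met by the constant 0, against extremality; a nonzero
    target bounds \<open>S\<close>.\<close>
  obtain i where i: "\<zeta> i \<noteq> 0"
  proof (rule ccontr)
    assume "\<not> thesis"
    then have "\<zeta> j = 0" for j using that by blast
    then show False using ext[of 0 "\<lambda>w. 0"] by (simp add: cn_holomorphic_on_const)
  qed
  have small: "cmod (Z t j) \<le> norm (z j)" if "t \<in> S" for t j
  proof (cases "j = 1")
    case False
    then have "0 \<le> pair_gap z (Z t) 1 j" using that unfolding S_def by auto
    then have "(cmod (Z t j))\<^sup>2 \<le> (norm (z j))\<^sup>2" by (simp add: pair_gap_def z1 Z_def)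
    then show ?thesis by (rule power2_le_imp_le) simp
  qed (simp add: Z_def z1)
  have bdd: "bdd_above S"
  proof (rule bdd_aboveI)
    fix t assume t: "t \<in> S"
    then have "t * cmod (\<zeta> i) \<le> 1" using small[OF t, of i] z[of i] by (simp add: Z_def norm_mult S_def)
    then show "t \<le> 1 / cmod (\<zeta> i)" using i by (simp add: le_divide_eq)
  qed
  define T where "T = Sup S"
  have TS: "T \<in> S" unfolding T_def using closed_contains_Sup[OF _ bdd \<open>closed S\<close>] \<open>1 \<in> S\<close> by blast
  have T1: "T \<ge> 1" using TS by (simp add: S_def)
  have domT: "pick_dominates (gram z) (cgram (Z T))" using TS by (simp add: S_def)
  have ZT: "cmod (Z T j) < 1" for j using small[OF TS, of j] z[of j] by simp
  have NT: "nonunique z (Z T)"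
  proof (cases "\<exists>i j. i \<noteq> j \<and> pair_gap z (Z T) i j = 0")
    case True
    then show ?thesis using nonunique_degenerate[OF d z ZT injz _ _ domT] by blast
  next
    case False
    then have gT: "pair_gap z (Z T) i j > 0" if "i \<noteq> j" for i j using TS that unfolding S_def by force
    have tend: "((\<lambda>t. pair_gap z (Z t) i j) \<longlongrightarrow> pair_gap z (Z T) i j) (at_right T)" for i j
      using continuous_on_pair_gap[of UNIV z \<zeta> i j, folded Z_def] by (simp add: continuous_on_def) (metis tendsto_within_subset top_greatest)
    have "eventually (\<lambda>t. \<forall>i\<in>UNIV. \<forall>j\<in>UNIV. i \<noteq> j \<longrightarrow> 0 < pair_gap z (Z t) i j) (at_right T)"
    proof (intro eventually_ball_finite ballI)
      fix i j :: 3
      show "eventually (\<lambda>t. i \<noteq> j \<longrightarrow> 0 < pair_gap z (Z t) i j) (at_right T)"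
        by (cases "i = j") (use order_tendstoD(1)[OF tend gT] in auto)
    qed auto
    then obtain b where b: "b > T" "\<And>t i j. T < t \<Longrightarrow> t < b \<Longrightarrow> i \<noteq> j \<Longrightarrow> 0 < pair_gap z (Z t) i j"
      unfolding eventually_at_right_field by auto
    \<comment> \<open>Scalings tending to \<open>T\<close> from above, within the interval where the
      gaps stay positive; each lies outside \<open>S\<close>, and only domination can be what
      fails.\<close>
    define t where "t n = T + (b - T) * inverse (real (Suc (Suc n)))" for n
    have t: "T < t n" "t n < b" for n
    proof -
      have "0 < (b - T) * inverse (real (Suc (Suc n)))" using b by simp
      moreover have "(b - T) * inverse (real (Suc (Suc n))) < (b - T) * 1"
        by (rule mult_strict_left_mono) (use b in \<open>auto simp: inverse_less_1_iff\<close>)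
      ultimately show "T < t n" "t n < b" by (simp_all add: t_def)
    qed
    have "t \<longlonglongrightarrow> T + (b - T) * 0"
      unfolding t_def by (intro tendsto_intros LIMSEQ_Suc[OF LIMSEQ_inverse_real_of_nat])
    then have "(\<lambda>n. t n / T) \<longlonglongrightarrow> T / T" using T1 by (intro tendsto_intros) auto
    then have tT: "(\<lambda>n. t n / T) \<longlonglongrightarrow> 1" using T1 by simp
    have resc: "(\<lambda>k. of_real (t n / T) * Z T k) = Z (t n)" for n using T1 by (simp add: Z_def fun_eq_iff)
    show ?thesis
    proof (rule nonunique_at_threshold[OF d z injz z1(1) _ ZT domT _ _ _ tT], unfold resc)
      show "Z T 1 = 0" by (simp add: Z_def z1)
      show "\<not> pick_dominates (gram z) (cgram (Z (t n)))" for n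
      proof
        assume "pick_dominates (gram z) (cgram (Z (t n)))"
        then have "t n \<in> S" using t[of n] T1 b(2)[OF t] unfolding S_def by (auto intro: less_imp_le)
        then have "t n \<le> T" unfolding T_def by (rule cSup_upper[OF _ bdd])
        then show False using t[of n] by simp
      qed
    qed (use gT b(2)[OF t] in \<open>auto intro: less_imp_le\<close>)
  qed
  have "T = 1"
  proof (rule ccontr)
    assume "T \<noteq> 1"
    then have "T > 1" using T1 by simp
    obtain F where F: "solves z (Z T) F" using NT unfolding nonunique_def by blast
    show False
    proof (rule ext[of "1 / T" "\<lambda>w. of_real (1 / T) * F w"])
      show "1 / T < 1" using \<open>T > 1\<close> by simp
      show "cn_holomorphic_on (\<lambda>w. of_real (1 / T) * F w) (ball 0 1)"
        using F by (intro cn_holomorphic_intros) (simp add: solves_def)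
      show "cmod (of_real (1 / T) * F w) \<le> 1 / T" if "norm w < 1" for w
      proof -
        have "cmod (F w) \<le> 1" using F that by (simp add: solves_def less_imp_le)
        then show ?thesis using \<open>T > 1\<close> unfolding norm_mult norm_of_real by (simp add: divide_right_mono)
      qed
      show "of_real (1 / T) * F (z j) = \<zeta> j" for j using F \<open>T > 1\<close> by (simp add: solves_def Z_def)
    qed
  qed
  then show ?thesis using NT Z1 by simp
qed

theorem theorem2p2:
  fixes z :: "nat \<Rightarrow> complex ^ 'd" and \<zeta> :: "nat \<Rightarrow> complex"
  assumes "CARD('d) \<ge> 2"
    and "\<And>j. j \<in> {1..3} \<Longrightarrow> z j \<in> ball 0 1"
    and "inj_on z {1..3}"
    and "\<And>j. j \<in> {1..3} \<Longrightarrow> \<zeta> j \<in> ball 0 1"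
    and "np_extremal 3 z \<zeta>"
  shows "\<exists>f g. np_solution 3 z \<zeta> f \<and> np_solution 3 z \<zeta> g \<and> (\<exists>w\<in>ball 0 1. f w \<noteq> g w)"
proof -
  \<comment> \<open>In the type \<open>3\<close> the numeral 3 is 0, so the indices are matched by
    cases.\<close>
  define \<nu> :: "3 \<Rightarrow> nat" where "\<nu> i = (if i = 1 then 1 else if i = 2 then 2 else 3)" for i
  have \<nu>: "\<nu> 1 = 1" "\<nu> 2 = 2" "\<nu> 3 = 3" by (auto simp: \<nu>_def)
  have \<nu>I: "\<nu> i \<in> {1..3}" for i by (auto simp: \<nu>_def)
  have ball3: "(\<forall>j\<in>{1..3}. P j) \<longleftrightarrow> (\<forall>i. P (\<nu> i))" for P
  proof -
    have "{1..3::nat} = {1, 2, 3}" by auto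
    then show ?thesis by (simp add: forall_3 \<nu>)
  qed
  define z3 where "z3 i = z (\<nu> i)" for i
  define \<zeta>3 where "\<zeta>3 i = \<zeta> (\<nu> i)" for i
  have sol: "np_solution 3 z \<zeta> f \<longleftrightarrow> solves z3 \<zeta>3 f" for f
    unfolding np_solution_def solves_def ball3 z3_def \<zeta>3_def by (auto simp: image_subset_iff)
  have z3: "norm (z3 i) < 1" and \<zeta>3: "cmod (\<zeta>3 i) < 1" for i
    using assms(2,4)[OF \<nu>I] by (simp_all add: z3_def \<zeta>3_def)
  have "inj \<nu>" unfolding inj_def forall_3 \<nu> by simp
  then have inj3: "inj z3" using assms(3) \<nu>I unfolding z3_def inj_def inj_on_def by metis
  define p where "p = z3 1"
  define c where "c = \<zeta>3 1"
  have p: "norm p < 1" and c: "cmod c < 1" using z3 \<zeta>3 by (simp_all add: p_def c_def)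
  have c': "cmod (- c) < 1" using c by simp
  define Z where "Z i = ballaut p (z3 i)" for i
  define C where "C i = moeb c (\<zeta>3 i)" for i
  have Zz: "ballaut p (Z i) = z3 i" for i unfolding Z_def by (rule ballaut_ballaut[OF p cip_neq_1[OF z3 p]])
  have C\<zeta>: "moeb (- c) (C i) = \<zeta>3 i" for i unfolding C_def using moeb_moeb[OF c] \<zeta>3 by (simp add: less_imp_le)
  obtain f where f: "solves z3 \<zeta>3 f" and ext: "\<And>g. solves z3 \<zeta>3 g \<Longrightarrow> \<not> closure (g ` ball 0 1) \<subseteq> ball 0 1"
    using assms(5) unfolding np_extremal_def sol by blast
  have "nonunique Z C"
  proof (rule nonunique_extremal_0[OF assms(1)])
    show "norm (Z i) < 1" for i unfolding Z_def by (rule ballaut_norm[OF p z3])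
    show "inj Z"
    proof (rule injI)
      fix i j assume "Z i = Z j"
      then have "z3 i = z3 j" using Zz[of i] Zz[of j] by simp
      then show "i = j" using inj3 by (simp add: inj_eq)
    qed
    show "Z 1 = 0" by (simp add: Z_def p_def[symmetric] ballaut_self[OF p])
    show "C 1 = 0" by (simp add: C_def c_def)
    show "solves Z C (\<lambda>w. moeb c (f (ballaut p w)))"
      by (rule solves_compose_moeb[OF c solves_compose_ballaut[OF p f Zz]]) (simp add: C_def)
    fix F r
    assume r: "r < 1" and F: "cn_holomorphic_on F (ball 0 1)" "\<And>w. norm w < 1 \<Longrightarrow> cmod (F w) \<le> r" "\<And>j. F (Z j) = C j"
    have "solves Z C F" unfolding solves_def using F r by (auto intro: le_less_trans)
    then have "solves z3 C (\<lambda>w. F (ballaut p w))"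
      by (rule solves_compose_ballaut[OF p]) (simp add: Z_def)
    then have g: "solves z3 \<zeta>3 (\<lambda>w. moeb (- c) (F (ballaut p w)))"
      by (rule solves_compose_moeb[OF c']) (rule C\<zeta>)
    \<comment> \<open>Undoing the normalisation preserves relative compactness: the image lies in
      that of a closed disc under \<open>moeb (- c)\<close>, a compact part of the open
      disc.\<close>
    have "(\<lambda>w. moeb (- c) (F (ballaut p w))) ` ball 0 1 \<subseteq> moeb (- c) ` cball 0 r"
      using F(2) ballaut_norm[OF p] by auto
    moreover have "compact (moeb (- c) ` cball 0 r)"
      by (rule compact_continuous_image[OF holomorphic_on_imp_continuous_on[OF holomorphic_on_subset[OF moeb_holomorphic[OF c']]] compact_cball])
        (use r in auto)
    ultimately have "closure ((\<lambda>w. moeb (- c) (F (ballaut p w))) ` ball 0 1) \<subseteq> moeb (- c) ` cball 0 r"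
      by (intro closure_minimal compact_imp_closed)
    also have "\<dots> \<subseteq> ball 0 1" using moeb_norm[OF c'] r by auto
    finally show False using ext[OF g] by blast
  qed
  then have "nonunique Z \<zeta>3" unfolding C_def[abs_def] by (rule nonunique_moeb[OF c \<zeta>3])
  then have "nonunique z3 \<zeta>3" unfolding Z_def[abs_def] by (rule nonunique_ballaut[OF p z3])
  then obtain f g w where "solves z3 \<zeta>3 f" "solves z3 \<zeta>3 g" "norm w < 1" "f w \<noteq> g w" unfolding nonunique_def by auto
  then show ?thesis unfolding sol by (intro exI[of _ f] exI[of _ g] conjI bexI[of _ w]) simp_all
qed

end
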